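(* Let $H$ be a reflexive semicomplete digraph. If $H$ contains neither $R$ nor $\vec{C}^*_3$ as an induced subdigraph, and $U(H^{sym})$ is a proper interval graph, then MinHOM($H$) is polynomial time solvable.
   Context: A homomorphism of $D$ to $H$ is a map $f:V(D)\to V(H)$ with $uv\in A(D)\Rightarrow f(u)f(v)\in A(H)$ (loops are arcs). MinHOM($H$): given a digraph $D$ and nonnegative costs $c_i(u)$ ($u\in V(D)$, $i\in V(H)$), find a homomorphism $f$ of $D$ to $H$ minimizing $\sum_u c_{f(u)}(u)$ or report none exists. A reflexive semicomplete digraph has a loop at every vertex and at least one arc between every pair of distinct vertices. $H^{sym}$: digraph on $V(H)$ whose arcs are those $uv\in A(H)$ with $vu\in A(H)$. $U(\cdot)$: underlying undirected graph. A proper interval graph is a (reflexive) graph isomorphic to the intersection graph of a family of inclusion-free intervals on the real line (possibly disconnected). $R$: reflexive digraph on $\{1,2,3\}$ with arcs $12,23,31,13,11,22,33$. $\vec{C}^*_3$: directed 3-cycle with a loop at each vertex. *)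

theory Defs
  imports
    "Graph_Theory.Digraph_Isomorphism"
    "HOL-Analysis.Topology_Euclidean_Space"
    "HOL-Computational_Algebra.Polynomial"
    "HOL-Library.Log_Nat"
begin

section \<open>Polynomial time\<close>

text \<open>
  Programs are while programs over natural numbers and binary trees.  Time is charged at
  logarithmic cost: evaluating an expression costs the bit size of the value of each of its
  subexpressions, so copying, arithmetic and tree operations are never cheaper than the size of
  the data produced, and every value written has size at most the running time.  Hence
  polynomial time in this model coincides with polynomial time on Turing machines.
\<close>

datatype data = Num nat | Node data data

primrec bitsize :: "data \<Rightarrow> nat" where
  "bitsize (Num n) = 1 + floorlog 2 n"
| "bitsize (Node a b) = 1 + bitsize a + bitsize b"

datatype expr =
    Lit nat
  | Var nat
  | Cons expr expr
  | Hd expr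
  | Tl expr
  | IsNode expr
  | Add expr expr
  | Sub expr expr
  | Mul expr expr
  | Leq expr expr

type_synonym state = "nat \<Rightarrow> data"

text \<open>Ill-typed operations are totalised: trees count as the number 0, and numbers have both
  components equal to 0.\<close>

fun num_of :: "data \<Rightarrow> nat" where
  "num_of (Num n) = n"
| "num_of (Node a b) = 0"

fun left :: "data \<Rightarrow> data" where
  "left (Num n) = Num 0"
| "left (Node a b) = a"

fun right :: "data \<Rightarrow> data" where
  "right (Num n) = Num 0"
| "right (Node a b) = b"

primrec eval_expr :: "expr \<Rightarrow> state \<Rightarrow> data" where
  "eval_expr (Lit n) s = Num n"
| "eval_expr (Var x) s = s x"
| "eval_expr (Cons e f) s = Node (eval_expr e s) (eval_expr f s)"
| "eval_expr (Hd e) s = left (eval_expr e s)"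
| "eval_expr (Tl e) s = right (eval_expr e s)"
| "eval_expr (IsNode e) s = Num (of_bool (\<exists>a b. eval_expr e s = Node a b))"
| "eval_expr (Add e f) s = Num (num_of (eval_expr e s) + num_of (eval_expr f s))"
| "eval_expr (Sub e f) s = Num (num_of (eval_expr e s) - num_of (eval_expr f s))"
| "eval_expr (Mul e f) s = Num (num_of (eval_expr e s) * num_of (eval_expr f s))"
| "eval_expr (Leq e f) s = Num (of_bool (num_of (eval_expr e s) \<le> num_of (eval_expr f s)))"

primrec expr_time :: "expr \<Rightarrow> state \<Rightarrow> nat" where
  "expr_time (Lit n) s = bitsize (Num n)"
| "expr_time (Var x) s = bitsize (s x)"
| "expr_time (Cons e f) s = bitsize (eval_expr (Cons e f) s) + expr_time e s + expr_time f s"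
| "expr_time (Hd e) s = bitsize (eval_expr (Hd e) s) + expr_time e s"
| "expr_time (Tl e) s = bitsize (eval_expr (Tl e) s) + expr_time e s"
| "expr_time (IsNode e) s = bitsize (eval_expr (IsNode e) s) + expr_time e s"
| "expr_time (Add e f) s = bitsize (eval_expr (Add e f) s) + expr_time e s + expr_time f s"
| "expr_time (Sub e f) s = bitsize (eval_expr (Sub e f) s) + expr_time e s + expr_time f s"
| "expr_time (Mul e f) s = bitsize (eval_expr (Mul e f) s) + expr_time e s + expr_time f s"
| "expr_time (Leq e f) s = bitsize (eval_expr (Leq e f) s) + expr_time e s + expr_time f s"

datatype com =
    Skip
  | Assign nat expr
  | Seq com com
  | If expr com com
  | While expr com

text \<open>\<open>exec p s t s'\<close>: started in state \<open>s\<close>, program \<open>p\<close> halts after time \<open>t\<close> in state \<open>s'\<close>.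
  A guard holds iff its value is not the number 0.\<close>

inductive exec :: "com \<Rightarrow> state \<Rightarrow> nat \<Rightarrow> state \<Rightarrow> bool" where
  Skip: "exec Skip s 1 s"
| Assign: "exec (Assign x e) s (1 + expr_time e s) (s(x := eval_expr e s))"
| Seq: "exec p s t s' \<Longrightarrow> exec q s' t' s'' \<Longrightarrow> exec (Seq p q) s (1 + t + t') s''"
| IfTrue: "eval_expr e s \<noteq> Num 0 \<Longrightarrow> exec p s t s' \<Longrightarrow>
    exec (If e p q) s (1 + expr_time e s + t) s'"
| IfFalse: "eval_expr e s = Num 0 \<Longrightarrow> exec q s t s' \<Longrightarrow>
    exec (If e p q) s (1 + expr_time e s + t) s'"
| WhileFalse: "eval_expr e s = Num 0 \<Longrightarrow> exec (While e p) s (1 + expr_time e s) s"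
| WhileTrue: "eval_expr e s \<noteq> Num 0 \<Longrightarrow> exec p s t s' \<Longrightarrow> exec (While e p) s' t' s'' \<Longrightarrow>
    exec (While e p) s (1 + expr_time e s + t + t') s''"

lemma exec_deterministic:
  "exec p s t s' \<Longrightarrow> exec p s u r \<Longrightarrow> u = t \<and> r = s'"
proof (induction arbitrary: u r rule: exec.induct)
  case (Seq p s t s' q t' s'')
  from Seq.prems show ?case by (cases rule: exec.cases) (use Seq.IH in blast)+
next
  case (IfTrue e s p t s' q)
  from IfTrue.prems show ?case by (cases rule: exec.cases) (use IfTrue in blast)+
next
  case (IfFalse e s q t s' p)
  from IfFalse.prems show ?case by (cases rule: exec.cases) (use IfFalse in blast)+
next
  case (WhileTrue e s p t s' t' s'')
  from WhileTrue.prems show ?case by (cases rule: exec.cases) (use WhileTrue in blast)+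
qed (auto elim: exec.cases)

text \<open>A computational problem is given by its instances, their encoding, and the relation
  between an instance and the admissible outputs.  Input and output are held in variable 0.\<close>

definition polytime_solvable ::
    "'i set \<Rightarrow> ('i \<Rightarrow> data) \<Rightarrow> ('i \<Rightarrow> data \<Rightarrow> bool) \<Rightarrow> bool" where
  "polytime_solvable inst enc sol \<longleftrightarrow>
    (\<exists>(p :: com) (q :: nat poly). \<forall>i\<in>inst. \<exists>t s'.
       exec p ((\<lambda>x. Num 0)(0 := enc i)) t s' \<and>
       t \<le> poly q (bitsize (enc i)) \<and>
       sol i (s' 0))"


section \<open>Minimum cost homomorphisms\<close>

definition digraph_hom :: "'b pair_pre_digraph \<Rightarrow> 'a pair_pre_digraph \<Rightarrow> ('b \<Rightarrow> 'a) \<Rightarrow> bool" where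
  "digraph_hom D H f \<longleftrightarrow>
    f ` pverts D \<subseteq> pverts H \<and> (\<forall>u v. (u, v) \<in> parcs D \<longrightarrow> (f u, f v) \<in> parcs H)"

definition hom_cost :: "'b pair_pre_digraph \<Rightarrow> ('b \<Rightarrow> 'a \<Rightarrow> rat) \<Rightarrow> ('b \<Rightarrow> 'a) \<Rightarrow> rat" where
  "hom_cost D c f = (\<Sum>u\<in>pverts D. c u (f u))"

definition min_cost_hom ::
    "'b pair_pre_digraph \<Rightarrow> 'a pair_pre_digraph \<Rightarrow> ('b \<Rightarrow> 'a \<Rightarrow> rat) \<Rightarrow> ('b \<Rightarrow> 'a) \<Rightarrow> bool" where
  "min_cost_hom D H c f \<longleftrightarrow>
    digraph_hom D H f \<and> (\<forall>g. digraph_hom D H g \<longrightarrow> hom_cost D c f \<le> hom_cost D c g)"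

text \<open>\<open>c u i\<close> is the cost \<open>c\<^sub>i(u)\<close> of mapping \<open>u\<close> to \<open>i\<close>.  Costs are rational, so that instances are
  finite objects; the vertices of an input digraph are numbered \<open>0, \<dots>, n - 1\<close>.\<close>

definition minhom_instances ::
    "'a pair_pre_digraph \<Rightarrow> (nat pair_pre_digraph \<times> (nat \<Rightarrow> 'a \<Rightarrow> rat)) set" where
  "minhom_instances H = {(D, c).
     pair_fin_digraph D \<and> pverts D = {..<card (pverts D)} \<and>
     (\<forall>u\<in>pverts D. \<forall>i\<in>pverts H. 0 \<le> c u i)}"

definition enc_list :: "data list \<Rightarrow> data" where
  "enc_list xs = foldr Node xs (Num 0)"

definition enc_rat :: "rat \<Rightarrow> data" where
  "enc_rat r = (case quotient_of r of (a, b) \<Rightarrow> Node (Num (nat a)) (Num (nat b)))"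

text \<open>Each vertex of \<open>D\<close> contributes its row of the adjacency matrix and its list of costs, the
  latter in the order in which \<open>vs\<close> enumerates the vertices of \<open>H\<close>.\<close>

fun enc_minhom :: "'a list \<Rightarrow> nat pair_pre_digraph \<times> (nat \<Rightarrow> 'a \<Rightarrow> rat) \<Rightarrow> data" where
  "enc_minhom vs (D, c) =
    (let n = card (pverts D) in
     enc_list (map (\<lambda>u. Node
       (enc_list (map (\<lambda>v. Num (of_bool ((u, v) \<in> parcs D))) [0..<n]))
       (enc_list (map (\<lambda>i. enc_rat (c u i)) vs))) [0..<n]))"

text \<open>The output is \<open>0\<close> if there is no homomorphism, and otherwise a pair of \<open>1\<close> and the list of the
  positions in \<open>vs\<close> of the images of \<open>0, \<dots>, n - 1\<close> under an optimal homomorphism.\<close>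

fun minhom_solution ::
    "'a pair_pre_digraph \<Rightarrow> 'a list \<Rightarrow> nat pair_pre_digraph \<times> (nat \<Rightarrow> 'a \<Rightarrow> rat) \<Rightarrow> data \<Rightarrow> bool" where
  "minhom_solution H vs (D, c) y \<longleftrightarrow>
    (if \<exists>f. digraph_hom D H f
     then \<exists>ks. y = Node (Num 1) (enc_list (map Num ks)) \<and>
            length ks = card (pverts D) \<and> (\<forall>k\<in>set ks. k < length vs) \<and>
            min_cost_hom D H c (\<lambda>u. vs ! (ks ! u))
     else y = Num 0)"

text \<open>\<open>H\<close> is not part of the input: program and polynomial may depend on \<open>H\<close>.\<close>

definition MinHOM_polytime :: "'a pair_pre_digraph \<Rightarrow> bool" where
  "MinHOM_polytime H \<longleftrightarrow>
    (\<forall>vs. distinct vs \<and> set vs = pverts H \<longrightarrow>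
       polytime_solvable (minhom_instances H) (enc_minhom vs) (minhom_solution H vs))"


section \<open>The target digraphs\<close>

definition reflexive_semicomplete :: "'a pair_pre_digraph \<Rightarrow> bool" where
  "reflexive_semicomplete H \<longleftrightarrow>
    (\<forall>u\<in>pverts H. (u, u) \<in> parcs H) \<and>
    (\<forall>u\<in>pverts H. \<forall>v\<in>pverts H. u \<noteq> v \<longrightarrow> (u, v) \<in> parcs H \<or> (v, u) \<in> parcs H)"

definition contains_induced :: "'a pair_pre_digraph \<Rightarrow> 'b pair_pre_digraph \<Rightarrow> bool" where
  "contains_induced H X \<longleftrightarrow>
    (\<exists>K. induced_subgraph K (with_proj H) \<and> digraph_iso K (with_proj X))"

definition digraph_R :: "nat pair_pre_digraph" where
  "digraph_R = \<lparr> pverts = {1, 2, 3},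
     parcs = {(1, 2), (2, 3), (3, 1), (1, 3), (1, 1), (2, 2), (3, 3)} \<rparr>"

definition reflexive_C3 :: "nat pair_pre_digraph" where
  "reflexive_C3 = \<lparr> pverts = {1, 2, 3},
     parcs = {(1, 2), (2, 3), (3, 1), (1, 1), (2, 2), (3, 3)} \<rparr>"

definition sym_part :: "'a pair_pre_digraph \<Rightarrow> 'a pair_pre_digraph" where
  "sym_part H = \<lparr> pverts = pverts H, parcs = {(u, v). (u, v) \<in> parcs H \<and> (v, u) \<in> parcs H} \<rparr>"

text \<open>Undirected graphs are represented by symmetric digraphs, and the underlying graph of a
  digraph is given by \<^const>\<open>mk_symmetric\<close>.  Since the intervals are nonempty, the condition for
  \<open>u = v\<close> says that there is a loop at every vertex.  Distinct vertices may have equal intervals.\<close>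

definition proper_interval_graph :: "'a pair_pre_digraph \<Rightarrow> bool" where
  "proper_interval_graph G \<longleftrightarrow>
    (\<exists>I :: 'a \<Rightarrow> real set.
       (\<forall>v\<in>pverts G. is_interval (I v) \<and> I v \<noteq> {}) \<and>
       (\<forall>u\<in>pverts G. \<forall>v\<in>pverts G. \<not> I u \<subset> I v) \<and>
       (\<forall>u\<in>pverts G. \<forall>v\<in>pverts G. (u, v) \<in> parcs G \<longleftrightarrow> I u \<inter> I v \<noteq> {}))"

end

theory Submission
  imports Defs
begin

text \<open>
  The asymmetric arcs of \<open>H\<close> form a semiorder, and listing the vertices along it yields a Min-Max
  ordering: with an arc, all arcs nested inside it in the same direction are present.  For such an
  ordering, homomorphisms from \<open>D\<close> are the sets of pairs \<open>(u, i)\<close>, read as \<open>f(u) \<ge> i\<close>, that are closed under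
  certain implications, and the cost is a sum of weights of such pairs.  A closed set of minimum
  weight is found by a flow that moves weight backwards along implications: augmentations by \<open>\<Delta>\<close>,
  for \<open>\<Delta>\<close> running through decreasing powers of two, each lower the total negative weight by \<open>\<Delta>\<close>, and
  every closed set bounds that quantity from below, so linearly many augmentations per \<open>\<Delta>\<close> suffice.
\<close>

section \<open>A calculus of polynomial time computable functions\<close>

text \<open>Two obstacles shape the development. Costs are given in binary, so augmentation without
  scaling might take exponentially many rounds. And the running time has to be proved for concrete
  programs, so the algorithm is a composition of folds with schedules fixed in advance: surplus
  rounds of a search, a walk or a phase are idle. For each fold the essential point is then a size
  bound on its accumulator. Whatever depends on \<open>H\<close> alone, such as the vertex order, is
  a constant of the program. A Min-Max ordering is what makes closed sets sufficient: if
  \<open>f(u) = p < q = f(v)\<close> for an arc \<open>uv\<close> of \<open>D\<close> although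
  \<open>pq\<close> is no arc of \<open>H\<close>, then no arc of \<open>H\<close> leads from a
  position up to \<open>p\<close> to one from \<open>q\<close> on, so that
  \<open>f(v) \<ge> q\<close> implies \<open>f(u) \<ge> p + 1\<close>, a contradiction; the case
  \<open>p > q\<close> is symmetric. The semiorder arises from the hypotheses as follows. Excluding
  \<open>R\<close> and the reflexive 3-cycle makes asymmetric arcs transitive; the posets 3+1 and
  2+2, which a semiorder must avoid, appear in the incomparability graph as a claw and an induced
  4-cycle.\<close>

definition polybound :: "'i set \<Rightarrow> ('i \<Rightarrow> data) \<Rightarrow> ('i \<Rightarrow> nat) \<Rightarrow> bool" where
  "polybound I e f \<longleftrightarrow> (\<exists>q :: nat poly. \<forall>i\<in>I. f i \<le> poly q (bitsize (e i)))"

text \<open>The program has its input and output in register \<open>k\<close> and preserves the registers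
  below \<open>k\<close>, so that programs compose.  An index \<open>i\<close> is an abstract input with encoding \<open>e i\<close>.\<close>

definition polytime :: "'i set \<Rightarrow> ('i \<Rightarrow> data) \<Rightarrow> ('i \<Rightarrow> data) \<Rightarrow> bool" where
  "polytime I e f \<longleftrightarrow> (\<forall>k. \<exists>p T. polybound I e T \<and> (\<forall>i\<in>I. \<forall>s. s k = e i \<longrightarrow>
     (\<exists>t s'. exec p s t s' \<and> t \<le> T i \<and> s' k = f i \<and> (\<forall>j<k. s' j = s j))))"

lemma bitsize_pos [simp]: "0 < bitsize d"
  by (cases d) auto

lemma poly_nat_mono: "x \<le> y \<Longrightarrow> poly (q :: nat poly) x \<le> poly q y"
  by (induction q) (auto intro!: add_mono mult_mono)

lemma polybound_const: "polybound I e (\<lambda>_. c)"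
  unfolding polybound_def by (rule exI[of _ "[:c:]"]) simp

lemma polybound_size: "polybound I e (\<lambda>i. bitsize (e i))"
  unfolding polybound_def by (rule exI[of _ "[:0, 1:]"]) simp

lemma polybound_add: "polybound I e f \<Longrightarrow> polybound I e g \<Longrightarrow> polybound I e (\<lambda>i. f i + g i)"
  unfolding polybound_def by (metis (no_types, lifting) add_mono poly_add)

lemma polybound_mult: "polybound I e f \<Longrightarrow> polybound I e g \<Longrightarrow> polybound I e (\<lambda>i. f i * g i)"
  unfolding polybound_def by (metis (no_types, lifting) mult_mono' poly_mult zero_le)

lemma polybound_mono: "polybound I e g \<Longrightarrow> (\<And>i. i \<in> I \<Longrightarrow> f i \<le> g i) \<Longrightarrow> polybound I e f"
  unfolding polybound_def by (meson order_trans)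

lemma polybound_poly:
  assumes "polybound I e f"
  shows "polybound I e (\<lambda>i. poly q (f i))"
proof -
  from assms obtain r where r: "\<And>i. i \<in> I \<Longrightarrow> f i \<le> poly r (bitsize (e i))"
    unfolding polybound_def by blast
  show ?thesis unfolding polybound_def
    by (rule exI[of _ "pcompose q r"]) (auto simp: poly_pcompose intro!: poly_nat_mono r)
qed

lemmas polybound_intros =
  polybound_const polybound_size polybound_add polybound_mult polybound_poly

lemma polybound_subset: "polybound I e f \<Longrightarrow> J \<subseteq> I \<Longrightarrow> polybound J e f"
  unfolding polybound_def by blast

lemma polybound_trans:
  assumes "polybound J e' f" and "\<And>i. i \<in> I \<Longrightarrow> \<phi> i \<in> J"
    and "polybound I e (\<lambda>i. bitsize (e' (\<phi> i)))"
  shows "polybound I e (\<lambda>i. f (\<phi> i))"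
proof -
  from assms(1) obtain q where q: "\<And>j. j \<in> J \<Longrightarrow> f j \<le> poly q (bitsize (e' j))"
    unfolding polybound_def by blast
  show ?thesis
    by (rule polybound_mono[OF polybound_poly[OF assms(3), of q]]) (use assms(2) q in auto)
qed

section \<open>Bit lengths of arithmetic results and of program outputs\<close>

lemma floorlog_add_le: "floorlog 2 (a + b) \<le> floorlog 2 a + floorlog 2 b"
proof (cases "a = 0 \<or> b = 0")
  case True
  then show ?thesis by auto
next
  case False
  define p where "p = floorlog 2 a"
  define q where "q = floorlog 2 b"
  have a: "a < 2 ^ p" and b: "b < 2 ^ q"
    using floorlog_le_iff[of 2 a p] floorlog_le_iff[of 2 b q] by (auto simp: p_def q_def)
  obtain m n where mn: "p = Suc m" "q = Suc n"
    using False a b by (cases p; cases q) auto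
  have "a + b < 2 * 2 ^ m + 2 * 2 ^ n" using a b mn by simp
  \<comment> \<open>The right side is \<open>4 * 2 ^ m * 2 ^ n\<close>; with
    \<open>2 ^ m = Suc x\<close> and \<open>2 ^ n = Suc y\<close> it exceeds the left side by
    \<open>4 * x * y + 2 * x + 2 * y\<close>.\<close>
  also have "\<dots> \<le> 2 ^ (p + q)"
  proof -
    have "(1::nat) \<le> 2 ^ m" "(1::nat) \<le> 2 ^ n" by simp_all
    then obtain x y where "(2::nat) ^ m = Suc x" "(2::nat) ^ n = Suc y"
      by (metis Suc_le_D One_nat_def)
    then show ?thesis using mn by (simp add: power_add algebra_simps)
  qed
  finally show ?thesis
    using floorlog_le_iff[of 2 "a + b" "p + q"] by (simp add: p_def q_def)
qed

lemma floorlog_mult_le: "floorlog 2 (a * b) \<le> floorlog 2 a + floorlog 2 b"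
proof -
  have "a < 2 ^ floorlog 2 a" "b < 2 ^ floorlog 2 b"
    using floorlog_le_iff[of 2 a "floorlog 2 a"] floorlog_le_iff[of 2 b "floorlog 2 b"] by auto
  then have "a * b < 2 ^ (floorlog 2 a + floorlog 2 b)"
    by (simp add: power_add mult_strict_mono')
  then show ?thesis using floorlog_le_iff[of 2 "a * b"] by simp
qed

lemma floorlog_le_self: "floorlog 2 a \<le> a"
  using floorlog_le_iff[of 2 a a] by simp

lemma floorlog_two_power: "floorlog 2 (2 ^ n) = n + 1"
  using floorlog_power[of 1 2 n] by (simp add: floorlog_def)

lemma bitsize_num_of: "bitsize (Num (num_of d)) \<le> bitsize d"
  by (cases d) (auto simp: floorlog_def)

lemma bitsize_left: "bitsize (left d) \<le> bitsize d"
  by (cases d) (auto simp: floorlog_def)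

lemma bitsize_right: "bitsize (right d) \<le> bitsize d"
  by (cases d) (auto simp: floorlog_def)

lemma bitsize_eval_le: "bitsize (eval_expr e s) \<le> expr_time e s"
  by (cases e) auto

text \<open>Since every value written is paid for, output sizes are bounded by running times.\<close>

lemma exec_bitsize: "exec p s t s' \<Longrightarrow> bitsize (s' j) \<le> bitsize (s j) + t"
  by (induction rule: exec.induct) (auto intro: bitsize_eval_le le_SucI trans_le_add2)

lemma polytime_bitsize:
  assumes "polytime I e f"
  shows "polybound I e (\<lambda>i. bitsize (f i))"
proof -
  from assms[unfolded polytime_def, rule_format, of 0] obtain p T where T: "polybound I e T"
    and ex: "\<And>i s. i \<in> I \<Longrightarrow> s 0 = e i \<Longrightarrow> \<exists>t s'. exec p s t s' \<and> t \<le> T i \<and> s' 0 = f i"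
    by blast
  have "bitsize (f i) \<le> bitsize (e i) + T i" if i: "i \<in> I" for i
  proof -
    obtain t s' where "exec p (\<lambda>_. e i) t s'" "t \<le> T i" "s' 0 = f i"
      using ex[OF i, of "\<lambda>_. e i"] by auto
    with exec_bitsize[of p "\<lambda>_. e i" t s' 0] show ?thesis by auto
  qed
  then show ?thesis by (intro polybound_mono[OF polybound_add[OF polybound_size T]])
qed

lemma polytime_subset: "polytime I e f \<Longrightarrow> J \<subseteq> I \<Longrightarrow> polytime J e f"
  unfolding polytime_def by (meson polybound_subset subsetD)

lemma polytime_cong: "polytime I e f \<Longrightarrow> (\<And>i. i \<in> I \<Longrightarrow> f i = g i) \<Longrightarrow> polytime I e g"
  unfolding polytime_def by simp

section \<open>Composition, single expressions, pairing and branching\<close>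

lemma polytime_self: "polytime I e e"
  unfolding polytime_def
proof
  fix k
  show "\<exists>p T. polybound I e T \<and> (\<forall>i\<in>I. \<forall>s. s k = e i \<longrightarrow>
     (\<exists>t s'. exec p s t s' \<and> t \<le> T i \<and> s' k = e i \<and> (\<forall>j<k. s' j = s j)))"
    by (rule exI[of _ Skip], rule exI[of _ "\<lambda>_. 1"]) (use exec.Skip polybound_const in fastforce)
qed

text \<open>The intermediate value has polynomial size by \<open>polytime_bitsize\<close>, so a time
  bound in terms of that size is polynomial in the original input. The map \<open>\<phi>\<close>
  allows the second function to have abstract inputs of another type; only the encodings have to
  match.\<close>

lemma polytime_comp:
  assumes "polytime I e f" "polytime J f' g"
    and \<phi>: "\<And>i. i \<in> I \<Longrightarrow> \<phi> i \<in> J" "\<And>i. i \<in> I \<Longrightarrow> f' (\<phi> i) = f i"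
  shows "polytime I e (\<lambda>i. g (\<phi> i))"
  unfolding polytime_def
proof
  fix k
  from assms(1)[unfolded polytime_def, rule_format, of k] obtain p T where T: "polybound I e T"
    and p: "\<And>i s. i \<in> I \<Longrightarrow> s k = e i \<Longrightarrow>
      \<exists>t s'. exec p s t s' \<and> t \<le> T i \<and> s' k = f i \<and> (\<forall>j<k. s' j = s j)" by blast
  from assms(2)[unfolded polytime_def, rule_format, of k] obtain q U where U: "polybound J f' U"
    and q: "\<And>i s. i \<in> J \<Longrightarrow> s k = f' i \<Longrightarrow>
      \<exists>t s'. exec q s t s' \<and> t \<le> U i \<and> s' k = g i \<and> (\<forall>j<k. s' j = s j)" by blast
  have "polybound I e (\<lambda>i. bitsize (f' (\<phi> i)))"
    by (rule polybound_mono[OF polytime_bitsize[OF assms(1)]]) (simp add: \<phi>)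
  with \<phi> have U': "polybound I e (\<lambda>i. U (\<phi> i))" by (intro polybound_trans[OF U])
  show "\<exists>p T. polybound I e T \<and> (\<forall>i\<in>I. \<forall>s. s k = e i \<longrightarrow>
     (\<exists>t s'. exec p s t s' \<and> t \<le> T i \<and> s' k = g (\<phi> i) \<and> (\<forall>j<k. s' j = s j)))"
  proof (intro exI[of _ "Seq p q"] exI[of _ "\<lambda>i. 1 + T i + U (\<phi> i)"] conjI ballI allI impI)
    show "polybound I e (\<lambda>i. 1 + T i + U (\<phi> i))" by (intro polybound_add polybound_const T U')
    fix i s assume i: "i \<in> I" and s: "s k = e i"
    obtain t s' where 1: "exec p s t s'" "t \<le> T i" "s' k = f i" "\<forall>j<k. s' j = s j"
      using p[where s=s, OF i s] by blast
    obtain t' s'' where 2: "exec q s' t' s''" "t' \<le> U (\<phi> i)" "s'' k = g (\<phi> i)" "\<forall>j<k. s'' j = s' j"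
      using q[of "\<phi> i" s'] 1(3) \<phi>[OF i] by auto
    have "exec (Seq p q) s (1 + t + t') s''" using 1(1) 2(1) by (rule exec.Seq)
    with 1 2 show "\<exists>t s'. exec (Seq p q) s t s' \<and> t \<le> 1 + T i + U (\<phi> i) \<and> s' k = g (\<phi> i) \<and>
        (\<forall>j<k. s' j = s j)"
      by (intro exI[of _ "1 + t + t'"] exI[of _ s'']) auto
  qed
qed

text \<open>As \<open>h\<close> acts on the value alone, it is enough to treat data as inputs that
  encode themselves, and to compose.\<close>

lemma polytime_expr:
  assumes f: "polytime I e f"
    and ev: "\<And>k s. eval_expr (E k) s = h (s k)"
    and time: "\<And>k s. expr_time (E k) s \<le> poly q (bitsize (s k))"
  shows "polytime I e (\<lambda>i. h (f i))"
proof (rule polytime_comp[OF f, of UNIV id h])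
  show "polytime UNIV id h"
    unfolding polytime_def
  proof
    fix k
    show "\<exists>p T. polybound UNIV id T \<and> (\<forall>i\<in>UNIV. \<forall>s. s k = id i \<longrightarrow>
       (\<exists>t s'. exec p s t s' \<and> t \<le> T i \<and> s' k = h i \<and> (\<forall>j<k. s' j = s j)))"
    proof (intro exI[of _ "Assign k (E k)"] exI[of _ "\<lambda>d. 1 + poly q (bitsize (id d))"]
        conjI ballI allI impI)
      show "polybound UNIV id (\<lambda>d. 1 + poly q (bitsize (id d)))"
        by (intro polybound_intros)
      fix d and s :: state assume "s k = id d"
      then show "\<exists>t s'. exec (Assign k (E k)) s t s' \<and> t \<le> 1 + poly q (bitsize (id d)) \<and>
          s' k = h d \<and> (\<forall>j<k. s' j = s j)"
        using time[of k s] exec.Assign[of k "E k" s]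
        by (intro exI[of _ "1 + expr_time (E k) s"] exI[of _ "s(k := eval_expr (E k) s)"])
          (auto simp: ev)
    qed
  qed
qed auto

lemma polytime_left: "polytime I e f \<Longrightarrow> polytime I e (\<lambda>i. left (f i))"
  by (rule polytime_expr[where E = "\<lambda>k. Hd (Var k)" and q = "[:0, 2:]"])
    (auto simp: mult_2_right bitsize_left)

lemma polytime_right: "polytime I e f \<Longrightarrow> polytime I e (\<lambda>i. right (f i))"
  by (rule polytime_expr[where E = "\<lambda>k. Tl (Var k)" and q = "[:0, 2:]"])
    (auto simp: mult_2_right bitsize_right)

primrec const_expr :: "data \<Rightarrow> expr" where
  "const_expr (Num n) = Lit n"
| "const_expr (Node a b) = Cons (const_expr a) (const_expr b)"

lemma eval_const_expr [simp]: "eval_expr (const_expr d) s = d"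
  by (induction d) auto

lemma expr_time_const_expr: "expr_time (const_expr d) s = expr_time (const_expr d) (\<lambda>_. Num 0)"
  by (induction d) auto

text \<open>This is how tables that depend only on the fixed target enter a program: they are
  spelled out as an expression of constant cost.\<close>

lemma polytime_const: "polytime I e (\<lambda>_. d)"
proof (rule polytime_expr[OF polytime_self, where E = "\<lambda>k. const_expr d" and h = "\<lambda>_. d"
      and q = "[:expr_time (const_expr d) (\<lambda>_. Num 0):]"])
  show "expr_time (const_expr d) s \<le> poly [:expr_time (const_expr d) (\<lambda>_. Num 0):] (bitsize (s k))"
    for k :: nat and s
    by (subst expr_time_const_expr) simp
qed auto

text \<open>The input is copied upwards before each part runs. The first part, working from
  \<open>k+1\<close>, leaves the input in \<open>k\<close> intact for the second, and the second,
  working from \<open>k+2\<close>, leaves the first result in \<open>k+1\<close>.\<close>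

lemma polytime_Node:
  assumes f: "polytime I e f" and g: "polytime I e g"
  shows "polytime I e (\<lambda>i. Node (f i) (g i))"
  unfolding polytime_def
proof
  fix k
  from f[unfolded polytime_def, rule_format, of "k+1"] obtain p T where T: "polybound I e T"
    and p: "\<And>i s. i \<in> I \<Longrightarrow> s (k+1) = e i \<Longrightarrow>
      \<exists>t s'. exec p s t s' \<and> t \<le> T i \<and> s' (k+1) = f i \<and> (\<forall>j<k+1. s' j = s j)" by blast
  from g[unfolded polytime_def, rule_format, of "k+2"] obtain q U where U: "polybound I e U"
    and q: "\<And>i s. i \<in> I \<Longrightarrow> s (k+2) = e i \<Longrightarrow>
      \<exists>t s'. exec q s t s' \<and> t \<le> U i \<and> s' (k+2) = g i \<and> (\<forall>j<k+2. s' j = s j)" by blast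
  let ?P = "Seq (Assign (k+1) (Var k)) (Seq p (Seq (Assign (k+2) (Var k)) (Seq q
     (Assign k (Cons (Var (k+1)) (Var (k+2)))))))"
  let ?T = "\<lambda>i. 8 + 2 * bitsize (e i) + T i + U i + 2 * bitsize (f i) + 2 * bitsize (g i)"
  show "\<exists>p T. polybound I e T \<and> (\<forall>i\<in>I. \<forall>s. s k = e i \<longrightarrow>
     (\<exists>t s'. exec p s t s' \<and> t \<le> T i \<and> s' k = Node (f i) (g i) \<and> (\<forall>j<k. s' j = s j)))"
  proof (intro exI[of _ ?P] exI[of _ ?T] conjI ballI allI impI)
    show "polybound I e ?T" by (intro polybound_intros T U polytime_bitsize[OF f] polytime_bitsize[OF g])
    fix i s assume i: "i \<in> I" and s: "s k = e i"
    define s1 where "s1 = s(k+1 := e i)"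
    have e1: "exec (Assign (k+1) (Var k)) s (1 + bitsize (e i)) s1"
      using exec.Assign[of "k+1" "Var k" s] s by (simp add: s1_def)
    obtain t2 s2 where e2: "exec p s1 t2 s2" and 2: "t2 \<le> T i" "s2 (k+1) = f i" "\<forall>j<k+1. s2 j = s1 j"
      using p[where s=s1, OF i] by (auto simp: s1_def)
    define s3 where "s3 = s2(k+2 := e i)"
    have e3: "exec (Assign (k+2) (Var k)) s2 (1 + bitsize (e i)) s3"
      using exec.Assign[of "k+2" "Var k" s2] s 2 by (simp add: s3_def s1_def)
    obtain t4 s4 where e4: "exec q s3 t4 s4" and 4: "t4 \<le> U i" "s4 (k+2) = g i" "\<forall>j<k+2. s4 j = s3 j"
      using q[where s=s3, OF i] by (auto simp: s3_def)
    have v: "s4 (k+1) = f i" "s4 (k+2) = g i" using 4 2 by (auto simp: s3_def)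
    have e5: "exec (Assign k (Cons (Var (k+1)) (Var (k+2)))) s4
        (2 + (bitsize (f i) + bitsize (g i)) + (bitsize (f i) + bitsize (g i))) (s4(k := Node (f i) (g i)))"
      using exec.Assign[of k "Cons (Var (k+1)) (Var (k+2))" s4] v by (simp add: add_ac)
    note ex = exec.Seq[OF e1 exec.Seq[OF e2 exec.Seq[OF e3 exec.Seq[OF e4 e5]]]]
    show "\<exists>t s'. exec ?P s t s' \<and> t \<le> ?T i \<and> s' k = Node (f i) (g i) \<and> (\<forall>j<k. s' j = s j)"
      by (intro exI conjI, rule ex) (use 2 4 in \<open>auto simp: s1_def s3_def\<close>)
  qed
qed

text \<open>Each branch is required only where its guard holds, so that lookups valid under the
  guard may occur in it.\<close>

lemma polytime_If:
  assumes b: "polytime I e (\<lambda>i. Num (of_bool (P i)))"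
    and f: "polytime {i\<in>I. P i} e f" and g: "polytime {i\<in>I. \<not> P i} e g"
  shows "polytime I e (\<lambda>i. if P i then f i else g i)"
  unfolding polytime_def
proof
  fix k
  from b[unfolded polytime_def, rule_format, of "k+1"] obtain p T where T: "polybound I e T"
    and p: "\<And>i s. i \<in> I \<Longrightarrow> s (k+1) = e i \<Longrightarrow> \<exists>t s'. exec p s t s' \<and> t \<le> T i \<and>
        s' (k+1) = Num (of_bool (P i)) \<and> (\<forall>j<k+1. s' j = s j)" by blast
  from f[unfolded polytime_def, rule_format, of k] obtain q U where U: "polybound {i\<in>I. P i} e U"
    and q: "\<And>i s. i \<in> I \<Longrightarrow> P i \<Longrightarrow> s k = e i \<Longrightarrow>
      \<exists>t s'. exec q s t s' \<and> t \<le> U i \<and> s' k = f i \<and> (\<forall>j<k. s' j = s j)" by blast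
  from g[unfolded polytime_def, rule_format, of k] obtain r V where V: "polybound {i\<in>I. \<not> P i} e V"
    and r: "\<And>i s. i \<in> I \<Longrightarrow> \<not> P i \<Longrightarrow> s k = e i \<Longrightarrow>
      \<exists>t s'. exec r s t s' \<and> t \<le> V i \<and> s' k = g i \<and> (\<forall>j<k. s' j = s j)" by blast
  \<comment> \<open>\<open>U\<close> and \<open>V\<close> are bounded only on their own parts of
    \<open>I\<close>; the polynomials serve as bounds on all of \<open>I\<close>.\<close>
  from U V obtain u v where u: "\<And>i. i \<in> I \<Longrightarrow> P i \<Longrightarrow> U i \<le> poly u (bitsize (e i))"
    and v: "\<And>i. i \<in> I \<Longrightarrow> \<not> P i \<Longrightarrow> V i \<le> poly v (bitsize (e i))"
    unfolding polybound_def by blast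
  let ?P = "Seq (Assign (k+1) (Var k)) (Seq p (If (Var (k+1)) q r))"
  let ?T = "\<lambda>i. 6 + bitsize (e i) + T i + poly u (bitsize (e i)) + poly v (bitsize (e i))"
  show "\<exists>p T. polybound I e T \<and> (\<forall>i\<in>I. \<forall>s. s k = e i \<longrightarrow> (\<exists>t s'. exec p s t s' \<and> t \<le> T i \<and>
      s' k = (if P i then f i else g i) \<and> (\<forall>j<k. s' j = s j)))"
  proof (intro exI[of _ ?P] exI[of _ ?T] conjI ballI allI impI)
    show "polybound I e ?T" by (intro polybound_intros T)
    fix i s assume i: "i \<in> I" and s: "s k = e i"
    define s1 where "s1 = s(k+1 := e i)"
    have e1: "exec (Assign (k+1) (Var k)) s (1 + bitsize (e i)) s1"
      using exec.Assign[of "k+1" "Var k" s] s by (simp add: s1_def)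
    obtain t2 s2 where e2: "exec p s1 t2 s2" and 2: "t2 \<le> T i" "s2 (k+1) = Num (of_bool (P i))"
      "\<forall>j<k+1. s2 j = s1 j"
      using p[where s=s1, OF i] by (auto simp: s1_def)
    have s2: "s2 k = e i" using 2 s by (simp add: s1_def)
    show "\<exists>t s'. exec ?P s t s' \<and> t \<le> ?T i \<and> s' k = (if P i then f i else g i) \<and>
        (\<forall>j<k. s' j = s j)"
    proof (cases "P i")
      case True
      obtain t3 s3 where e3: "exec q s2 t3 s3" and 3: "t3 \<le> U i" "s3 k = f i" "\<forall>j<k. s3 j = s2 j"
        using q[where s=s2, OF i True s2] by blast
      have e4: "exec (If (Var (k+1)) q r) s2 (1 + expr_time (Var (k+1)) s2 + t3) s3"
        using True 2 e3 by (intro exec.IfTrue) auto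
      show ?thesis
        by (intro exI conjI, rule exec.Seq[OF e1 exec.Seq[OF e2 e4]])
          (use 2 3 True u[OF i True] in \<open>auto simp: s1_def floorlog_def\<close>)
    next
      case False
      obtain t3 s3 where e3: "exec r s2 t3 s3" and 3: "t3 \<le> V i" "s3 k = g i" "\<forall>j<k. s3 j = s2 j"
        using r[where s=s2, OF i False s2] by blast
      have e4: "exec (If (Var (k+1)) q r) s2 (1 + expr_time (Var (k+1)) s2 + t3) s3"
        using False 2 e3 by (intro exec.IfFalse) auto
      show ?thesis
        by (intro exI conjI, rule exec.Seq[OF e1 exec.Seq[OF e2 e4]])
          (use 2 3 False v[OF i False] in \<open>auto simp: s1_def floorlog_def\<close>)
    qed
  qed
qed

subsection \<open>Arithmetic\<close>

lemma bitsize_add: "bitsize (Num (a + b)) \<le> bitsize (Num a) + bitsize (Num b)"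
  using floorlog_add_le[of a b] by simp

lemma bitsize_mult: "bitsize (Num (a * b)) \<le> bitsize (Num a) + bitsize (Num b)"
  using floorlog_mult_le[of a b] by simp

lemma bitsize_mono: "a \<le> b \<Longrightarrow> bitsize (Num a) \<le> bitsize (Num b)"
  by (simp add: floorlog_mono)

lemma polytime_arith:
  assumes f: "polytime I e (\<lambda>i. Num (f i))" and g: "polytime I e (\<lambda>i. Num (g i))"
    and ev: "\<And>x y s. eval_expr (op x y) s = Num (h (num_of (eval_expr x s)) (num_of (eval_expr y s)))"
    and time: "\<And>x y s. expr_time (op x y) s = bitsize (eval_expr (op x y) s) + expr_time x s + expr_time y s"
    and size: "\<And>a b. bitsize (Num (h a b)) \<le> bitsize (Num a) + bitsize (Num b)"
  shows "polytime I e (\<lambda>i. Num (h (f i) (g i)))"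
proof -
  have "polytime I e (\<lambda>i. (\<lambda>d. Num (h (num_of (left d)) (num_of (right d)))) (Node (Num (f i)) (Num (g i))))"
  proof (rule polytime_expr[OF polytime_Node[OF f g],
        where E = "\<lambda>k. op (Hd (Var k)) (Tl (Var k))" and q = "[:0, 6:]"])
    fix k :: nat and s :: state
    have "bitsize (Num (h (num_of (left (s k))) (num_of (right (s k))))) \<le>
        bitsize (left (s k)) + bitsize (right (s k))"
      using size[of "num_of (left (s k))" "num_of (right (s k))"]
        bitsize_num_of[of "left (s k)"] bitsize_num_of[of "right (s k)"] by linarith
    then show "expr_time (op (Hd (Var k)) (Tl (Var k))) s \<le> poly [:0, 6:] (bitsize (s k))"
      using bitsize_left[of "s k"] bitsize_right[of "s k"] by (simp add: time ev)
  qed (simp add: ev)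
  then show ?thesis by simp
qed

lemma polytime_add:
  "polytime I e (\<lambda>i. Num (f i)) \<Longrightarrow> polytime I e (\<lambda>i. Num (g i)) \<Longrightarrow>
    polytime I e (\<lambda>i. Num (f i + g i))"
  by (rule polytime_arith[where op = Add]) (use bitsize_add in auto)

lemma polytime_mult:
  "polytime I e (\<lambda>i. Num (f i)) \<Longrightarrow> polytime I e (\<lambda>i. Num (g i)) \<Longrightarrow>
    polytime I e (\<lambda>i. Num (f i * g i))"
  by (rule polytime_arith[where op = Mul]) (use bitsize_mult in auto)

lemma polytime_diff:
  "polytime I e (\<lambda>i. Num (f i)) \<Longrightarrow> polytime I e (\<lambda>i. Num (g i)) \<Longrightarrow>
    polytime I e (\<lambda>i. Num (f i - g i))"
  by (rule polytime_arith[where op = Sub and h = "(-)"]) (auto intro!: le_SucI trans_le_add1 floorlog_mono)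

abbreviation polytime_pred :: "'i set \<Rightarrow> ('i \<Rightarrow> data) \<Rightarrow> ('i \<Rightarrow> bool) \<Rightarrow> bool" where
  "polytime_pred I e P \<equiv> polytime I e (\<lambda>i. Num (of_bool (P i)))"

lemma polytime_le:
  "polytime I e (\<lambda>i. Num (f i)) \<Longrightarrow> polytime I e (\<lambda>i. Num (g i)) \<Longrightarrow>
    polytime_pred I e (\<lambda>i. f i \<le> g i)"
  by (rule polytime_arith[where op = Leq and h = "\<lambda>a b. of_bool (a \<le> b)"]) (auto simp: floorlog_def)

lemma polytime_not:
  assumes "polytime_pred I e P"
  shows "polytime_pred I e (\<lambda>i. \<not> P i)"
  by (rule polytime_cong[OF polytime_diff[OF polytime_const[of I e "Num 1"] assms]]) auto

lemma polytime_conj: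
  assumes "polytime_pred I e P" "polytime_pred I e Q"
  shows "polytime_pred I e (\<lambda>i. P i \<and> Q i)"
  by (rule polytime_cong[OF polytime_mult[OF assms]]) auto

lemma polytime_disj:
  assumes "polytime_pred I e P" "polytime_pred I e Q"
  shows "polytime_pred I e (\<lambda>i. P i \<or> Q i)"
  using polytime_not[OF polytime_conj[OF polytime_not[OF assms(1)] polytime_not[OF assms(2)]]]
  by simp

lemma polytime_less:
  "polytime I e (\<lambda>i. Num (f i)) \<Longrightarrow> polytime I e (\<lambda>i. Num (g i)) \<Longrightarrow>
    polytime_pred I e (\<lambda>i. f i < g i)"
  using polytime_not[OF polytime_le[of I e g f]] by (simp add: not_le)

lemma polytime_eq:
  assumes "polytime I e (\<lambda>i. Num (f i))" "polytime I e (\<lambda>i. Num (g i))"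
  shows "polytime_pred I e (\<lambda>i. f i = g i)"
  using polytime_conj[OF polytime_le[OF assms] polytime_le[OF assms(2,1)]]
  by (simp add: eq_iff)

lemma polytime_num_If:
  assumes "polytime_pred I e P" "polytime {i\<in>I. P i} e (\<lambda>i. Num (f i))"
    "polytime {i\<in>I. \<not> P i} e (\<lambda>i. Num (g i))"
  shows "polytime I e (\<lambda>i. Num (if P i then f i else g i))"
  by (rule polytime_cong[OF polytime_If[OF assms]]) auto

subsection \<open>Lists\<close>

abbreviation enc_map :: "('x \<Rightarrow> data) \<Rightarrow> 'x list \<Rightarrow> data" where
  "enc_map \<phi> xs \<equiv> enc_list (map \<phi> xs)"

lemma enc_list_simps [simp]: "enc_list [] = Num 0" "enc_list (x # xs) = Node x (enc_list xs)"
  by (auto simp: enc_list_def)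

lemma bitsize_enc_list: "bitsize (enc_list xs) = 1 + (\<Sum>x\<leftarrow>xs. 1 + bitsize x)"
  by (induction xs) (auto simp: floorlog_def)

lemma bitsize_enc_list_append:
  "bitsize (enc_list (xs @ ys)) + 1 = bitsize (enc_list xs) + bitsize (enc_list ys)"
  by (simp add: bitsize_enc_list)

lemma bitsize_enc_list_rev [simp]: "bitsize (enc_list (rev xs)) = bitsize (enc_list xs)"
  by (simp add: bitsize_enc_list rev_map[symmetric])

lemma bitsize_mem: "x \<in> set xs \<Longrightarrow> bitsize (\<phi> x) \<le> bitsize (enc_map \<phi> xs)"
  by (induction xs) auto

lemma length_le_bitsize: "length xs \<le> bitsize (enc_map \<phi> xs)"
  by (induction xs) auto

text \<open>Bodies of loops are computed in an environment that is extended by the loop variables.\<close>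

definition ext :: "('i \<Rightarrow> data) \<Rightarrow> ('i \<times> 'x \<Rightarrow> data) \<Rightarrow> 'i \<times> 'x \<Rightarrow> data" where
  "ext e \<phi> = (\<lambda>j. Node (e (fst j)) (\<phi> j))"

section \<open>Loops over lists and operations built from them\<close>

lemma polytime_lift:
  assumes "polytime I e f" "\<And>j. j \<in> J \<Longrightarrow> fst j \<in> I"
  shows "polytime J (ext e \<phi>) (\<lambda>j. f (fst j))"
proof -
  have "polytime J (ext e \<phi>) (\<lambda>j. left (ext e \<phi> j))" by (intro polytime_left polytime_self)
  from polytime_comp[OF this assms(1), of fst] assms(2) show ?thesis by (simp add: ext_def)
qed

lemma polytime_top: "polytime J (ext e \<phi>) \<phi>"
  using polytime_right[OF polytime_self[of J "ext e \<phi>"]] by (simp add: ext_def)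

text \<open>Iterating a polynomial time body can blow up, since the accumulator may double in each
  round. The bound \<open>B\<close>, required after every prefix of the list, excludes this; the
  rounds are then uniformly polynomial and their number is the length of the list. The invariant
  \<open>A\<close> is what the body may assume about the accumulator, and \<open>\<psi>\<close>
  depends on \<open>i\<close> because the format of the accumulator may, as for vectors of length
  \<open>N i\<close>.\<close>

lemma polytime_fold:
  fixes xs :: "'i \<Rightarrow> 'x list" and \<psi> :: "'i \<Rightarrow> 'a \<Rightarrow> data"
  assumes xs: "polytime I e (\<lambda>i. enc_map \<phi> (xs i))"
    and init: "polytime I e (\<lambda>i. \<psi> i (a0 i))"
    and step: "polytime {((i, x), a). i \<in> I \<and> x \<in> set (xs i) \<and> A i a}
      (ext (ext e (\<lambda>j. \<phi> (snd j))) (\<lambda>j. \<psi> (fst (fst j)) (snd j)))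
      (\<lambda>j. \<psi> (fst (fst j)) (F (fst (fst j)) (snd (fst j)) (snd j)))"
    and inv0: "\<And>i. i \<in> I \<Longrightarrow> A i (a0 i)"
    and inv: "\<And>i x a. i \<in> I \<Longrightarrow> x \<in> set (xs i) \<Longrightarrow> A i a \<Longrightarrow> A i (F i x a)"
    and B: "polybound I e B"
    and bound: "\<And>i ys zs. i \<in> I \<Longrightarrow> xs i = ys @ zs \<Longrightarrow> bitsize (\<psi> i (fold (F i) ys (a0 i))) \<le> B i"
  shows "polytime I e (\<lambda>i. \<psi> i (fold (F i) (xs i) (a0 i)))"
  unfolding polytime_def
proof
  fix k
  define J where "J = {((i, x), a). i \<in> I \<and> x \<in> set (xs i) \<and> A i a}"
  define e' where "e' = ext (ext e (\<lambda>j. \<phi> (snd j))) (\<lambda>j. \<psi> (fst (fst j)) (snd j))"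
  have e': "e' ((i, x), a) = Node (Node (e i) (\<phi> x)) (\<psi> i a)" for i x a
    by (simp add: e'_def ext_def)
  from xs[unfolded polytime_def, rule_format, of "k+1"] obtain p T where T: "polybound I e T"
    and p: "\<And>i s. i \<in> I \<Longrightarrow> s (k+1) = e i \<Longrightarrow> \<exists>t s'. exec p s t s' \<and> t \<le> T i \<and>
      s' (k+1) = enc_map \<phi> (xs i) \<and> (\<forall>j<k+1. s' j = s j)" by blast
  from init[unfolded polytime_def, rule_format, of "k+2"] obtain q U where U: "polybound I e U"
    and q: "\<And>i s. i \<in> I \<Longrightarrow> s (k+2) = e i \<Longrightarrow> \<exists>t s'. exec q s t s' \<and> t \<le> U i \<and>
      s' (k+2) = \<psi> i (a0 i) \<and> (\<forall>j<k+2. s' j = s j)" by blast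
  from step[folded J_def e'_def, unfolded polytime_def, rule_format, of "k+3"]
  obtain r V where V: "polybound J e' V"
    and r: "\<And>j s. j \<in> J \<Longrightarrow> s (k+3) = e' j \<Longrightarrow> \<exists>t s'. exec r s t s' \<and> t \<le> V j \<and>
      s' (k+3) = \<psi> (fst (fst j)) (F (fst (fst j)) (snd (fst j)) (snd j)) \<and> (\<forall>j<k+3. s' j = s j)"
    by blast
  from V obtain v where v: "\<And>j. j \<in> J \<Longrightarrow> V j \<le> poly v (bitsize (e' j))"
    unfolding polybound_def by blast
  define l where "l i = bitsize (enc_map \<phi> (xs i))" for i
  \<comment> \<open>A generous allowance for one round: the guard, the construction of the
    environment of size at most \<open>2 + bitsize (e i) + l i + B i\<close>, the body run on it,
    and the two updates.\<close>
  define C where "C i = 20 + 3 * bitsize (e i) + 8 * l i + 5 * B i +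
    poly v (2 + bitsize (e i) + l i + B i)" for i
  have l: "polybound I e l" unfolding l_def by (rule polytime_bitsize[OF xs])
  have C: "polybound I e C" unfolding C_def by (intro polybound_intros l B)
  define body where "body = Seq (Assign (k+3) (Cons (Cons (Var k) (Hd (Var (k+1)))) (Var (k+2))))
    (Seq r (Seq (Assign (k+2) (Var (k+3))) (Assign (k+1) (Tl (Var (k+1))))))"
  define W where "W = While (IsNode (Var (k+1))) body"
  \<comment> \<open>Between rounds, register \<open>k\<close> holds the input, \<open>k+1\<close>
    the rest \<open>zs\<close> of the list and \<open>k+2\<close> the accumulator after the prefix
    \<open>ys\<close>. The body works from \<open>k+3\<close> on and so preserves all three.\<close>
  have loop: "\<exists>t s'. exec W s t s' \<and> t \<le> (length zs + 1) * C i \<and>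
      s' (k+2) = \<psi> i (fold (F i) (xs i) (a0 i)) \<and> (\<forall>j\<le>k. s' j = s j)"
    if i: "i \<in> I" and "xs i = ys @ zs" "s k = e i" "s (k+1) = enc_map \<phi> zs"
      "s (k+2) = \<psi> i (fold (F i) ys (a0 i))" for i ys zs s
    using that(2-)
  proof (induction zs arbitrary: ys s)
    case Nil
    have "exec W s (1 + expr_time (IsNode (Var (k+1))) s) s"
      unfolding W_def by (rule exec.WhileFalse) (use Nil in simp)
    then show ?case using Nil by (intro exI) (auto simp: C_def floorlog_def)
  next
    case (Cons x zs)
    define a where "a = fold (F i) ys (a0 i)"
    have A: "A i (fold (F i) us (a0 i))" if "set us \<subseteq> set (xs i)" for us
      using that by (induction us rule: rev_induct) (auto intro: inv0[OF i] inv[OF i])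
    have x: "x \<in> set (xs i)" using Cons.prems by simp
    have j: "((i, x), a) \<in> J" using i x A[of ys] Cons.prems(1) by (auto simp: J_def a_def)
    have x_size: "bitsize (\<phi> x) \<le> l i" unfolding l_def by (rule bitsize_mem[OF x])
    have zs_size: "1 + bitsize (\<phi> x) + bitsize (enc_map \<phi> zs) \<le> l i"
      using Cons.prems(1) bitsize_enc_list_append[of "map \<phi> ys" "map \<phi> (x # zs)"] bitsize_pos[of "enc_map \<phi> ys"]
      unfolding l_def Cons.prems(1) by (simp del: bitsize_pos)
    have a_size: "bitsize (\<psi> i a) \<le> B i" unfolding a_def by (rule bound[OF i Cons.prems(1)])
    have a'_size: "bitsize (\<psi> i (F i x a)) \<le> B i"
      using bound[OF i, of "ys @ [x]" zs] Cons.prems(1) by (simp add: a_def)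
    define s1 where "s1 = s(k+3 := e' ((i, x), a))"
    let ?E = "expr.Cons (expr.Cons (Var k) (Hd (Var (k+1)))) (Var (k+2))"
    have "exec (Assign (k+3) ?E) s (1 + expr_time ?E s) (s(k+3 := eval_expr ?E s))"
      by (rule exec.Assign)
    moreover have "eval_expr ?E s = e' ((i, x), a)" using Cons.prems by (simp add: e' a_def)
    ultimately have e1: "exec (Assign (k+3) ?E) s (1 + expr_time ?E s) s1" by (simp only: s1_def)
    have t1: "expr_time ?E s \<le> 3 + 3 * bitsize (e i) + 5 * l i + 3 * B i"
      using Cons.prems x_size a_size zs_size by (simp add: a_def)
    obtain t2 s2 where e2: "exec r s1 t2 s2" and 2: "t2 \<le> V ((i, x), a)"
      "s2 (k+3) = \<psi> i (F i x a)" "\<forall>j<k+3. s2 j = s1 j"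
      using r[OF j, of s1] by (auto simp: s1_def)
    have "V ((i, x), a) \<le> poly v (2 + bitsize (e i) + l i + B i)"
      by (rule order_trans[OF v[OF j]], rule poly_nat_mono) (use x_size a_size in \<open>simp add: e'\<close>)
    with 2 have t2: "t2 \<le> poly v (2 + bitsize (e i) + l i + B i)" by simp
    define s3 where "s3 = s2(k+2 := \<psi> i (F i x a))"
    have e3: "exec (Assign (k+2) (Var (k+3))) s2 (1 + bitsize (\<psi> i (F i x a))) s3"
      using exec.Assign[of "k+2" "Var (k+3)" s2] 2(2) by (simp add: s3_def)
    have s3: "s3 (k+1) = Node (\<phi> x) (enc_map \<phi> zs)"
      using 2(3) Cons.prems by (simp add: s3_def s1_def)
    define s4 where "s4 = s3(k+1 := enc_map \<phi> zs)"
    have e4: "exec (Assign (k+1) (Tl (Var (k+1)))) s3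
        (1 + (bitsize (enc_map \<phi> zs) + bitsize (Node (\<phi> x) (enc_map \<phi> zs)))) s4"
      using exec.Assign[of "k+1" "Tl (Var (k+1))" s3] s3 by (simp add: s4_def)
    note e5 = exec.Seq[OF e1 exec.Seq[OF e2 exec.Seq[OF e3 e4]], folded body_def]
    have "\<exists>t s'. exec W s4 t s' \<and> t \<le> (length zs + 1) * C i \<and>
      s' (k+2) = \<psi> i (fold (F i) (xs i) (a0 i)) \<and> (\<forall>j\<le>k. s' j = s4 j)"
      by (rule Cons.IH[of "ys @ [x]"]) (use Cons.prems 2(3) in \<open>auto simp: s4_def s3_def s1_def a_def\<close>)
    then obtain t6 s6 where e6: "exec W s4 t6 s6" and 6: "t6 \<le> (length zs + 1) * C i"
      "s6 (k+2) = \<psi> i (fold (F i) (xs i) (a0 i))" "\<forall>j\<le>k. s6 j = s4 j" by blast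
    have g: "eval_expr (IsNode (Var (k+1))) s \<noteq> Num 0" using Cons.prems by simp
    have tg: "expr_time (IsNode (Var (k+1))) s \<le> 3 + l i"
      using Cons.prems zs_size by (simp add: floorlog_def)
    show ?case
      by (intro exI conjI, unfold W_def, rule exec.WhileTrue[OF g e5 e6[unfolded W_def]])
        (use 6 2(3) t1 t2 tg a'_size zs_size in \<open>auto simp: C_def s4_def s3_def s1_def\<close>)
  qed
  let ?P = "Seq (Assign (k+1) (Var k)) (Seq p (Seq (Assign (k+2) (Var k)) (Seq q
    (Seq W (Assign k (Var (k+2)))))))"
  let ?T = "\<lambda>i. 10 + 2 * bitsize (e i) + T i + U i + (l i + 1) * C i + B i"
  show "\<exists>p T. polybound I e T \<and> (\<forall>i\<in>I. \<forall>s. s k = e i \<longrightarrow> (\<exists>t s'. exec p s t s' \<and> t \<le> T i \<and>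
      s' k = \<psi> i (fold (F i) (xs i) (a0 i)) \<and> (\<forall>j<k. s' j = s j)))"
  proof (intro exI[of _ ?P] exI[of _ ?T] conjI ballI allI impI)
    show "polybound I e ?T" by (intro polybound_intros T U l C B)
    fix i s assume i: "i \<in> I" and s: "s k = e i"
    define s1 where "s1 = s(k+1 := e i)"
    have e1: "exec (Assign (k+1) (Var k)) s (1 + bitsize (e i)) s1"
      using exec.Assign[of "k+1" "Var k" s] s by (simp add: s1_def)
    obtain t2 s2 where e2: "exec p s1 t2 s2"
      and 2: "t2 \<le> T i" "s2 (k+1) = enc_map \<phi> (xs i)" "\<forall>j<k+1. s2 j = s1 j"
      using p[where s=s1, OF i] by (auto simp: s1_def)
    define s3 where "s3 = s2(k+2 := e i)"
    have e3: "exec (Assign (k+2) (Var k)) s2 (1 + bitsize (e i)) s3"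
      using exec.Assign[of "k+2" "Var k" s2] s 2 by (simp add: s3_def s1_def)
    obtain t4 s4 where e4: "exec q s3 t4 s4"
      and 4: "t4 \<le> U i" "s4 (k+2) = \<psi> i (a0 i)" "\<forall>j<k+2. s4 j = s3 j"
      using q[where s=s3, OF i] by (auto simp: s3_def)
    have "\<exists>t s'. exec W s4 t s' \<and> t \<le> (length (xs i) + 1) * C i \<and>
      s' (k+2) = \<psi> i (fold (F i) (xs i) (a0 i)) \<and> (\<forall>j\<le>k. s' j = s4 j)"
      by (rule loop[OF i, of "[]"]) (use 2 4 s in \<open>auto simp: s3_def s1_def\<close>)
    then obtain t5 s5 where e5: "exec W s4 t5 s5" and 5: "t5 \<le> (length (xs i) + 1) * C i"
      "s5 (k+2) = \<psi> i (fold (F i) (xs i) (a0 i))" "\<forall>j\<le>k. s5 j = s4 j" by blast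
    have "(length (xs i) + 1) * C i \<le> (l i + 1) * C i"
      unfolding l_def by (intro mult_right_mono add_right_mono length_le_bitsize) simp
    with 5 have t5: "t5 \<le> (l i + 1) * C i" by linarith
    have e6: "exec (Assign k (Var (k+2))) s5 (1 + bitsize (\<psi> i (fold (F i) (xs i) (a0 i))))
        (s5(k := \<psi> i (fold (F i) (xs i) (a0 i))))"
      using exec.Assign[of k "Var (k+2)" s5] 5 by simp
    show "\<exists>t s'. exec ?P s t s' \<and> t \<le> ?T i \<and>
      s' k = \<psi> i (fold (F i) (xs i) (a0 i)) \<and> (\<forall>j<k. s' j = s j)"
      by (intro exI conjI, rule exec.Seq[OF e1 exec.Seq[OF e2 exec.Seq[OF e3 exec.Seq[OF e4
            exec.Seq[OF e5 e6]]]]])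
        (use 2 4 5(3) t5 bound[OF i, of "xs i" "[]"] in \<open>auto simp: s1_def s3_def\<close>)
  qed
qed

lemma polytime_Cons:
  "polytime I e (\<lambda>i. \<phi> (x i)) \<Longrightarrow> polytime I e (\<lambda>i. enc_map \<phi> (xs i)) \<Longrightarrow>
    polytime I e (\<lambda>i. enc_map \<phi> (x i # xs i))"
  using polytime_Node by fastforce

text \<open>Only the front of an encoded list is accessible in one operation, so folds build their
  output backwards; reversal at the end restores the order.\<close>

lemma polytime_rev_append:
  assumes "polytime I e (\<lambda>i. enc_map \<phi> (xs i))" "polytime I e (\<lambda>i. enc_map \<phi> (ys i))"
  shows "polytime I e (\<lambda>i. enc_map \<phi> (rev (xs i) @ ys i))"
proof -
  have "polytime I e (\<lambda>i. (\<lambda>_. enc_map \<phi>) i (fold (\<lambda>x l. x # l) (xs i) (ys i)))"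
  proof (rule polytime_fold[where A = "\<lambda>_ _. True"
        and B = "\<lambda>i. bitsize (enc_map \<phi> (xs i)) + bitsize (enc_map \<phi> (ys i))"])
    show "polytime {((i, x), a). i \<in> I \<and> x \<in> set (xs i) \<and> True}
     (ext (ext e (\<lambda>j. \<phi> (snd j))) (\<lambda>j. enc_map \<phi> (snd j)))
     (\<lambda>j. enc_map \<phi> (snd (fst j) # snd j))"
      by (rule polytime_Cons[OF polytime_lift[OF polytime_top, of _ UNIV] polytime_top]) auto
    fix i us vs assume "xs i = us @ vs"
    then show "bitsize (enc_map \<phi> (fold (\<lambda>x l. x # l) us (ys i))) \<le>
        bitsize (enc_map \<phi> (xs i)) + bitsize (enc_map \<phi> (ys i))"
      using bitsize_enc_list_append[of "rev (map \<phi> us)" "map \<phi> (ys i)"]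
        bitsize_enc_list_append[of "map \<phi> us" "map \<phi> vs"]
      by (simp add: fold_Cons_rev rev_map[symmetric])
  qed (use assms in \<open>auto intro: polybound_intros polytime_bitsize\<close>)
  then show ?thesis by (simp add: fold_Cons_rev)
qed

lemma polytime_rev:
  "polytime I e (\<lambda>i. enc_map \<phi> (xs i)) \<Longrightarrow> polytime I e (\<lambda>i. enc_map \<phi> (rev (xs i)))"
  using polytime_rev_append[of I e \<phi> xs "\<lambda>_. []"] by (simp add: polytime_const)

text \<open>The size of a body's result is bounded in terms of the extended environment; since an
  element is no larger than the list containing it, one bound serves all rounds.\<close>

lemma polytime_loop_size:
  fixes xs :: "'i \<Rightarrow> 'x list"
  assumes xs: "polytime I e (\<lambda>i. enc_map \<phi> (xs i))"
    and f: "polytime {(i, x). i \<in> I \<and> x \<in> set (xs i)} (ext e (\<lambda>j. \<phi> (snd j))) (\<lambda>j. f (fst j) (snd j))"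
  obtains B where "polybound I e B" "\<And>i x. i \<in> I \<Longrightarrow> x \<in> set (xs i) \<Longrightarrow> bitsize (f i x) \<le> B i"
proof -
  let ?J = "{(i, x). i \<in> I \<and> x \<in> set (xs i)}"
  from polytime_bitsize[OF f] obtain q where q: "\<And>j. j \<in> ?J \<Longrightarrow>
      bitsize (f (fst j) (snd j)) \<le> poly q (bitsize (ext e (\<lambda>j. \<phi> (snd j)) j))"
    unfolding polybound_def by blast
  let ?B = "\<lambda>i. poly q (1 + bitsize (e i) + bitsize (enc_map \<phi> (xs i)))"
  show ?thesis
  proof (rule that[of ?B])
    show "polybound I e ?B" by (intro polybound_intros polytime_bitsize[OF xs])
    fix i x assume ix: "i \<in> I" "x \<in> set (xs i)"
    then have "bitsize (f i x) \<le> poly q (bitsize (ext e (\<lambda>j. \<phi> (snd j)) (i, x)))"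
      using q[of "(i, x)"] by simp
    also have "\<dots> \<le> ?B i"
      by (rule poly_nat_mono) (simp add: ext_def bitsize_mem[OF ix(2)])
    finally show "bitsize (f i x) \<le> ?B i" .
  qed
qed

lemma polytime_concat:
  fixes xs :: "'i \<Rightarrow> 'x list"
  assumes xs: "polytime I e (\<lambda>i. enc_map \<phi> (xs i))"
    and F: "polytime {(i, x). i \<in> I \<and> x \<in> set (xs i)} (ext e (\<lambda>j. \<phi> (snd j)))
      (\<lambda>j. enc_map \<xi> (F (fst j) (snd j)))"
  shows "polytime I e (\<lambda>i. enc_map \<xi> (concat (map (F i) (xs i))))"
proof -
  obtain B where B: "polybound I e B"
    "\<And>i x. i \<in> I \<Longrightarrow> x \<in> set (xs i) \<Longrightarrow> bitsize (enc_map \<xi> (F i x)) \<le> B i"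
    using polytime_loop_size[OF xs F] by blast
  have fold_eq: "fold (\<lambda>x l. rev (F i x) @ l) ys l = rev (concat (map (F i) ys)) @ l" for i ys l
    by (induction ys arbitrary: l) auto
  have "polytime I e (\<lambda>i. (\<lambda>_. enc_map \<xi>) i (fold ((\<lambda>i x l. rev (F i x) @ l) i) (xs i) ((\<lambda>_. []) i)))"
  proof (rule polytime_fold[where A = "\<lambda>_ _. True"
        and B = "\<lambda>i. 1 + bitsize (enc_map \<phi> (xs i)) * B i"])
    show "polytime {((i, x), a). i \<in> I \<and> x \<in> set (xs i) \<and> True}
     (ext (ext e (\<lambda>j. \<phi> (snd j))) (\<lambda>j. enc_map \<xi> (snd j)))
     (\<lambda>j. enc_map \<xi> (rev (F (fst (fst j)) (snd (fst j))) @ snd j))"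
      by (rule polytime_rev_append[OF polytime_lift[OF F] polytime_top]) auto
    show "polybound I e (\<lambda>i. 1 + bitsize (enc_map \<phi> (xs i)) * B i)"
      by (intro polybound_intros polytime_bitsize[OF xs] B)
    fix i us vs assume i: "i \<in> I" and us: "xs i = us @ vs"
    have "bitsize (enc_map \<xi> (concat (map (F i) us))) \<le> 1 + length us * B i"
      if "set us \<subseteq> set (xs i)" for us
      using that
    proof (induction us)
      case (Cons x us)
      then show ?case
        using B(2)[OF i, of x]
          bitsize_enc_list_append[of "map \<xi> (F i x)" "map \<xi> (concat (map (F i) us))"] by simp
    qed (auto simp: floorlog_def)
    from this[of us] us have "bitsize (enc_map \<xi> (concat (map (F i) us))) \<le> 1 + length us * B i"
      by simp
    also have "\<dots> \<le> 1 + bitsize (enc_map \<phi> (xs i)) * B i"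
      using us length_le_bitsize[of "xs i" \<phi>] by (intro add_mono mult_mono) auto
    finally show "bitsize (enc_map \<xi> (fold (\<lambda>x l. rev (F i x) @ l) us [])) \<le>
        1 + bitsize (enc_map \<phi> (xs i)) * B i"
      by (simp add: fold_eq rev_map[symmetric])
  qed (use xs in \<open>auto intro: polytime_const\<close>)
  then have "polytime I e (\<lambda>i. enc_map \<xi> (rev (concat (map (F i) (xs i)))))" by (simp add: fold_eq)
  from polytime_rev[OF this] show ?thesis by simp
qed

lemma polytime_map:
  fixes xs :: "'i \<Rightarrow> 'x list"
  assumes xs: "polytime I e (\<lambda>i. enc_map \<phi> (xs i))"
    and f: "polytime {(i, x). i \<in> I \<and> x \<in> set (xs i)} (ext e (\<lambda>j. \<phi> (snd j))) (\<lambda>j. f (fst j) (snd j))"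
  shows "polytime I e (\<lambda>i. enc_map (f i) (xs i))"
proof -
  have "polytime I e (\<lambda>i. enc_map id (concat (map ((\<lambda>i x. [f i x]) i) (xs i))))"
    by (rule polytime_concat[OF xs]) (use polytime_Node[OF f polytime_const[of _ _ "Num 0"]] in simp)
  then show ?thesis by (simp add: concat_map_singleton)
qed

text \<open>A number given in binary may be exponential in its bit size, so \<open>[0..<n]\<close>
  is produced only from a list of length \<open>n\<close> that is already available.\<close>

lemma polytime_upt:
  fixes xs :: "'i \<Rightarrow> 'x list"
  assumes xs: "polytime I e (\<lambda>i. enc_map \<phi> (xs i))"
  shows "polytime I e (\<lambda>i. Num (length (xs i)))" "polytime I e (\<lambda>i. enc_map Num [0..<length (xs i)])"
proof -
  let ?\<psi> = "\<lambda>(c, l). Node (Num c) (enc_map Num l)"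
  let ?F = "\<lambda>i :: 'i. \<lambda>x :: 'x. \<lambda>(c, l). (Suc c, c # l)"
  let ?l = "\<lambda>i. bitsize (enc_map \<phi> (xs i))"
  have fold_eq: "fold (?F i) ys (0, []) = (length ys, rev [0..<length ys])" for i ys
    by (induction ys rule: rev_induct) auto
  have \<psi>: "polytime J (ext e' (\<lambda>j. ?\<psi> (snd j))) (\<lambda>j. Num (fst (snd j)))"
    "polytime J (ext e' (\<lambda>j. ?\<psi> (snd j))) (\<lambda>j. enc_map Num (snd (snd j)))" for J and e' :: "'j \<Rightarrow> data"
    using polytime_left[OF polytime_top[of J e' "\<lambda>j. ?\<psi> (snd j)"]]
      polytime_right[OF polytime_top[of J e' "\<lambda>j. ?\<psi> (snd j)"]] by (simp_all add: case_prod_beta)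
  have *: "polytime I e (\<lambda>i. (\<lambda>_. ?\<psi>) i (fold (?F i) (xs i) ((\<lambda>_. (0, [])) i)))"
  proof (rule polytime_fold[where A = "\<lambda>_ _. True" and B = "\<lambda>i. 4 + ?l i + ?l i * (2 + ?l i)", OF xs])
    show "polytime {((i, x), a). i \<in> I \<and> x \<in> set (xs i) \<and> True}
     (ext (ext e (\<lambda>j. \<phi> (snd j))) (\<lambda>j. ?\<psi> (snd j)))
     (\<lambda>j. ?\<psi> (?F (fst (fst j)) (snd (fst j)) (snd j)))"
      using polytime_Node[OF polytime_add[OF \<psi>(1) polytime_const[of _ _ "Num 1"]]
          polytime_Cons[of _ _ Num, OF \<psi>]]
      by (simp add: case_prod_beta)
    fix i us vs assume us: "xs i = us @ vs"
    have "bitsize (enc_map Num (rev [0..<n])) \<le> 1 + n * (2 + n)" for n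
    proof -
      have "(\<Sum>x\<leftarrow>[0..<n]. Suc (Suc (floorlog 2 x))) \<le> (\<Sum>x\<leftarrow>[0..<n]. 2 + n)"
        by (rule sum_list_mono) (auto intro: order_trans[OF floorlog_le_self])
      then show ?thesis by (simp add: bitsize_enc_list rev_map[symmetric] sum_list_triv o_def)
    qed
    from this[of "length us"] have "bitsize (?\<psi> (fold (?F i) us (0, []))) \<le>
        4 + length us + length us * (2 + length us)"
      using floorlog_le_self[of "length us"] by (simp add: fold_eq)
    also have "\<dots> \<le> 4 + ?l i + ?l i * (2 + ?l i)"
      using us length_le_bitsize[of "xs i" \<phi>] by (intro add_mono mult_mono) auto
    finally show "bitsize (?\<psi> (fold (?F i) us (0, []))) \<le> 4 + ?l i + ?l i * (2 + ?l i)" .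
  qed (use xs in \<open>auto intro!: polybound_intros polytime_bitsize polytime_const\<close>)
  show "polytime I e (\<lambda>i. Num (length (xs i)))"
    using polytime_left[OF *] by (simp add: fold_eq)
  show "polytime I e (\<lambda>i. enc_map Num [0..<length (xs i)])"
    using polytime_rev[of _ _ Num "\<lambda>i. rev [0..<length (xs i)]"] polytime_right[OF *]
    by (simp add: fold_eq)
qed

lemma polytime_nth:
  fixes xs :: "'i \<Rightarrow> 'x list"
  assumes xs: "polytime I e (\<lambda>i. enc_map \<phi> (xs i))" and m: "polytime I e (\<lambda>i. Num (m i))"
    and less: "\<And>i. i \<in> I \<Longrightarrow> m i < length (xs i)"
  shows "polytime I e (\<lambda>i. \<phi> (xs i ! m i))"
proof -
  let ?\<psi> = "\<lambda>(c, d). Node (Num c) d"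
  let ?F = "\<lambda>i :: 'i. \<lambda>x. \<lambda>(c, d). (Suc c, if c = m i then \<phi> x else d)"
  let ?l = "\<lambda>i. bitsize (enc_map \<phi> (xs i))"
  have fold_eq: "fold (?F i) ys (0, Num 0) =
      (length ys, if m i < length ys then \<phi> (ys ! m i) else Num 0)" for i ys
    by (induction ys rule: rev_induct) (auto simp: nth_append less_Suc_eq)
  have *: "polytime I e (\<lambda>i. (\<lambda>_. ?\<psi>) i (fold (?F i) (xs i) ((\<lambda>_. (0, Num 0)) i)))"
  proof (rule polytime_fold[where A = "\<lambda>_ _. True" and B = "\<lambda>i. 4 + ?l i + ?l i", OF xs])
    let ?J = "{((i, x), a). i \<in> I \<and> x \<in> set (xs i) \<and> True}"
    let ?e = "ext (ext e (\<lambda>j. \<phi> (snd j))) (\<lambda>j. ?\<psi> (snd j))"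
    have \<psi>: "polytime J ?e (\<lambda>j. Num (fst (snd j)))" "polytime J ?e (\<lambda>j. snd (snd j))" for J
      using polytime_left[OF polytime_top[of J _ "\<lambda>j. ?\<psi> (snd j)"]]
        polytime_right[OF polytime_top[of J _ "\<lambda>j. ?\<psi> (snd j)"]] by (simp_all add: case_prod_beta)
    have \<phi>: "polytime J ?e (\<lambda>j. \<phi> (snd (fst j)))" for J
      by (rule polytime_lift[OF polytime_top, of _ UNIV]) simp
    have m': "polytime ?J ?e (\<lambda>j. Num (m (fst (fst j))))"
      by (rule polytime_lift[OF polytime_lift[OF m, where J = "{(i, x). i \<in> I}"]]) auto
    show "polytime ?J ?e (\<lambda>j. ?\<psi> (?F (fst (fst j)) (snd (fst j)) (snd j)))"
      using polytime_Node[OF polytime_add[OF \<psi>(1) polytime_const[of _ _ "Num 1"]]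
          polytime_If[OF polytime_eq[OF \<psi>(1) m'] \<phi> \<psi>(2)]]
      by (simp add: case_prod_beta)
    fix i us vs assume us: "xs i = us @ vs"
    have "floorlog 2 (length us) \<le> ?l i"
      using floorlog_le_self[of "length us"] length_le_bitsize[of "xs i" \<phi>] us by simp
    moreover have "bitsize (\<phi> (us ! m i)) \<le> ?l i" if "m i < length us"
      using that us bitsize_mem[of "us ! m i" "xs i" \<phi>] by simp
    ultimately show "bitsize (?\<psi> (fold (?F i) us (0, Num 0))) \<le> 4 + ?l i + ?l i"
      by (auto simp: fold_eq floorlog_def)
  qed (use xs in \<open>auto intro!: polybound_intros polytime_bitsize polytime_const\<close>)
  have "polytime I e (\<lambda>i. if m i < length (xs i) then \<phi> (xs i ! m i) else Num 0)"
    using polytime_right[OF *] by (simp add: fold_eq)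
  then show ?thesis by (rule polytime_cong) (use less in simp)
qed

text \<open>The condition \<open>size\<close> says that \<open>h\<close> at most adds bit sizes,
  hence the accumulator grows linearly in the number of rounds. Both addition and multiplication
  satisfy it.\<close>

lemma polytime_aggregate:
  fixes xs :: "'i \<Rightarrow> 'x list" and h :: "nat \<Rightarrow> nat \<Rightarrow> nat"
  assumes xs: "polytime I e (\<lambda>i. enc_map \<phi> (xs i))"
    and f: "polytime {(i, x). i \<in> I \<and> x \<in> set (xs i)} (ext e (\<lambda>j. \<phi> (snd j)))
      (\<lambda>j. Num (f (fst j) (snd j)))"
    and h: "\<And>J (e' :: ('i \<times> 'x) \<times> nat \<Rightarrow> data) f g. polytime J e' (\<lambda>i. Num (f i)) \<Longrightarrow>
      polytime J e' (\<lambda>i. Num (g i)) \<Longrightarrow> polytime J e' (\<lambda>i. Num (h (f i) (g i)))"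
    and size: "\<And>a b. bitsize (Num (h a b)) \<le> bitsize (Num a) + bitsize (Num b)"
  shows "polytime I e (\<lambda>i. Num (fold (\<lambda>x. h (f i x)) (xs i) c))"
proof -
  obtain B where B: "polybound I e B"
    "\<And>i x. i \<in> I \<Longrightarrow> x \<in> set (xs i) \<Longrightarrow> bitsize (Num (f i x)) \<le> B i"
    using polytime_loop_size[OF xs f] by blast
  let ?l = "\<lambda>i. bitsize (enc_map \<phi> (xs i))"
  have "polytime I e (\<lambda>i. (\<lambda>_. Num) i (fold ((\<lambda>i x. h (f i x)) i) (xs i) ((\<lambda>_. c) i)))"
  proof (rule polytime_fold[where A = "\<lambda>_ _. True"
        and B = "\<lambda>i. bitsize (Num c) + ?l i * B i", OF xs])
    show "polytime {((i, x), a). i \<in> I \<and> x \<in> set (xs i) \<and> True}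
     (ext (ext e (\<lambda>j. \<phi> (snd j))) (\<lambda>j. Num (snd j)))
     (\<lambda>j. Num (h (f (fst (fst j)) (snd (fst j))) (snd j)))"
      by (rule h[OF polytime_lift[OF f] polytime_top]) auto
    show "polybound I e (\<lambda>i. bitsize (Num c) + ?l i * B i)"
      by (intro polybound_intros polytime_bitsize[OF xs] B)
    fix i us vs assume i: "i \<in> I" and us: "xs i = us @ vs"
    have "bitsize (Num (fold (\<lambda>x. h (f i x)) us c)) \<le> bitsize (Num c) + length us * B i"
      if "set us \<subseteq> set (xs i)" for us
      using that
    proof (induction us rule: rev_induct)
      case (snoc x us)
      then show ?case
        using B(2)[OF i, of x] size[of "f i x" "fold (\<lambda>x. h (f i x)) us c"] by simp
    qed simp
    then have "bitsize (Num (fold (\<lambda>x. h (f i x)) us c)) \<le> bitsize (Num c) + length us * B i"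
      using us by simp
    also have "\<dots> \<le> bitsize (Num c) + ?l i * B i"
      using us length_le_bitsize[of "xs i" \<phi>] by (intro add_mono mult_mono) auto
    finally show "bitsize (Num (fold (\<lambda>x. h (f i x)) us c)) \<le> bitsize (Num c) + ?l i * B i" .
  qed (auto intro: polytime_const)
  then show ?thesis by simp
qed

lemma floorlog_small [simp]: "floorlog 2 0 = 0" "floorlog 2 (Suc 0) = 1"
  using floorlog_two_power[of 0] by (simp_all add: floorlog_def)

lemma bitsize_enc_map_le:
  assumes "\<And>x. x \<in> set xs \<Longrightarrow> bitsize (\<phi> x) \<le> B"
  shows "bitsize (enc_map \<phi> xs) \<le> 1 + length xs * (1 + B)"
  using assms
proof (induction xs)
  case (Cons x xs)
  then have "bitsize (\<phi> x) \<le> B" "bitsize (enc_map \<phi> xs) \<le> 1 + length xs * (1 + B)" by simp_all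
  then show ?case by simp
qed (simp add: floorlog_def)

text \<open>These are the increments of the scaling phases. Their number is governed by the bit
  length of \<open>M i\<close>, for which no list is at hand, so this needs a while loop of its own
  instead of a fold.\<close>

lemma polytime_powers:
  assumes M: "polytime I e (\<lambda>i. Num (M i))"
  shows "polytime I e (\<lambda>i. enc_map (\<lambda>j. Num (2 ^ j)) (rev [0..<Suc (floorlog 2 (M i))]))"
proof (rule polytime_comp[OF M, where J = UNIV and f' = Num and \<phi> = M])
  \<comment> \<open>Descending order keeps the largest power at the head, where the guard compares
    it with \<open>m\<close> and the body doubles it; the guard first fails at exponent
    \<open>floorlog 2 m\<close>.\<close>
  define P where "P j = enc_map (\<lambda>j. Num (2 ^ j)) (rev [0..<Suc j])" for j
  have P_Suc: "P (Suc j) = Node (Num (2 * 2 ^ j)) (P j)" and P_left: "left (P j) = Num (2 ^ j)" for j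
    by (simp_all add: P_def)
  define S where "S m = 1 + Suc (floorlog 2 m) * (3 + floorlog 2 m)" for m
  have P_size: "bitsize (P j) \<le> S m" if "j \<le> floorlog 2 m" for j m
  proof -
    have "bitsize (P j) \<le> 1 + length (rev [0..<Suc j]) * (1 + (2 + floorlog 2 m))"
      unfolding P_def
    proof (rule bitsize_enc_map_le)
      fix x assume "x \<in> set (rev [0..<Suc j])"
      then have "x \<le> floorlog 2 m" using that by auto
      then show "bitsize (Num (2 ^ x)) \<le> 2 + floorlog 2 m" by (simp add: floorlog_two_power)
    qed
    also have "\<dots> \<le> S m"
      unfolding S_def by (rule add_left_mono, rule mult_mono) (use that in auto)
    finally show ?thesis .
  qed
  define C where "C m = 50 + 10 * S m + 10 * floorlog 2 m" for m
  have "polytime UNIV Num (\<lambda>m. P (floorlog 2 m))"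
    unfolding polytime_def
  proof
    fix k
    define body where "body = Assign (k+1)
      (expr.Cons (Add (Hd (Var (k+1))) (Hd (Var (k+1)))) (Var (k+1)))"
    define W where "W = While (Leq (Hd (Var (k+1))) (Var k)) body"
    have loop: "\<exists>t s'. exec W s t s' \<and> t \<le> (n + 1) * C m \<and> s' (k+1) = P (floorlog 2 m) \<and>
        (\<forall>j\<le>k. s' j = s j)"
      if "j + n = floorlog 2 m" "s k = Num m" "s (k+1) = P j" for j n m s
      using that
    proof (induction n arbitrary: j s)
      case 0
      have "m < 2 ^ j" using floorlog_le_iff[of 2 m j] 0 by simp
      then have "exec W s (1 + expr_time (Leq (Hd (Var (k+1))) (Var k)) s) s"
        unfolding W_def by (intro exec.WhileFalse) (use 0 in \<open>simp add: P_left\<close>)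
      then show ?case using 0 P_size[of j m]
        by (intro exI) (auto simp: C_def P_left floorlog_two_power)
    next
      case (Suc n)
      have "2 ^ j \<le> m" using floorlog_le_iff[of 2 m j] Suc.prems(1) by simp
      then have g: "eval_expr (Leq (Hd (Var (k+1))) (Var k)) s \<noteq> Num 0"
        using Suc.prems by (simp add: P_left)
      have tg: "expr_time (Leq (Hd (Var (k+1))) (Var k)) s \<le> 10 + S m + 2 * floorlog 2 m"
        using Suc.prems P_size[of j m] by (auto simp: P_left floorlog_two_power)
      let ?E = "expr.Cons (Add (Hd (Var (k+1))) (Hd (Var (k+1)))) (Var (k+1))"
      define s1 where "s1 = s(k+1 := P (Suc j))"
      have ev: "eval_expr ?E s = P (Suc j)" using Suc.prems by (simp add: P_left P_Suc mult_2)
      have e1: "exec body s (1 + expr_time ?E s) s1"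
        using exec.Assign[of "k+1" ?E s] unfolding ev body_def s1_def .
      have "expr_time ?E s = bitsize (P (Suc j)) + (bitsize (Num (2 ^ Suc j)) +
          (bitsize (Num (2 ^ j)) + bitsize (P j)) + (bitsize (Num (2 ^ j)) + bitsize (P j))) + bitsize (P j)"
        using Suc.prems by (simp add: P_left P_Suc mult_2)
      also have "\<dots> \<le> 10 + 4 * S m + 3 * floorlog 2 m"
        using P_size[of j m] P_size[of "Suc j" m] Suc.prems(1) floorlog_two_power[of "Suc j"]
        by (simp add: floorlog_two_power)
      finally have t1: "expr_time ?E s \<le> 10 + 4 * S m + 3 * floorlog 2 m" .
      have "\<exists>t s'. exec W s1 t s' \<and> t \<le> (n + 1) * C m \<and> s' (k+1) = P (floorlog 2 m) \<and>
          (\<forall>j\<le>k. s' j = s1 j)"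
        by (rule Suc.IH[of "Suc j"]) (use Suc.prems in \<open>auto simp: s1_def\<close>)
      then obtain t2 s2 where e2: "exec W s1 t2 s2" and 2: "t2 \<le> (n + 1) * C m"
        "s2 (k+1) = P (floorlog 2 m)" "\<forall>j\<le>k. s2 j = s1 j" by blast
      have t: "1 + expr_time (Leq (Hd (Var (k+1))) (Var k)) s + (1 + expr_time ?E s) + t2 \<le> (Suc n + 1) * C m"
        using tg t1 2(1) by (simp add: C_def)
      show ?case
        by (intro exI conjI, unfold W_def, rule exec.WhileTrue[OF g e1 e2[unfolded W_def]])
          (use 2 t in \<open>auto simp: s1_def\<close>)
    qed
    let ?P = "Seq (Assign (k+1) (expr.Cons (Lit 1) (Lit 0))) (Seq W (Assign k (Var (k+1))))"
    let ?T = "\<lambda>m. 20 + (floorlog 2 m + 1) * C m + S m"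
    have "floorlog 2 m \<le> bitsize (Num m)" for m by simp
    then have "polybound UNIV Num (\<lambda>m. floorlog 2 m)"
      by (intro polybound_mono[OF polybound_size]) auto
    then have bound: "polybound UNIV Num ?T"
      unfolding C_def S_def Suc_eq_plus1 by (intro polybound_intros)
    show "\<exists>p T. polybound UNIV Num T \<and> (\<forall>i\<in>UNIV. \<forall>s. s k = Num i \<longrightarrow>
       (\<exists>t s'. exec p s t s' \<and> t \<le> T i \<and> s' k = P (floorlog 2 i) \<and> (\<forall>j<k. s' j = s j)))"
    proof (intro exI[of _ ?P] exI[of _ ?T] conjI ballI allI impI bound)
      fix m and s :: state assume s: "s k = Num m"
      define s1 where "s1 = s(k+1 := P 0)"
      have e1: "exec (Assign (k+1) (expr.Cons (Lit 1) (Lit 0))) s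
          (1 + expr_time (expr.Cons (Lit 1) (Lit 0)) s) s1"
        using exec.Assign[of "k+1" "expr.Cons (Lit 1) (Lit 0)" s] by (simp add: s1_def P_def)
      have "\<exists>t s'. exec W s1 t s' \<and> t \<le> (floorlog 2 m + 1) * C m \<and> s' (k+1) = P (floorlog 2 m) \<and>
        (\<forall>j\<le>k. s' j = s1 j)"
        by (rule loop[of 0]) (use s in \<open>auto simp: s1_def\<close>)
      then obtain t2 s2 where e2: "exec W s1 t2 s2" and 2: "t2 \<le> (floorlog 2 m + 1) * C m"
        "s2 (k+1) = P (floorlog 2 m)" "\<forall>j\<le>k. s2 j = s1 j" by blast
      have e3: "exec (Assign k (Var (k+1))) s2 (1 + bitsize (P (floorlog 2 m))) (s2(k := P (floorlog 2 m)))"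
        using exec.Assign[of k "Var (k+1)" s2] 2 by simp
      show "\<exists>t s'. exec ?P s t s' \<and> t \<le> ?T m \<and> s' k = P (floorlog 2 m) \<and> (\<forall>j<k. s' j = s j)"
        by (intro exI conjI, rule exec.Seq[OF e1 exec.Seq[OF e2 e3]])
          (use 2 P_size[of "floorlog 2 m" m] in \<open>auto simp: s1_def\<close>)
    qed
  qed
  then show "polytime UNIV Num (\<lambda>m. enc_map (\<lambda>j. Num (2 ^ j)) (rev [0..<Suc (floorlog 2 m)]))"
    by (simp only: P_def)
qed auto

section \<open>Minimum weight closed sets\<close>

text \<open>\<open>E x y\<close> stands for the implication that a closed set with \<open>x\<close>
  also contains \<open>y\<close>. Weights are split into two natural numbers \<open>a x\<close> and
  \<open>b x\<close>, as programs have no negative numbers.\<close>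

locale implication_network =
  fixes N :: nat and E :: "nat \<Rightarrow> nat \<Rightarrow> bool" and a b :: "nat \<Rightarrow> nat"
begin

definition closed_set :: "nat set \<Rightarrow> bool" where
  "closed_set X \<longleftrightarrow> X \<subseteq> {..<N} \<and> (\<forall>x\<in>X. \<forall>y<N. E x y \<longrightarrow> y \<in> X)"

definition weight :: "nat \<Rightarrow> int" where
  "weight x = int (a x) - int (b x)"

text \<open>\<open>G x y\<close> is the amount of weight moved from \<open>y\<close> to
  \<open>x\<close>, against the implication \<open>E x y\<close>. The two sides of the resulting
  balance are kept apart so that they can be compared without subtraction.\<close>

definition credit :: "(nat \<Rightarrow> nat \<Rightarrow> nat) \<Rightarrow> nat \<Rightarrow> nat" where
  "credit G x = a x + (\<Sum>y<N. G x y)"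

definition debit :: "(nat \<Rightarrow> nat \<Rightarrow> nat) \<Rightarrow> nat \<Rightarrow> nat" where
  "debit G x = b x + (\<Sum>y<N. G y x)"

definition deficient :: "nat \<Rightarrow> (nat \<Rightarrow> nat \<Rightarrow> nat) \<Rightarrow> nat \<Rightarrow> bool" where
  "deficient \<Delta> G x \<longleftrightarrow> credit G x + \<Delta> \<le> debit G x"

definition excessive :: "nat \<Rightarrow> (nat \<Rightarrow> nat \<Rightarrow> nat) \<Rightarrow> nat \<Rightarrow> bool" where
  "excessive \<Delta> G x \<longleftrightarrow> debit G x + \<Delta> \<le> credit G x"

text \<open>Along an implication any amount may be moved; against one, only flow that is already
  there can be cancelled.\<close>

definition residual :: "nat \<Rightarrow> (nat \<Rightarrow> nat \<Rightarrow> nat) \<Rightarrow> nat \<Rightarrow> nat \<Rightarrow> bool" where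
  "residual \<Delta> G x y \<longleftrightarrow> E x y \<or> \<Delta> \<le> G y x"

text \<open>A search in the form of a fold, with the value \<open>N\<close> for failure.\<close>

definition pick :: "(nat \<Rightarrow> bool) \<Rightarrow> nat" where
  "pick P = fold (\<lambda>y z. if P y then y else z) [0..<N] N"

text \<open>A label is positive iff an excessive node is reachable, and it increases along some residual
  arc towards such a node.\<close>

definition label_round :: "nat \<Rightarrow> (nat \<Rightarrow> nat \<Rightarrow> nat) \<Rightarrow> nat \<Rightarrow> (nat \<Rightarrow> nat) \<Rightarrow> nat \<Rightarrow> nat" where
  "label_round \<Delta> G t l = (\<lambda>x. if l x = 0 \<and> pick (\<lambda>y. residual \<Delta> G x y \<and> 0 < l y) < N then Suc t else l x)"

definition init_labels :: "nat \<Rightarrow> (nat \<Rightarrow> nat \<Rightarrow> nat) \<Rightarrow> nat \<Rightarrow> nat" where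
  "init_labels \<Delta> G = (\<lambda>x. if excessive \<Delta> G x then Suc N else 0)"

text \<open>Rounds are numbered downwards, so nodes found later, further away from an excess, get
  smaller labels. All labels given in rounds are at most \<open>N\<close>, hence below the initial
  label \<open>Suc N\<close> of excessive nodes.\<close>

definition labels :: "nat \<Rightarrow> (nat \<Rightarrow> nat \<Rightarrow> nat) \<Rightarrow> nat \<Rightarrow> nat" where
  "labels \<Delta> G = fold (label_round \<Delta> G) (rev [0..<N]) (init_labels \<Delta> G)"

definition push :: "nat \<Rightarrow> nat \<Rightarrow> nat \<Rightarrow> (nat \<Rightarrow> nat \<Rightarrow> nat) \<Rightarrow> nat \<Rightarrow> nat \<Rightarrow> nat" where
  "push \<Delta> x y G = (\<lambda>p q. if E x y \<and> p = x \<and> q = y then G p q + \<Delta>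
     else if \<not> E x y \<and> p = y \<and> q = x then G p q - \<Delta> else G p q)"

definition walk_next :: "nat \<Rightarrow> (nat \<Rightarrow> nat) \<Rightarrow> nat \<times> (nat \<Rightarrow> nat \<Rightarrow> nat) \<Rightarrow> nat" where
  "walk_next \<Delta> l s = pick (\<lambda>y. residual \<Delta> (snd s) (fst s) y \<and> l (fst s) < l y)"

definition walk_step :: "nat \<Rightarrow> (nat \<Rightarrow> nat) \<Rightarrow> nat \<times> (nat \<Rightarrow> nat \<Rightarrow> nat) \<Rightarrow> nat \<times> (nat \<Rightarrow> nat \<Rightarrow> nat)" where
  "walk_step \<Delta> l s = (if l (fst s) \<le> N \<and> walk_next \<Delta> l s < N
     then (walk_next \<Delta> l s, push \<Delta> (fst s) (walk_next \<Delta> l s) (snd s)) else s)"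

definition augment :: "nat \<Rightarrow> (nat \<Rightarrow> nat) \<Rightarrow> nat \<Rightarrow> (nat \<Rightarrow> nat \<Rightarrow> nat) \<Rightarrow> nat \<Rightarrow> nat \<Rightarrow> nat" where
  "augment \<Delta> l x G = snd (fold (\<lambda>_. walk_step \<Delta> l) [0..<N] (x, G))"

definition start :: "nat \<Rightarrow> (nat \<Rightarrow> nat \<Rightarrow> nat) \<Rightarrow> (nat \<Rightarrow> nat) \<Rightarrow> nat" where
  "start \<Delta> G l = pick (\<lambda>x. deficient \<Delta> G x \<and> 0 < l x)"

definition step :: "nat \<Rightarrow> (nat \<Rightarrow> nat \<Rightarrow> nat) \<Rightarrow> nat \<Rightarrow> nat \<Rightarrow> nat" where
  "step \<Delta> G = (if start \<Delta> G (labels \<Delta> G) < N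
     then augment \<Delta> (labels \<Delta> G) (start \<Delta> G (labels \<Delta> G)) G else G)"

text \<open>A fixed schedule in place of a loop until no augmentation remains. The number
  \<open>2 * N\<close> is what \<open>phase_spec\<close> needs: a finished phase with
  \<open>2 * \<Delta>\<close> leaves a gap of at most \<open>N * (2 * \<Delta>)\<close>, and each
  augmentation of the next phase closes \<open>\<Delta>\<close> of it.\<close>

definition phases :: "nat \<Rightarrow> nat list" where
  "phases L = concat (map (\<lambda>\<Delta>. replicate (2 * N) \<Delta>) (map (\<lambda>j. 2 ^ j) (rev [0..<Suc L])))"

definition final_labels :: "nat \<Rightarrow> nat \<Rightarrow> nat" where
  "final_labels L = labels 1 (fold step (phases L) (\<lambda>_ _. 0))"

text \<open>Divisibility by \<open>\<Delta>\<close> makes every positive flow at least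
  \<open>\<Delta>\<close>, so that it can be cancelled by a full step.\<close>

definition supported :: "nat \<Rightarrow> (nat \<Rightarrow> nat \<Rightarrow> nat) \<Rightarrow> bool" where
  "supported \<Delta> G \<longleftrightarrow> (\<forall>x<N. \<forall>y<N. \<Delta> dvd G x y \<and> (0 < G x y \<longrightarrow> E x y))"

definition balance :: "(nat \<Rightarrow> nat \<Rightarrow> nat) \<Rightarrow> nat \<Rightarrow> int" where
  "balance G x = int (credit G x) - int (debit G x)"

definition deficit :: "(nat \<Rightarrow> nat \<Rightarrow> nat) \<Rightarrow> int" where
  "deficit G = (\<Sum>x<N. max 0 (- balance G x))"

section \<open>Weak duality between closed sets and flows\<close>

lemma balance_eq: "balance G x = weight x + (\<Sum>y<N. int (G x y)) - (\<Sum>y<N. int (G y x))"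
  by (simp add: balance_def credit_def debit_def weight_def)

text \<open>Flow between nodes of \<open>X\<close> cancels. There is no flow \<open>G x y\<close>
  with \<open>x\<close> inside and \<open>y\<close> outside, since it would lie on an implication
  leaving the closed set; what remains is flow on implications that enter \<open>X\<close>.\<close>

lemma sum_balance:
  assumes X: "closed_set X" and G: "supported \<Delta> G"
  shows "(\<Sum>x\<in>X. balance G x) = (\<Sum>x\<in>X. weight x) - (\<Sum>x\<in>X. \<Sum>y\<in>{..<N} - X. int (G y x))"
proof -
  have sub: "X \<subseteq> {..<N}" using X by (simp add: closed_set_def)
  have split: "(\<Sum>y<N. f y) = (\<Sum>y\<in>X. f y) + (\<Sum>y\<in>{..<N} - X. f y)" for f :: "nat \<Rightarrow> int"
    using sum.subset_diff[OF sub, of f] by simp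
  have "(\<Sum>y\<in>{..<N} - X. int (G x y)) = 0" if "x \<in> X" for x
  proof (rule sum.neutral, rule ballI)
    fix y assume "y \<in> {..<N} - X"
    with that X G sub show "int (G x y) = 0"
      by (force simp: closed_set_def supported_def)
  qed
  then have "(\<Sum>x\<in>X. balance G x) = (\<Sum>x\<in>X. weight x) + (\<Sum>x\<in>X. \<Sum>y\<in>X. int (G x y)) -
      (\<Sum>x\<in>X. (\<Sum>y\<in>X. int (G y x)) + (\<Sum>y\<in>{..<N} - X. int (G y x)))"
    by (simp add: balance_eq split sum.distrib sum_subtractf)
  moreover have "(\<Sum>x\<in>X. \<Sum>y\<in>X. int (G y x)) = (\<Sum>x\<in>X. \<Sum>y\<in>X. int (G x y))"
    by (rule sum.swap)
  ultimately show ?thesis by (simp add: sum.distrib)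
qed

lemma sum_balance_le:
  assumes "closed_set X" "supported \<Delta> G"
  shows "(\<Sum>x\<in>X. balance G x) \<le> (\<Sum>x\<in>X. weight x)"
  unfolding sum_balance[OF assms] by (simp add: sum_nonneg)

text \<open>Weak duality: the deficit of every flow is bounded below by minus the weight of every
  closed set.\<close>

lemma deficit_ge:
  assumes X: "closed_set X" and G: "supported \<Delta> G"
  shows "- (\<Sum>x\<in>X. weight x) \<le> deficit G"
proof -
  have "- (\<Sum>x\<in>X. weight x) \<le> (\<Sum>x\<in>X. - balance G x)"
    using sum_balance_le[OF assms] by (simp add: sum_negf)
  also have "\<dots> \<le> (\<Sum>x\<in>X. max 0 (- balance G x))" by (rule sum_mono) simp
  also have "\<dots> \<le> deficit G"
    unfolding deficit_def using X by (intro sum_mono2) (auto simp: closed_set_def)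
  finally show ?thesis .
qed

section \<open>Labels as a search for excess\<close>

lemma pick_cases: "pick P < N \<and> P (pick P) \<or> pick P = N \<and> (\<forall>y<N. \<not> P y)"
proof -
  have "(let z = fold (\<lambda>y z. if P y then y else z) [0..<m] N in
      z < m \<and> P z \<or> z = N \<and> (\<forall>y<m. \<not> P y))" for m
    by (induction m) (auto simp: Let_def less_Suc_eq)
  from this[of N] show ?thesis by (simp add: pick_def Let_def)
qed

lemma pick_less_iff: "pick P < N \<longleftrightarrow> (\<exists>y<N. P y)"
  using pick_cases[of P] by auto

lemma pick_sat: "pick P < N \<Longrightarrow> P (pick P)"
  using pick_cases[of P] by auto

text \<open>The third statement lets a walk from any labelled node climb to an excess. By the
  fourth, the unlabelled nodes form a set that no residual arc leaves towards a labelled node, which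
  later yields a closed set.\<close>

lemma labels_spec:
  fixes G :: "nat \<Rightarrow> nat \<Rightarrow> nat"
  assumes "0 < \<Delta>"
  defines "l \<equiv> labels \<Delta> G"
  shows "l x \<le> Suc N"
    and "l x = Suc N \<longleftrightarrow> excessive \<Delta> G x"
    and "0 < l x \<Longrightarrow> l x \<le> N \<Longrightarrow> \<exists>y<N. residual \<Delta> G x y \<and> l x < l y"
    and "x < N \<Longrightarrow> y < N \<Longrightarrow> l x = 0 \<Longrightarrow> residual \<Delta> G x y \<Longrightarrow> l y = 0"
proof -
  \<comment> \<open>Here \<open>m\<close> is the number of the round just finished and
    \<open>N - m\<close> counts the rounds done. By \<open>m < l x\<close>, the label of the next
    round is smaller than all earlier ones. The disjunction says that the search is saturated or
    every round so far has labelled a new node; in the second case \<open>N\<close> rounds label all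
    nodes.\<close>
  define inv where "inv m l \<longleftrightarrow> (\<forall>x. l x \<le> Suc N \<and> (l x = Suc N \<longleftrightarrow> excessive \<Delta> G x) \<and>
      (0 < l x \<and> l x \<le> N \<longrightarrow> (\<exists>y<N. residual \<Delta> G x y \<and> l x < l y)) \<and> (0 < l x \<longrightarrow> m < l x)) \<and>
    ((\<forall>x<N. \<forall>y<N. l x = 0 \<and> residual \<Delta> G x y \<longrightarrow> l y = 0) \<or> N - m \<le> card {x. x < N \<and> 0 < l x})"
    for m l
  have "inv m (fold (label_round \<Delta> G) (rev [m..<N]) (init_labels \<Delta> G))" if "m \<le> N" for m
    using that
  proof (induction m rule: inc_induct)
    case base
    show ?case by (simp add: inv_def init_labels_def)
  next
    case (step m)
    define l where "l = fold (label_round \<Delta> G) (rev [Suc m..<N]) (init_labels \<Delta> G)"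
    define l' where "l' = label_round \<Delta> G m l"
    have l: "inv (Suc m) l" using step.IH by (simp add: l_def)
    have l'_eq: "l' x = (if l x = 0 \<and> (\<exists>y<N. residual \<Delta> G x y \<and> 0 < l y) then Suc m else l x)" for x
      by (simp add: l'_def label_round_def pick_less_iff)
    have mono: "l x \<le> l' x" for x by (simp add: l'_eq)
    from l have l1: "l x \<le> Suc N" and l2: "l x = Suc N \<longleftrightarrow> excessive \<Delta> G x"
      and l3: "0 < l x \<Longrightarrow> l x \<le> N \<Longrightarrow> \<exists>y<N. residual \<Delta> G x y \<and> l x < l y"
      and l4: "0 < l x \<Longrightarrow> Suc m < l x" for x
      unfolding inv_def by blast+
    have 1: "l' x \<le> Suc N" "l' x = Suc N \<longleftrightarrow> excessive \<Delta> G x" "0 < l' x \<longrightarrow> m < l' x" for x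
      using l1[of x] l2[of x] l4[of x] step.hyps by (cases "l x = 0"; simp add: l'_eq)+
    have 2: "\<exists>y<N. residual \<Delta> G x y \<and> l' x < l' y" if "0 < l' x" "l' x \<le> N" for x
    proof (cases "l x = 0")
      case True
      with that(1) have ex: "\<exists>y<N. residual \<Delta> G x y \<and> 0 < l y"
        unfolding l'_eq by (auto split: if_splits)
      with True have x: "l' x = Suc m" by (simp add: l'_eq)
      from ex obtain y where y: "y < N" "residual \<Delta> G x y" "0 < l y" by blast
      with x l4[of y] mono[of y] have "l' x < l' y" by simp
      with y show ?thesis by blast
    next
      case False
      then have x: "l' x = l x" by (simp add: l'_eq)
      with False that l3[of x] obtain y where "y < N" "residual \<Delta> G x y" "l x < l y" by auto
      moreover from this x mono[of y] have "l' x < l' y" by simp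
      ultimately show ?thesis by blast
    qed
    have 3: "(\<forall>x<N. \<forall>y<N. l' x = 0 \<and> residual \<Delta> G x y \<longrightarrow> l' y = 0) \<or>
      N - m \<le> card {x. x < N \<and> 0 < l' x}"
    proof (cases "\<forall>x<N. \<forall>y<N. l x = 0 \<and> residual \<Delta> G x y \<longrightarrow> l y = 0")
      case True
      have eq: "l' x = l x" if "x < N" for x
      proof -
        have "\<not> (l x = 0 \<and> (\<exists>y<N. residual \<Delta> G x y \<and> 0 < l y))"
          using True that less_numeral_extra(3) by metis
        then show ?thesis unfolding l'_eq by (rule if_not_P)
      qed
      show ?thesis
      proof (intro disjI1 allI impI)
        fix x y assume "x < N" "y < N" "l' x = 0 \<and> residual \<Delta> G x y"
        with True eq show "l' y = 0" by metis
      qed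
    next
      case False
      then obtain x y where xy: "x < N" "y < N" "l x = 0" "residual \<Delta> G x y" "0 < l y"
        using neq0_conv by metis
      then have "l' x = Suc m" unfolding l'_eq by (intro if_P) blast
      then have "x \<in> {x. x < N \<and> 0 < l' x}" "x \<notin> {x. x < N \<and> 0 < l x}" using xy by simp_all
      moreover have "{x. x < N \<and> 0 < l x} \<subseteq> {x. x < N \<and> 0 < l' x}"
        using mono by (auto intro: less_le_trans)
      ultimately have "{x. x < N \<and> 0 < l x} \<subset> {x. x < N \<and> 0 < l' x}" by blast
      then have "card {x. x < N \<and> 0 < l x} < card {x. x < N \<and> 0 < l' x}"
        by (intro psubset_card_mono) auto
      moreover have "N - Suc m \<le> card {x. x < N \<and> 0 < l x}" using False l unfolding inv_def by blast
      ultimately show ?thesis by linarith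
    qed
    have "inv m l'" using 1 2 3 unfolding inv_def by blast
    moreover have "fold (label_round \<Delta> G) (rev [m..<N]) (init_labels \<Delta> G) = l'"
      using step.hyps by (simp add: upt_conv_Cons l'_def l_def)
    ultimately show ?case by simp
  qed
  from this[of 0] have inv: "inv 0 l" by (simp add: l_def labels_def)
  then show "l x \<le> Suc N" "l x = Suc N \<longleftrightarrow> excessive \<Delta> G x"
    "0 < l x \<Longrightarrow> l x \<le> N \<Longrightarrow> \<exists>y<N. residual \<Delta> G x y \<and> l x < l y" by (simp_all add: inv_def)
  from inv consider "\<forall>x<N. \<forall>y<N. l x = 0 \<and> residual \<Delta> G x y \<longrightarrow> l y = 0"
    | "N \<le> card {x. x < N \<and> 0 < l x}" by (auto simp: inv_def)
  then show "l y = 0" if "x < N" "y < N" "l x = 0" "residual \<Delta> G x y"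
  proof cases
    case 2
    then have "{x. x < N \<and> 0 < l x} = {..<N}" by (intro card_seteq) auto
    moreover have "x \<in> {..<N}" using that(1) by simp
    ultimately have "0 < l x" by blast
    with that(3) show ?thesis by simp
  next
    case 1
    with that show ?thesis by metis
  qed
qed

section \<open>Augmentation along a walk of increasing labels\<close>

lemma balance_push:
  assumes "x < N" "y < N" "x \<noteq> y" "E x y \<or> \<Delta> \<le> G y x"
  shows "balance (push \<Delta> x y G) z =
    balance G z + (if z = x then int \<Delta> else 0) - (if z = y then int \<Delta> else 0)"
proof (cases "E x y")
  case True
  \<comment> \<open>The conditional is nested in both orders so that the row sum and the column sum
    each collapse on their own index.\<close>
  have "int (push \<Delta> x y G p q) = int (G p q) + (if q = y then if p = x then int \<Delta> else 0 else 0)"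
    "int (push \<Delta> x y G p q) = int (G p q) + (if p = x then if q = y then int \<Delta> else 0 else 0)" for p q
    using True by (auto simp: push_def)
  then have "(\<Sum>q<N. int (push \<Delta> x y G z q)) = (\<Sum>q<N. int (G z q)) + (if z = x then int \<Delta> else 0)"
    "(\<Sum>p<N. int (push \<Delta> x y G p z)) = (\<Sum>p<N. int (G p z)) + (if z = y then int \<Delta> else 0)"
    using assms(1,2) by (simp_all add: sum.distrib)
  then show ?thesis by (simp add: balance_eq)
next
  case False
  have "int (push \<Delta> x y G p q) = int (G p q) - (if q = x then if p = y then int \<Delta> else 0 else 0)"
    "int (push \<Delta> x y G p q) = int (G p q) - (if p = y then if q = x then int \<Delta> else 0 else 0)" for p q
    using False assms(4) by (auto simp: push_def)
  then have "(\<Sum>q<N. int (push \<Delta> x y G z q)) = (\<Sum>q<N. int (G z q)) - (if z = y then int \<Delta> else 0)"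
    "(\<Sum>p<N. int (push \<Delta> x y G p z)) = (\<Sum>p<N. int (G p z)) - (if z = x then int \<Delta> else 0)"
    using assms(1,2) by (simp_all add: sum_subtractf)
  then show ?thesis by (simp add: balance_eq)
qed

lemma supported_push:
  assumes "supported \<Delta> G"
  shows "supported \<Delta> (push \<Delta> x y G)"
  using assms unfolding supported_def push_def by (auto simp: dvd_diff_nat)

text \<open>Labels increase along the walk, so that each residual arc it uses is still unchanged.\<close>

lemma augment_spec:
  assumes \<Delta>: "0 < \<Delta>" and G: "supported \<Delta> G" and x: "x < N" "0 < labels \<Delta> G x"
  obtains y where "y < N" "excessive \<Delta> G y" "supported \<Delta> (augment \<Delta> (labels \<Delta> G) x G)"
    "\<And>z. balance (augment \<Delta> (labels \<Delta> G) x G) z =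
      balance G z + (if z = x then int \<Delta> else 0) - (if z = y then int \<Delta> else 0)"
proof -
  define l where "l = labels \<Delta> G"
  note l = labels_spec[OF \<Delta>, where G = G, folded l_def]
  \<comment> \<open>The clause \<open>m < l (fst s)\<close> measures progress: each round raises the
    label unless it is \<open>Suc N\<close> already, so after \<open>N\<close> rounds the walk
    stands at an excessive node.\<close>
  define inv where "inv m s \<longleftrightarrow> fst s < N \<and> supported \<Delta> (snd s) \<and> (l (fst s) = Suc N \<or> m < l (fst s)) \<and>
      (\<forall>z. balance (snd s) z = balance G z + (if z = x then int \<Delta> else 0) - (if z = fst s then int \<Delta> else 0)) \<and>
      (\<forall>p q. l (fst s) < l p \<longrightarrow> snd s p q = G p q \<and> snd s q p = G q p)" for m :: nat and s
  have "inv m (fold (\<lambda>_. walk_step \<Delta> l) [0..<m] (x, G))" for m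
  proof (induction m)
    case 0
    then show ?case using x G by (simp add: inv_def l_def)
  next
    case (Suc m)
    obtain v F where s: "fold (\<lambda>_. walk_step \<Delta> l) [0..<m] (x, G) = (v, F)" by fastforce
    from Suc have inv: "inv m (v, F)" by (simp add: s)
    show ?case
    proof (cases "l v = Suc N")
      case True
      then have "walk_step \<Delta> l (v, F) = (v, F)" by (simp add: walk_step_def)
      with inv True show ?thesis by (simp add: s inv_def)
    next
      case False
      with inv l(1)[of v] have v: "v < N" "m < l v" "l v \<le> N" "supported \<Delta> F"
        and same: "\<And>p q. l v < l p \<Longrightarrow> F p q = G p q \<and> F q p = G q p"
        and bal: "\<And>z. balance F z = balance G z + (if z = x then int \<Delta> else 0) - (if z = v then int \<Delta> else 0)"
        by (auto simp: inv_def)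
      define w where "w = walk_next \<Delta> l (v, F)"
      obtain y where "y < N" "residual \<Delta> G v y" "l v < l y" using l(3)[of v] v by auto
      then have "\<exists>y<N. residual \<Delta> F v y \<and> l v < l y" using same[of y v] by (auto simp: residual_def)
      then have "w < N" by (simp add: w_def walk_next_def pick_less_iff)
      with pick_sat have w: "w < N" "residual \<Delta> F v w" "l v < l w"
        unfolding w_def walk_next_def fst_conv snd_conv by blast+
      have "inv (Suc m) (w, push \<Delta> v w F)"
        unfolding inv_def fst_conv snd_conv
      proof (intro conjI allI impI)
        fix z
        show "balance (push \<Delta> v w F) z =
            balance G z + (if z = x then int \<Delta> else 0) - (if z = w then int \<Delta> else 0)"
        proof -
          have "v \<noteq> w" using w(3) by auto
          with balance_push[of v w \<Delta> F z] v(1) w(1,2) bal[of z] show ?thesis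
            unfolding residual_def by linarith
        qed
      next
        fix p q assume p: "l w < l p"
        with w same[of p q] have "F p q = G p q" "F q p = G q p" by auto
        moreover have "p \<noteq> v" "p \<noteq> w" using p w by auto
        ultimately show "push \<Delta> v w F p q = G p q" "push \<Delta> v w F q p = G q p" by (auto simp: push_def)
      qed (use v w supported_push in auto)
      moreover have "walk_step \<Delta> l (v, F) = (w, push \<Delta> v w F)"
        using v w by (simp add: walk_step_def w_def)
      ultimately show ?thesis by (simp add: s)
    qed
  qed
  from this[of N] obtain y F where s: "fold (\<lambda>_. walk_step \<Delta> l) [0..<N] (x, G) = (y, F)"
    and inv: "inv N (y, F)" by (metis prod.collapse)
  have F: "augment \<Delta> (labels \<Delta> G) x G = F" by (simp add: augment_def s flip: l_def)
  show ?thesis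
  proof (rule that[of y])
    have "l y = Suc N" using inv l(1)[of y] by (auto simp: inv_def)
    then show "excessive \<Delta> G y" using l(2) by simp
  qed (use inv in \<open>auto simp: F inv_def\<close>)
qed

text \<open>The start has balance at most \<open>- \<Delta>\<close> and the end at least
  \<open>\<Delta>\<close>. Hence the gain at the start is entirely a reduction of its deficit, and
  the loss at the end creates no new one.\<close>

lemma step_augments:
  assumes \<Delta>: "0 < \<Delta>" and G: "supported \<Delta> G" and s: "start \<Delta> G (labels \<Delta> G) < N"
  shows "supported \<Delta> (step \<Delta> G)" "deficit (step \<Delta> G) = deficit G - int \<Delta>"
proof -
  define x where "x = start \<Delta> G (labels \<Delta> G)"
  have x: "x < N" "deficient \<Delta> G x" "0 < labels \<Delta> G x"
    using s pick_sat unfolding x_def start_def by blast+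
  obtain y where y: "y < N" "excessive \<Delta> G y" "supported \<Delta> (augment \<Delta> (labels \<Delta> G) x G)"
    and bal: "\<And>z. balance (augment \<Delta> (labels \<Delta> G) x G) z =
      balance G z + (if z = x then int \<Delta> else 0) - (if z = y then int \<Delta> else 0)"
    using augment_spec[OF \<Delta> G x(1,3)] by metis
  have st: "step \<Delta> G = augment \<Delta> (labels \<Delta> G) x G" using s by (simp add: step_def x_def)
  show "supported \<Delta> (step \<Delta> G)" using y st by simp
  have r: "balance G x \<le> - int \<Delta>" "int \<Delta> \<le> balance G y"
    using x(2) y(2) by (auto simp: deficient_def excessive_def balance_def)
  then have "max 0 (- balance (step \<Delta> G) z) = max 0 (- balance G z) - (if z = x then int \<Delta> else 0)" for z
    using \<Delta> by (auto simp: st bal)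
  then show "deficit (step \<Delta> G) = deficit G - int \<Delta>"
    using x(1) by (simp add: deficit_def sum_subtractf)
qed

section \<open>Cuts left by a failed search, and the scaling phases\<close>

text \<open>\<open>X\<close> consists of the nodes from which no excess is reachable. It is closed
  because implications are residual. Positive flow into \<open>X\<close> would be a multiple of
  \<open>\<Delta>\<close>, so its reversal would be residual and lead out of \<open>X\<close>;
  without such flow \<open>sum_balance\<close> becomes an equality.\<close>

lemma no_augmentation_cut:
  fixes G :: "nat \<Rightarrow> nat \<Rightarrow> nat"
  assumes \<Delta>: "0 < \<Delta>" and G: "supported \<Delta> G" and s: "\<not> start \<Delta> G (labels \<Delta> G) < N"
  defines "X \<equiv> {x. x < N \<and> labels \<Delta> G x = 0}"
  shows "closed_set X" "\<And>x. x \<in> X \<Longrightarrow> balance G x < int \<Delta>"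
    "\<And>x. x < N \<Longrightarrow> x \<notin> X \<Longrightarrow> - int \<Delta> < balance G x"
    "(\<Sum>x\<in>X. balance G x) = (\<Sum>x\<in>X. weight x)"
proof -
  note l = labels_spec[OF \<Delta>, where G = G]
  have res: "y \<in> X" if "x \<in> X" "y < N" "residual \<Delta> G x y" for x y
    using l(4)[of x y] that by (simp add: X_def)
  then show X: "closed_set X" by (auto simp: closed_set_def residual_def X_def)
  show "balance G x < int \<Delta>" if "x \<in> X" for x
    using l(2)[of x] that by (auto simp: X_def excessive_def balance_def)
  show "- int \<Delta> < balance G x" if "x < N" "x \<notin> X" for x
  proof -
    have "0 < labels \<Delta> G x" using that by (simp add: X_def)
    with s that(1) have "\<not> deficient \<Delta> G x" by (auto simp: start_def pick_less_iff)
    then show ?thesis by (simp add: deficient_def balance_def)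
  qed
  have "G y x = 0" if "x \<in> X" "y \<in> {..<N} - X" for x y
  proof (rule ccontr)
    assume "G y x \<noteq> 0"
    moreover have "\<Delta> dvd G y x" using that G by (auto simp: supported_def X_def)
    ultimately have "residual \<Delta> G x y" by (auto simp: residual_def intro: dvd_imp_le)
    with res that show False by auto
  qed
  then have "(\<Sum>x\<in>X. \<Sum>y\<in>{..<N} - X. int (G y x)) = 0" by simp
  with sum_balance[OF X G] show "(\<Sum>x\<in>X. balance G x) = (\<Sum>x\<in>X. weight x)" by simp
qed

text \<open>The cut attains weak duality up to an error of \<open>\<Delta>\<close> per node.\<close>

lemma no_augmentation_deficit:
  assumes \<Delta>: "0 < \<Delta>" and G: "supported \<Delta> G" and s: "\<not> start \<Delta> G (labels \<Delta> G) < N"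
  obtains X where "closed_set X" "deficit G \<le> - (\<Sum>x\<in>X. weight x) + int N * int \<Delta>"
proof -
  define X where "X = {x. x < N \<and> labels \<Delta> G x = 0}"
  note cut = no_augmentation_cut[OF assms, folded X_def]
  have "deficit G \<le> (\<Sum>x<N. int \<Delta> + (if x \<in> X then - balance G x else 0))"
    unfolding deficit_def
  proof (rule sum_mono)
    fix x assume "x \<in> {..<N}"
    then show "max 0 (- balance G x) \<le> int \<Delta> + (if x \<in> X then - balance G x else 0)"
      using cut(2)[of x] cut(3)[of x] by (cases "x \<in> X") auto
  qed
  also have "\<dots> = int N * int \<Delta> + (\<Sum>x\<in>X. - balance G x)"
    by (simp add: sum.distrib sum.If_cases X_def Int_def)
  finally show ?thesis using that[OF cut(1)] cut(4) by (simp add: sum_negf)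
qed

text \<open>If augmentation were still possible after the phase, all \<open>2 * N\<close> steps
  would have augmented and brought the deficit down to its lower bound; one more augmentation would
  pass below it.\<close>

lemma phase_spec:
  fixes G :: "nat \<Rightarrow> nat \<Rightarrow> nat"
  assumes \<Delta>: "0 < \<Delta>" and G: "supported \<Delta> G"
    and X: "closed_set X" "deficit G \<le> - (\<Sum>x\<in>X. weight x) + 2 * int N * int \<Delta>"
  defines "G' \<equiv> fold step (replicate (2 * N) \<Delta>) G"
  shows "supported \<Delta> G'" "\<not> start \<Delta> G' (labels \<Delta> G') < N"
proof -
  \<comment> \<open>The deficit is estimated only as long as a start exists: once there is none,
    \<open>step\<close> is the identity and the estimate remains vacuous.\<close>
  have *: "supported \<Delta> (fold step (replicate m \<Delta>) G) \<and>
      (let G' = fold step (replicate m \<Delta>) G in start \<Delta> G' (labels \<Delta> G') < N \<longrightarrow>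
      deficit G' \<le> - (\<Sum>x\<in>X. weight x) + (2 * int N - int m) * int \<Delta>)" for m
  proof (induction m)
    case 0
    then show ?case using G X by simp
  next
    case (Suc m)
    define F where "F = fold step (replicate m \<Delta>) G"
    have rep: "replicate (Suc m) \<Delta> = replicate m \<Delta> @ [\<Delta>]" by (simp add: replicate_append_same)
    have Suc_F: "fold step (replicate (Suc m) \<Delta>) G = step \<Delta> F" unfolding rep by (simp add: F_def)
    show ?case
    proof (cases "start \<Delta> F (labels \<Delta> F) < N")
      case True
      then show ?thesis
        using Suc step_augments[OF \<Delta> _ True] unfolding Suc_F by (simp add: F_def Let_def algebra_simps)
    next
      case False
      then have "step \<Delta> F = F" by (simp add: step_def)
      with False Suc show ?thesis unfolding Suc_F by (simp add: F_def Let_def)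
    qed
  qed
  from *[of "2 * N"] show sup: "supported \<Delta> G'" by (simp add: G'_def)
  show "\<not> start \<Delta> G' (labels \<Delta> G') < N"
  proof
    assume s: "start \<Delta> G' (labels \<Delta> G') < N"
    with *[of "2 * N"] have "deficit G' \<le> - (\<Sum>x\<in>X. weight x)" by (simp add: G'_def Let_def)
    with step_augments[OF \<Delta> sup s] deficit_ge[OF X(1), of \<Delta> "step \<Delta> G'"] \<Delta> show False by simp
  qed
qed

text \<open>The gap \<open>N * 2 ^ Suc L\<close> left by one phase is exactly the gap
  \<open>2 * N * 2 ^ L\<close> that the next one admits. The closed set used for comparison changes
  from phase to phase, so it is generalised in the induction.\<close>

lemma phases_spec:
  fixes G :: "nat \<Rightarrow> nat \<Rightarrow> nat"
  assumes "supported (2 ^ L) G" "closed_set X"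
    "deficit G \<le> - (\<Sum>x\<in>X. weight x) + 2 * int N * 2 ^ L"
  defines "G' \<equiv> fold step (phases L) G"
  shows "supported 1 G' \<and> \<not> start 1 G' (labels 1 G') < N"
  using assms(1-3) unfolding G'_def
proof (induction L arbitrary: G X)
  case 0
  then show ?case using phase_spec[of 1 G X] by (simp add: phases_def)
next
  case (Suc L)
  define F where "F = fold step (replicate (2 * N) (2 ^ Suc L)) G"
  have F: "supported (2 ^ Suc L) F" "\<not> start (2 ^ Suc L) F (labels (2 ^ Suc L) F) < N"
    using phase_spec[of "2 ^ Suc L" G X] Suc.prems by (simp_all add: F_def)
  obtain Y where "closed_set Y" "deficit F \<le> - (\<Sum>x\<in>Y. weight x) + int N * int (2 ^ Suc L)"
    using no_augmentation_deficit[OF _ F] by auto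
  moreover have "supported (2 ^ L) F"
    using F(1) unfolding supported_def by (auto intro: dvd_trans[of _ "2 ^ Suc L"])
  ultimately have "supported 1 (fold step (phases L) F) \<and>
      \<not> start 1 (fold step (phases L) F) (labels 1 (fold step (phases L) F)) < N"
    using Suc.IH[of F Y] by simp
  moreover have "phases (Suc L) = replicate (2 * N) (2 ^ Suc L) @ phases L"
    by (simp add: phases_def)
  ultimately show ?case by (simp add: F_def)
qed

text \<open>For \<open>\<Delta> = 1\<close> integrality gives balances at most 0 inside
  \<open>X\<close> and at least 0 outside, so \<open>X\<close> minimises the sum of balances. This
  sum equals the weight for \<open>X\<close>, and for any other closed set it is at most the
  weight.\<close>

theorem min_weight_closed:
  assumes L: "\<And>x. x < N \<Longrightarrow> b x \<le> 2 ^ L"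
  defines "X \<equiv> {x. x < N \<and> final_labels L x = 0}"
  shows "closed_set X" "closed_set Y \<Longrightarrow> (\<Sum>x\<in>X. weight x) \<le> (\<Sum>x\<in>Y. weight x)"
proof -
  define G where "G = fold step (phases L) (\<lambda>_ _. 0)"
  have "deficit (\<lambda>_ _. 0) \<le> (\<Sum>x<N. 2 ^ L)"
    unfolding deficit_def
  proof (rule sum_mono)
    fix x assume "x \<in> {..<N}"
    with L[of x] have "int (b x) \<le> 2 ^ L" by (metis lessThan_iff of_nat_le_iff of_nat_numeral of_nat_power)
    then have "int (b x) - int (a x) \<le> 2 ^ L" by linarith
    then show "max 0 (- balance (\<lambda>_ _. 0) x) \<le> 2 ^ L" by (simp add: balance_eq weight_def)
  qed
  also have "\<dots> \<le> 2 * int N * 2 ^ L" by simp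
  \<comment> \<open>The empty closed set, of weight 0, provides the comparison for the first
    phase.\<close>
  finally have "supported 1 G \<and> \<not> start 1 G (labels 1 G) < N"
    unfolding G_def by (intro phases_spec[of _ _ "{}"]) (auto simp: supported_def closed_set_def)
  then have G: "supported 1 G" "\<not> start 1 G (labels 1 G) < N" by auto
  have X: "X = {x. x < N \<and> labels 1 G x = 0}" by (simp add: X_def final_labels_def G_def)
  note cut = no_augmentation_cut[OF _ G, folded X]
  show "closed_set X" using cut(1) by simp
  assume Y: "closed_set Y"
  have fin: "finite X" "finite Y" using Y by (auto simp: X closed_set_def intro: finite_subset)
  have "(\<Sum>x\<in>X. weight x) = (\<Sum>x\<in>X. balance G x)" using cut(4) by simp
  also have "\<dots> = (\<Sum>x\<in>X \<inter> Y. balance G x) + (\<Sum>x\<in>X - Y. balance G x)"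
    using sum.Int_Diff[OF fin(1)] by blast
  also have "\<dots> \<le> (\<Sum>x\<in>X \<inter> Y. balance G x)"
  proof -
    have "balance G x \<le> 0" if "x \<in> X - Y" for x using cut(2)[of x] that by simp
    then have "(\<Sum>x\<in>X - Y. balance G x) \<le> 0" by (rule sum_nonpos)
    then show ?thesis by simp
  qed
  also have "\<dots> \<le> (\<Sum>x\<in>Y \<inter> X. balance G x) + (\<Sum>x\<in>Y - X. balance G x)"
  proof -
    have "0 \<le> balance G x" if "x \<in> Y - X" for x
      using cut(3)[of x] that Y by (auto simp: closed_set_def)
    then have "0 \<le> (\<Sum>x\<in>Y - X. balance G x)" by (rule sum_nonneg)
    then show ?thesis by (simp add: Int_commute)
  qed
  also have "\<dots> = (\<Sum>x\<in>Y. balance G x)" using sum.Int_Diff[OF fin(2), of "balance G" X] by simp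
  also have "\<dots> \<le> (\<Sum>x\<in>Y. weight x)" by (rule sum_balance_le[OF Y G(1)])
  finally show "(\<Sum>x\<in>X. weight x) \<le> (\<Sum>x\<in>Y. weight x)" .
qed

section \<open>Growth of the flow\<close>

text \<open>Each of the \<open>N\<close> moves of a walk adds at most \<open>\<Delta>\<close> to an
  entry. This bounds the bit sizes of flow matrices when the algorithm is run.\<close>

lemma step_le: "step \<Delta> G p q \<le> G p q + N * \<Delta>"
proof -
  have "snd (fold (\<lambda>_. walk_step \<Delta> l) [0..<m] (x, G)) p q \<le> G p q + m * \<Delta>" for l m x
  proof (induction m)
    case (Suc m)
    have "snd (walk_step \<Delta> l s) p q \<le> snd s p q + \<Delta>" for s
      by (auto simp: walk_step_def push_def intro: order_trans[OF diff_le_self])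
    from order_trans[OF this add_right_mono[OF Suc]] show ?case by simp
  qed simp
  then show ?thesis by (simp add: step_def augment_def)
qed

lemma fold_step_le: "fold step \<Delta>s G p q \<le> G p q + N * sum_list \<Delta>s"
proof (induction \<Delta>s arbitrary: G)
  case (Cons \<Delta> \<Delta>s)
  have "fold step (\<Delta> # \<Delta>s) G p q \<le> step \<Delta> G p q + N * sum_list \<Delta>s" using Cons by simp
  also have "\<dots> \<le> (G p q + N * \<Delta>) + N * sum_list \<Delta>s" by (rule add_right_mono[OF step_le])
  also have "\<dots> = G p q + N * sum_list (\<Delta> # \<Delta>s)" by (simp add: distrib_left)
  finally show ?case .
qed simp

end

subsection \<open>Vectors and matrices\<close>

abbreviation enc_vec :: "nat \<Rightarrow> (nat \<Rightarrow> nat) \<Rightarrow> data" where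
  "enc_vec N f \<equiv> enc_map (\<lambda>x. Num (f x)) [0..<N]"

abbreviation enc_mat :: "nat \<Rightarrow> (nat \<Rightarrow> nat \<Rightarrow> nat) \<Rightarrow> data" where
  "enc_mat N G \<equiv> enc_map (\<lambda>x. enc_vec N (G x)) [0..<N]"

abbreviation loop_dom :: "'i set \<Rightarrow> ('i \<Rightarrow> nat) \<Rightarrow> ('i \<times> nat) set" where
  "loop_dom I N \<equiv> {(i, x). i \<in> I \<and> x \<in> set [0..<N i]}"

abbreviation loop_env :: "('i \<Rightarrow> data) \<Rightarrow> 'i \<times> nat \<Rightarrow> data" where
  "loop_env e \<equiv> ext e (\<lambda>j. Num (snd j))"

lemma polytime_loop_lift:
  "polytime I e f \<Longrightarrow> polytime (loop_dom I N) (loop_env e) (\<lambda>j. f (fst j))"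
  by (erule polytime_lift) auto

lemma polytime_vec_nth:
  assumes "polytime I e (\<lambda>i. enc_vec (N i) (f i))" "polytime I e (\<lambda>i. Num (x i))"
    and "\<And>i. i \<in> I \<Longrightarrow> x i < N i"
  shows "polytime I e (\<lambda>i. Num (f i (x i)))"
proof -
  have "polytime I e (\<lambda>i. enc_map id (map (\<lambda>x. Num (f i x)) [0..<N i]))" using assms(1) by simp
  from polytime_nth[OF this assms(2)] have "polytime I e (\<lambda>i. id (map (\<lambda>x. Num (f i x)) [0..<N i] ! x i))"
    using assms(3) by simp
  then show ?thesis by (rule polytime_cong) (use assms(3) in simp)
qed

lemma polytime_mat_nth:
  assumes "polytime I e (\<lambda>i. enc_mat (N i) (G i))" "polytime I e (\<lambda>i. Num (x i))"
    "polytime I e (\<lambda>i. Num (y i))" and "\<And>i. i \<in> I \<Longrightarrow> x i < N i" "\<And>i. i \<in> I \<Longrightarrow> y i < N i"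
  shows "polytime I e (\<lambda>i. Num (G i (x i) (y i)))"
proof -
  have "polytime I e (\<lambda>i. enc_map id (map (\<lambda>x. enc_vec (N i) (G i x)) [0..<N i]))"
    using assms(1) by (simp add: o_def)
  from polytime_nth[OF this assms(2)]
  have "polytime I e (\<lambda>i. id (map (\<lambda>x. enc_vec (N i) (G i x)) [0..<N i] ! x i))"
    using assms(4) by simp
  then have "polytime I e (\<lambda>i. enc_vec (N i) (G i (x i)))"
    by (rule polytime_cong) (use assms(4) in simp)
  then show ?thesis by (rule polytime_vec_nth) (use assms in auto)
qed

text \<open>Sizes are supplied as lists \<open>[0..<N i]\<close>, in effect in unary: then
  \<open>N i\<close> itself, and not only its bit size, is polynomially bounded.\<close>

lemma polytime_size:
  assumes "polytime I e (\<lambda>i. enc_map Num [0..<N i])"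
  shows "polytime I e (\<lambda>i. Num (N i))" "polybound I e N"
proof -
  show "polytime I e (\<lambda>i. Num (N i))" using polytime_upt(1)[OF assms] by simp
  show "polybound I e N"
    by (rule polybound_mono[OF polytime_bitsize[OF assms]])
      (metis length_le_bitsize length_upt minus_nat.diff_0)
qed

lemma polytime_mat:
  assumes N: "polytime I e (\<lambda>i. enc_map Num [0..<N i])"
    and f: "polytime (loop_dom (loop_dom I N) (\<lambda>j. N (fst j))) (loop_env (loop_env e))
      (\<lambda>j. Num (G (fst (fst j)) (snd (fst j)) (snd j)))"
  shows "polytime I e (\<lambda>i. enc_mat (N i) (G i))"
  by (rule polytime_map[OF N], rule polytime_map[OF polytime_loop_lift[OF N]]) (rule f)

lemma polytime_sum:
  assumes N: "polytime I e (\<lambda>i. enc_map Num [0..<N i])"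
    and f: "polytime (loop_dom I N) (loop_env e) (\<lambda>j. Num (f (fst j) (snd j)))"
  shows "polytime I e (\<lambda>i. Num (\<Sum>x<N i. f i x))"
proof -
  have "polytime I e (\<lambda>i. Num (fold (\<lambda>x. (+) (f i x)) [0..<N i] 0))"
    by (rule polytime_aggregate[OF N f polytime_add bitsize_add])
  moreover have "fold (\<lambda>x. (+) (f i x)) [0..<n] 0 = (\<Sum>x<n. f i x)" for i n
    by (induction n) auto
  ultimately show ?thesis by simp
qed

lemma polytime_prod:
  assumes N: "polytime I e (\<lambda>i. enc_map Num [0..<N i])"
    and f: "polytime (loop_dom I N) (loop_env e) (\<lambda>j. Num (f (fst j) (snd j)))"
  shows "polytime I e (\<lambda>i. Num (\<Prod>x<N i. f i x))"
proof -
  have "polytime I e (\<lambda>i. Num (fold (\<lambda>x. (*) (f i x)) [0..<N i] 1))"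
    by (rule polytime_aggregate[OF N f polytime_mult bitsize_mult])
  moreover have "fold (\<lambda>x. (*) (f i x)) [0..<n] 1 = (\<Prod>x<n. f i x)" for i n
    by (induction n) auto
  ultimately show ?thesis by simp
qed

lemma bitsize_vec_le:
  "(\<And>x. x < N \<Longrightarrow> bitsize (Num (f x)) \<le> B) \<Longrightarrow> bitsize (enc_vec N f) \<le> 1 + N * (1 + B)"
  using bitsize_enc_map_le[of "[0..<N]" "\<lambda>x. Num (f x)" B] by simp

lemma bitsize_mat_le:
  assumes "\<And>x y. x < N \<Longrightarrow> y < N \<Longrightarrow> bitsize (Num (G x y)) \<le> B"
  shows "bitsize (enc_mat N G) \<le> 1 + N * (1 + (1 + N * (1 + B)))"
  using bitsize_enc_map_le[of "[0..<N]" "\<lambda>x. enc_vec N (G x)" "1 + N * (1 + B)"]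
    bitsize_vec_le[of N "G _" B] assms by simp

lemma bitsize_mat_entry:
  assumes "x < N" "y < N"
  shows "bitsize (Num (G x y)) \<le> bitsize (enc_mat N G)"
proof -
  have "bitsize (Num (G x y)) \<le> bitsize (enc_vec N (G x))"
    by (rule bitsize_mem) (use assms in simp)
  also have "\<dots> \<le> bitsize (enc_mat N G)"
    by (rule bitsize_mem) (use assms in simp)
  finally show ?thesis .
qed

lemma polytime_pick:
  assumes N: "polytime I e (\<lambda>i. enc_map Num [0..<N i])"
    and P: "polytime_pred (loop_dom I N) (loop_env e) (\<lambda>j. P (fst j) (snd j))"
  shows "polytime I e (\<lambda>i. Num (implication_network.pick (N i) (P i)))"
proof -
  have le: "fold (\<lambda>y z. if P i y then y else z) us (N i) \<le> N i" if "set us \<subseteq> set [0..<N i]" for us i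
    using that by (induction us rule: rev_induct) auto
  have "polytime I e (\<lambda>i. (\<lambda>_. Num) i (fold ((\<lambda>i y z. if P i y then y else z) i) [0..<N i] (N i)))"
  proof (rule polytime_fold[where A = "\<lambda>_ _. True" and B = "\<lambda>i. 1 + N i", OF N])
    let ?J = "{((i, x), a). i \<in> I \<and> x \<in> set [0..<N i] \<and> True}"
    have P': "polytime_pred J (ext (loop_env e) (\<lambda>j. Num (snd j))) (\<lambda>j. P (fst (fst j)) (snd (fst j)))"
      if "J \<subseteq> ?J" for J
      by (rule polytime_lift[OF P]) (use that in auto)
    have x: "polytime J (ext (loop_env e) (\<lambda>j. Num (snd j))) (\<lambda>j. Num (snd (fst j)))" for J
      by (rule polytime_lift[OF polytime_top[of UNIV]]) simp
    show "polytime ?J (ext (loop_env e) (\<lambda>j. Num (snd j)))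
        (\<lambda>j. Num (if P (fst (fst j)) (snd (fst j)) then snd (fst j) else snd j))"
      by (rule polytime_num_If[OF P'[OF subset_refl] x polytime_top])
    show "polybound I e (\<lambda>i. 1 + N i)" by (intro polybound_intros polytime_size[OF N])
    fix i us vs assume "[0..<N i] = us @ vs"
    then have "set us \<subseteq> set [0..<N i]" by (metis set_append sup.cobounded1)
    from le[OF this] show "bitsize (Num (fold (\<lambda>y z. if P i y then y else z) us (N i))) \<le> 1 + N i"
      using floorlog_le_self order_trans by (simp add: order_trans[OF floorlog_le_self])
  qed (auto intro: polytime_size[OF N])
  then show ?thesis by (simp add: implication_network.pick_def)
qed

subsection \<open>The augmentation algorithm\<close>

definition net_polytime ::
    "'i set \<Rightarrow> ('i \<Rightarrow> data) \<Rightarrow> ('i \<Rightarrow> nat) \<Rightarrow> ('i \<Rightarrow> nat \<Rightarrow> nat \<Rightarrow> bool) \<Rightarrow> ('i \<Rightarrow> nat \<Rightarrow> nat) \<Rightarrow> ('i \<Rightarrow> nat \<Rightarrow> nat) \<Rightarrow> bool"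
  where "net_polytime I e N E a b \<longleftrightarrow>
    polytime I e (\<lambda>i. enc_map Num [0..<N i]) \<and>
    polytime I e (\<lambda>i. enc_mat (N i) (\<lambda>x y. of_bool (E i x y))) \<and>
    polytime I e (\<lambda>i. enc_vec (N i) (a i)) \<and> polytime I e (\<lambda>i. enc_vec (N i) (b i))"

lemma net_polytimeD:
  assumes "net_polytime I e N E a b"
  shows "polytime I e (\<lambda>i. enc_map Num [0..<N i])"
    "polytime I e (\<lambda>i. enc_mat (N i) (\<lambda>x y. of_bool (E i x y)))"
    "polytime I e (\<lambda>i. enc_vec (N i) (a i))" "polytime I e (\<lambda>i. enc_vec (N i) (b i))"
  using assms by (auto simp: net_polytime_def)

lemma net_polytime_lift:
  assumes "net_polytime I e N E a b" "\<And>j. j \<in> J \<Longrightarrow> fst j \<in> I"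
  shows "net_polytime J (ext e \<phi>) (\<lambda>j. N (fst j)) (\<lambda>j. E (fst j)) (\<lambda>j. a (fst j)) (\<lambda>j. b (fst j))"
  using net_polytimeD[OF assms(1), THEN polytime_lift[where J = J and \<phi> = \<phi>]] assms(2)
  by (simp add: net_polytime_def)

lemma net_polytime_loop_lift:
  "net_polytime I e N E a b \<Longrightarrow> net_polytime (loop_dom I M) (loop_env e)
    (\<lambda>j. N (fst j)) (\<lambda>j. E (fst j)) (\<lambda>j. a (fst j)) (\<lambda>j. b (fst j))"
  by (erule net_polytime_lift) auto

lemma net_polytime_subset: "net_polytime I e N E a b \<Longrightarrow> J \<subseteq> I \<Longrightarrow> net_polytime J e N E a b"
  unfolding net_polytime_def by (blast intro: polytime_subset)

context
  fixes I :: "'i set" and e :: "'i \<Rightarrow> data" and N E a b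
    and \<Delta> :: "'i \<Rightarrow> nat" and G :: "'i \<Rightarrow> nat \<Rightarrow> nat \<Rightarrow> nat"
  assumes net: "net_polytime I e N E a b"
    and \<Delta>: "polytime I e (\<lambda>i. Num (\<Delta> i))"
    and G: "polytime I e (\<lambda>i. enc_mat (N i) (G i))"
begin

lemma polytime_credit_debit:
  assumes x: "polytime I e (\<lambda>i. Num (x i))" "\<And>i. i \<in> I \<Longrightarrow> x i < N i"
  shows "polytime I e (\<lambda>i. Num (implication_network.credit (N i) (a i) (G i) (x i)))"
    "polytime I e (\<lambda>i. Num (implication_network.debit (N i) (b i) (G i) (x i)))"
proof -
  note lift = polytime_loop_lift[where N = N]
  have "polytime I e (\<lambda>i. Num (\<Sum>y<N i. G i (x i) y))"
  proof (rule polytime_sum[OF net_polytimeD(1)[OF net]])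
    show "polytime (loop_dom I N) (loop_env e) (\<lambda>j. Num (G (fst j) (x (fst j)) (snd j)))"
      by (rule polytime_mat_nth[OF lift[OF G] lift[OF x(1)] polytime_top]) (use x(2) in auto)
  qed
  moreover have "polytime I e (\<lambda>i. Num (\<Sum>y<N i. G i y (x i)))"
  proof (rule polytime_sum[OF net_polytimeD(1)[OF net]])
    show "polytime (loop_dom I N) (loop_env e) (\<lambda>j. Num (G (fst j) (snd j) (x (fst j))))"
      by (rule polytime_mat_nth[OF lift[OF G] polytime_top lift[OF x(1)]]) (use x(2) in auto)
  qed
  ultimately show "polytime I e (\<lambda>i. Num (implication_network.credit (N i) (a i) (G i) (x i)))"
    "polytime I e (\<lambda>i. Num (implication_network.debit (N i) (b i) (G i) (x i)))"
    unfolding implication_network.credit_def implication_network.debit_def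
    by (auto intro!: polytime_add polytime_vec_nth[OF net_polytimeD(3)[OF net] x]
        polytime_vec_nth[OF net_polytimeD(4)[OF net] x])
qed

lemma polytime_deficient_excessive:
  assumes x: "polytime I e (\<lambda>i. Num (x i))" "\<And>i. i \<in> I \<Longrightarrow> x i < N i"
  shows "polytime_pred I e (\<lambda>i. implication_network.deficient (N i) (a i) (b i) (\<Delta> i) (G i) (x i))"
    "polytime_pred I e (\<lambda>i. implication_network.excessive (N i) (a i) (b i) (\<Delta> i) (G i) (x i))"
  unfolding implication_network.deficient_def implication_network.excessive_def
  by (intro polytime_le polytime_add \<Delta> polytime_credit_debit x; assumption)+

lemma polytime_residual:
  assumes x: "polytime I e (\<lambda>i. Num (x i))" "\<And>i. i \<in> I \<Longrightarrow> x i < N i"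
    and y: "polytime I e (\<lambda>i. Num (y i))" "\<And>i. i \<in> I \<Longrightarrow> y i < N i"
  shows "polytime_pred I e (\<lambda>i. implication_network.residual (E i) (\<Delta> i) (G i) (x i) (y i))"
  unfolding implication_network.residual_def
  by (intro polytime_disj polytime_le \<Delta> polytime_mat_nth[OF G y(1) x(1)]
      polytime_mat_nth[OF net_polytimeD(2)[OF net] x(1) y(1)] x y; assumption)

end

lemma polytime_num_If_total:
  "polytime_pred I e P \<Longrightarrow> polytime I e (\<lambda>i. Num (f i)) \<Longrightarrow> polytime I e (\<lambda>i. Num (g i)) \<Longrightarrow>
    polytime I e (\<lambda>i. Num (if P i then f i else g i))"
  by (rule polytime_num_If) (auto elim: polytime_subset)

lemma bitsize_num_le: "bitsize (Num n) \<le> Suc n"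
  using floorlog_le_self[of n] by simp

lemma bitsize_sum_list: "bitsize (Num (sum_list us)) \<le> bitsize (enc_map Num us)"
proof (induction us)
  case (Cons u us)
  then show ?case using bitsize_add[of u "sum_list us"] by simp
qed simp

text \<open>A list of length \<open>n\<close> is available for looping, so two copies per element
  produce \<open>2 * n\<close>.\<close>

lemma concat_pairs: "concat (map (\<lambda>_. [d, d]) [0..<n]) = replicate (2 * n) d"
proof (induction n)
  case (Suc n)
  have "replicate (2 * n) d @ replicate 2 d = replicate (2 * Suc n) d" by (simp flip: replicate_add)
  with Suc show ?case by (simp add: numeral_2_eq_2)
qed simp

lemma polytime_label_round:
  assumes net: "net_polytime I e N E a b" and \<Delta>: "polytime I e (\<lambda>i. Num (\<Delta> i))"
    and G: "polytime I e (\<lambda>i. enc_mat (N i) (G i))" and t: "polytime I e (\<lambda>i. Num (t i))"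
    and l: "polytime I e (\<lambda>i. enc_vec (N i) (l i))"
  shows "polytime I e (\<lambda>i. enc_vec (N i) (implication_network.label_round (N i) (E i) (\<Delta> i) (G i) (t i) (l i)))"
proof (rule polytime_map[OF net_polytimeD(1)[OF net]])
  let ?J = "loop_dom I N" and ?e = "loop_env e"
  let ?J2 = "loop_dom ?J (\<lambda>j. N (fst j))" and ?e2 = "loop_env (loop_env e)"
  note lift = polytime_loop_lift[where N = N]
  note lift2 = polytime_loop_lift[where N = "\<lambda>j. N (fst j)"]
  have N: "polytime ?J ?e (\<lambda>j. enc_map Num [0..<N (fst j)])" by (rule lift[OF net_polytimeD(1)[OF net]])
  have x: "polytime ?J ?e (\<lambda>j. Num (snd j))" by (rule polytime_top)
  have lx: "polytime ?J ?e (\<lambda>j. Num (l (fst j) (snd j)))"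
    by (rule polytime_vec_nth[OF lift[OF l] x]) auto
  have y: "polytime ?J2 ?e2 (\<lambda>j. Num (snd j))" by (rule polytime_top)
  have ly: "polytime ?J2 ?e2 (\<lambda>j. Num (l (fst (fst j)) (snd j)))"
    by (rule polytime_vec_nth[OF lift2[OF lift[OF l]] y]) auto
  have res: "polytime_pred ?J2 ?e2 (\<lambda>j. implication_network.residual (E (fst (fst j))) (\<Delta> (fst (fst j)))
      (G (fst (fst j))) (snd (fst j)) (snd j))"
    by (rule polytime_residual[OF net_polytime_loop_lift[OF net_polytime_loop_lift[OF net]]
          lift2[OF lift[OF \<Delta>]] lift2[OF lift[OF G]] lift2[OF x] _ y]) auto
  have pick: "polytime ?J ?e (\<lambda>j. Num (implication_network.pick (N (fst j)) (\<lambda>y.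
      implication_network.residual (E (fst j)) (\<Delta> (fst j)) (G (fst j)) (snd j) y \<and> 0 < l (fst j) y)))"
    by (rule polytime_pick[OF N], rule polytime_conj[OF res polytime_less[OF polytime_const ly]])
  show "polytime ?J ?e (\<lambda>j. Num (implication_network.label_round (N (fst j)) (E (fst j)) (\<Delta> (fst j))
      (G (fst j)) (t (fst j)) (l (fst j)) (snd j)))"
    unfolding implication_network.label_round_def
    by (intro polytime_num_If_total polytime_conj polytime_eq polytime_less polytime_const lx pick
        polytime_size(1)[OF N] polytime_add[OF lift[OF t] polytime_const[of _ _ "Num 1"], unfolded Suc_eq_plus1[symmetric]])
qed

lemma polytime_labels:
  assumes net: "net_polytime I e N E a b" and \<Delta>: "polytime I e (\<lambda>i. Num (\<Delta> i))"
    and G: "polytime I e (\<lambda>i. enc_mat (N i) (G i))"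
  shows "polytime I e (\<lambda>i. enc_vec (N i) (implication_network.labels (N i) (E i) (a i) (b i) (\<Delta> i) (G i)))"
proof -
  note N = net_polytimeD(1)[OF net]
  let ?init = "\<lambda>i. implication_network.init_labels (N i) (a i) (b i) (\<Delta> i) (G i)"
  let ?F = "\<lambda>i t l. implication_network.label_round (N i) (E i) (\<Delta> i) (G i) t l"
  note lift = polytime_loop_lift[where N = N]
  have init: "polytime I e (\<lambda>i. enc_vec (N i) (?init i))"
  proof (rule polytime_map[OF N])
    have exc: "polytime_pred (loop_dom I N) (loop_env e) (\<lambda>j. implication_network.excessive (N (fst j))
        (a (fst j)) (b (fst j)) (\<Delta> (fst j)) (G (fst j)) (snd j))"
      by (rule polytime_deficient_excessive(2)[OF net_polytime_loop_lift[OF net] lift[OF \<Delta>] lift[OF G]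
            polytime_top]) auto
    show "polytime (loop_dom I N) (loop_env e) (\<lambda>j. Num (?init (fst j) (snd j)))"
      unfolding implication_network.init_labels_def
      by (intro polytime_num_If_total exc polytime_const
          polytime_add[OF lift[OF polytime_size(1)[OF N]] polytime_const[of _ _ "Num 1"], unfolded Suc_eq_plus1[symmetric]])
  qed
  have "polytime I e (\<lambda>i. (\<lambda>i. enc_vec (N i)) i (fold (?F i) (rev [0..<N i]) (?init i)))"
  proof (rule polytime_fold[where A = "\<lambda>_ _. True" and B = "\<lambda>i. 1 + N i * (1 + (2 + N i))"
        and \<psi> = "\<lambda>i. enc_vec (N i)" and F = ?F and ?a0.0 = ?init, OF polytime_rev[OF N]])
    let ?J = "{((i, x), a :: nat \<Rightarrow> nat). i \<in> I \<and> x \<in> set (rev [0..<N i]) \<and> True}"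
    let ?e = "ext (loop_env e) (\<lambda>j. enc_vec (N (fst (fst j))) (snd j))"
    have J: "j \<in> ?J \<Longrightarrow> fst j \<in> loop_dom I N" for j by auto
    note lift' = polytime_lift[where J = ?J, OF _ J]
    show "polytime ?J ?e (\<lambda>j. enc_vec (N (fst (fst j))) (?F (fst (fst j)) (snd (fst j)) (snd j)))"
      by (rule polytime_label_round[OF net_polytime_lift[OF net_polytime_loop_lift[OF net] J]
            lift'[OF lift[OF \<Delta>]] lift'[OF lift[OF G]] lift'[OF polytime_top] polytime_top])
    show "polybound I e (\<lambda>i. 1 + N i * (1 + (2 + N i)))"
      by (intro polybound_intros polytime_size[OF N])
    fix i us vs assume us: "rev [0..<N i] = us @ vs"
    have "set us \<subseteq> set (rev [0..<N i])" unfolding us by simp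
    then have le: "fold (?F i) us (?init i) x \<le> Suc (N i)" for x
      by (induction us arbitrary: x rule: rev_induct)
        (auto simp: implication_network.init_labels_def implication_network.label_round_def)
    have "bitsize (Num (fold (?F i) us (?init i) x)) \<le> 2 + N i" for x
      using bitsize_num_le[of "fold (?F i) us (?init i) x"] le[of x] by linarith
    then show "bitsize (enc_vec (N i) (fold (?F i) us (?init i))) \<le> 1 + N i * (1 + (2 + N i))"
      by (rule bitsize_vec_le)
  qed (use init in auto)
  then show ?thesis by (simp add: implication_network.labels_def)
qed

lemma polytime_push:
  assumes net: "net_polytime I e N E a b" and \<Delta>: "polytime I e (\<lambda>i. Num (\<Delta> i))"
    and G: "polytime I e (\<lambda>i. enc_mat (N i) (G i))"
    and x: "polytime I e (\<lambda>i. Num (x i))" "\<And>i. i \<in> I \<Longrightarrow> x i < N i"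
    and y: "polytime I e (\<lambda>i. Num (y i))" "\<And>i. i \<in> I \<Longrightarrow> y i < N i"
  shows "polytime I e (\<lambda>i. enc_mat (N i) (implication_network.push (E i) (\<Delta> i) (x i) (y i) (G i)))"
proof (rule polytime_mat[OF net_polytimeD(1)[OF net]])
  let ?J = "loop_dom I N" and ?e = "loop_env e"
  let ?J2 = "loop_dom ?J (\<lambda>j. N (fst j))" and ?e2 = "loop_env (loop_env e)"
  have lift: "polytime ?J2 ?e2 (\<lambda>j. f (fst (fst j)))" if "polytime I e f" for f
    by (rule polytime_loop_lift[OF polytime_loop_lift[OF that]])
  have p: "polytime ?J2 ?e2 (\<lambda>j. Num (snd (fst j)))" by (rule polytime_loop_lift[OF polytime_top])
  have q: "polytime ?J2 ?e2 (\<lambda>j. Num (snd j))" by (rule polytime_top)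
  have Gpq: "polytime ?J2 ?e2 (\<lambda>j. Num (G (fst (fst j)) (snd (fst j)) (snd j)))"
    by (rule polytime_mat_nth[OF lift[OF G] p q]) auto
  have Exy: "polytime_pred ?J2 ?e2 (\<lambda>j. E (fst (fst j)) (x (fst (fst j))) (y (fst (fst j))))"
    by (rule polytime_mat_nth[OF lift[OF net_polytimeD(2)[OF net]] lift[OF x(1)] lift[OF y(1)]])
      (use x(2) y(2) in auto)
  show "polytime ?J2 ?e2 (\<lambda>j. Num (implication_network.push (E (fst (fst j))) (\<Delta> (fst (fst j)))
      (x (fst (fst j))) (y (fst (fst j))) (G (fst (fst j))) (snd (fst j)) (snd j)))"
    unfolding implication_network.push_def
    by (intro polytime_num_If_total polytime_conj polytime_not polytime_eq polytime_add polytime_diff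
        Exy Gpq p q lift[OF x(1)] lift[OF y(1)] lift[OF \<Delta>])
qed

lemma polytime_walk_step:
  assumes net: "net_polytime I e N E a b" and \<Delta>: "polytime I e (\<lambda>i. Num (\<Delta> i))"
    and G: "polytime I e (\<lambda>i. enc_mat (N i) (G i))" and l: "polytime I e (\<lambda>i. enc_vec (N i) (l i))"
    and x: "polytime I e (\<lambda>i. Num (x i))" "\<And>i. i \<in> I \<Longrightarrow> x i < N i"
  defines "s \<equiv> \<lambda>i. implication_network.walk_step (N i) (E i) (\<Delta> i) (l i) (x i, G i)"
  shows "polytime I e (\<lambda>i. Node (Num (fst (s i))) (enc_mat (N i) (snd (s i))))"
proof -
  note N = net_polytimeD(1)[OF net]
  let ?J = "loop_dom I N" and ?e = "loop_env e"
  note lift = polytime_loop_lift[where N = N]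
  define y where "y i = implication_network.walk_next (N i) (E i) (\<Delta> i) (l i) (x i, G i)" for i
  have lx: "polytime I e (\<lambda>i. Num (l i (x i)))" by (rule polytime_vec_nth[OF l x])
  have y: "polytime I e (\<lambda>i. Num (y i))"
    unfolding y_def implication_network.walk_next_def fst_conv snd_conv
  proof (rule polytime_pick[OF N], rule polytime_conj)
    show "polytime_pred ?J ?e (\<lambda>j. implication_network.residual (E (fst j)) (\<Delta> (fst j)) (G (fst j)) (x (fst j)) (snd j))"
      by (rule polytime_residual[OF net_polytime_loop_lift[OF net] lift[OF \<Delta>] lift[OF G] lift[OF x(1)] _
            polytime_top]) (use x(2) in auto)
    show "polytime_pred ?J ?e (\<lambda>j. l (fst j) (x (fst j)) < l (fst j) (snd j))"
      by (rule polytime_less[OF lift[OF lx] polytime_vec_nth[OF lift[OF l] polytime_top]]) auto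
  qed
  define P where "P i \<longleftrightarrow> l i (x i) \<le> N i \<and> y i < N i" for i
  have P: "polytime_pred I e P"
    unfolding P_def by (intro polytime_conj polytime_le polytime_less lx y polytime_size[OF N])
  let ?K = "{i\<in>I. P i}"
  have sub: "polytime ?K e f" if "polytime I e f" for f by (rule polytime_subset[OF that]) auto
  have "polytime ?K e (\<lambda>i. Node (Num (y i)) (enc_mat (N i) (implication_network.push (E i) (\<Delta> i) (x i) (y i) (G i))))"
  proof (rule polytime_Node[OF sub[OF y] polytime_push[OF net_polytime_subset[OF net] sub[OF \<Delta>] sub[OF G] sub[OF x(1)] _ sub[OF y]]])
  qed (use x(2) in \<open>auto simp: P_def\<close>)
  moreover have "polytime {i\<in>I. \<not> P i} e (\<lambda>i. Node (Num (x i)) (enc_mat (N i) (G i)))"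
    by (rule polytime_subset[OF polytime_Node[OF x(1) G]]) auto
  ultimately show ?thesis
    by (rule polytime_cong[OF polytime_If[OF P]])
      (simp add: s_def implication_network.walk_step_def P_def y_def)
qed

lemma polytime_augment:
  assumes net: "net_polytime I e N E a b" and \<Delta>: "polytime I e (\<lambda>i. Num (\<Delta> i))"
    and G: "polytime I e (\<lambda>i. enc_mat (N i) (G i))" and l: "polytime I e (\<lambda>i. enc_vec (N i) (l i))"
    and x: "polytime I e (\<lambda>i. Num (x i))" "\<And>i. i \<in> I \<Longrightarrow> x i < N i"
  shows "polytime I e (\<lambda>i. enc_mat (N i) (implication_network.augment (N i) (E i) (\<Delta> i) (l i) (x i) (G i)))"
proof -
  note N = net_polytimeD(1)[OF net]
  let ?\<psi> = "\<lambda>i s. Node (Num (fst s)) (enc_mat (N i) (snd s))"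
  let ?F = "\<lambda>i (_ :: nat). implication_network.walk_step (N i) (E i) (\<Delta> i) (l i)"
  \<comment> \<open>Bounds the bit size of a flow entry during the walk: to an entry of
    \<open>G i\<close>, at most \<open>N i\<close> pushes add at most
    \<open>N i * \<Delta> i\<close> in total.\<close>
  let ?g = "\<lambda>i. bitsize (enc_mat (N i) (G i)) + (bitsize (Num (N i)) + bitsize (Num (\<Delta> i)))"
  let ?B = "\<lambda>i. 2 + N i + (1 + N i * (1 + (1 + N i * (1 + ?g i))))"
  have "polytime I e (\<lambda>i. ?\<psi> i (fold (?F i) [0..<N i] (x i, G i)))"
  proof (rule polytime_fold[where A = "\<lambda>i s. fst s < N i" and B = ?B and \<psi> = ?\<psi> and F = ?F
        and ?a0.0 = "\<lambda>i. (x i, G i)", OF N])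
    let ?J = "{((i, x), a :: nat \<times> (nat \<Rightarrow> nat \<Rightarrow> nat)). i \<in> I \<and> x \<in> set [0..<N i] \<and> fst a < N i}"
    let ?e = "ext (loop_env e) (\<lambda>j. ?\<psi> (fst (fst j)) (snd j))"
    have J: "j \<in> ?J \<Longrightarrow> fst j \<in> loop_dom I N" for j by auto
    have lift: "polytime ?J ?e (\<lambda>j. f (fst (fst j)))" if "polytime I e f" for f
      by (rule polytime_lift[OF polytime_loop_lift[OF that] J])
    have v: "polytime ?J ?e (\<lambda>j. Num (fst (snd j)))"
      and F: "polytime ?J ?e (\<lambda>j. enc_mat (N (fst (fst j))) (snd (snd j)))"
      using polytime_left[OF polytime_top[of ?J "loop_env e" "\<lambda>j. ?\<psi> (fst (fst j)) (snd j)"]]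
        polytime_right[OF polytime_top[of ?J "loop_env e" "\<lambda>j. ?\<psi> (fst (fst j)) (snd j)"]] by simp_all
    show "polytime ?J ?e (\<lambda>j. ?\<psi> (fst (fst j)) (?F (fst (fst j)) (snd (fst j)) (snd j)))"
      using polytime_walk_step[OF net_polytime_lift[OF net_polytime_loop_lift[OF net] J] lift[OF \<Delta>] F lift[OF l] v]
      by (simp add: case_prod_beta)
    show "polybound I e ?B"
      by (intro polybound_intros polytime_bitsize[OF G] polytime_bitsize[OF \<Delta>]
          polytime_bitsize[OF polytime_size(1)[OF N]] polytime_size[OF N])
    show "fst (?F i y s) < N i" if "fst s < N i" for i y s
      using that by (simp add: implication_network.walk_step_def)
    fix i us vs assume i: "i \<in> I" and us: "[0..<N i] = us @ vs"
    define r where "r = fold (?F i) us (x i, G i)"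
    have len: "length us \<le> N i" using arg_cong[OF us, of length] by simp
    have "fst r < N i \<and> (\<forall>p q. snd r p q \<le> G i p q + length us * \<Delta> i)"
      unfolding r_def
    proof (induction us rule: rev_induct)
      case Nil
      then show ?case using x(2)[OF i] by simp
    next
      case (snoc u us)
      define r where "r = fold (?F i) us (x i, G i)"
      have r: "fst r < N i" "snd r p q \<le> G i p q + length us * \<Delta> i" for p q
        using snoc unfolding r_def by blast+
      have "snd (?F i u r) p q \<le> snd r p q + \<Delta> i" for p q
        by (auto simp: implication_network.walk_step_def implication_network.push_def intro: order_trans[OF diff_le_self])
      from order_trans[OF this add_right_mono[OF r(2)]]
      have "snd (?F i u r) p q \<le> G i p q + length (us @ [u]) * \<Delta> i" for p q by (simp add: add_ac)
      moreover have "fst (?F i u r) < N i" using r(1) by (simp add: implication_network.walk_step_def)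
      moreover have "fold (?F i) (us @ [u]) (x i, G i) = ?F i u r" by (simp add: r_def)
      ultimately show ?case by simp
    qed
    then have r: "fst r < N i" "snd r p q \<le> G i p q + N i * \<Delta> i" for p q
      using len by (auto intro: order_trans[OF _ add_left_mono[OF mult_right_mono]])
    have "bitsize (Num (snd r p q)) \<le> ?g i" if "p < N i" "q < N i" for p q
    proof -
      have "bitsize (Num (snd r p q)) \<le> bitsize (Num (G i p q + N i * \<Delta> i))" by (rule bitsize_mono[OF r(2)])
      also have "\<dots> \<le> bitsize (Num (G i p q)) + (bitsize (Num (N i)) + bitsize (Num (\<Delta> i)))"
        using bitsize_add[of "G i p q" "N i * \<Delta> i"] bitsize_mult[of "N i" "\<Delta> i"] by linarith
      also have "\<dots> \<le> ?g i" by (rule add_right_mono[OF bitsize_mat_entry[OF that]])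
      finally show ?thesis .
    qed
    then have "bitsize (enc_mat (N i) (snd r)) \<le> 1 + N i * (1 + (1 + N i * (1 + ?g i)))"
      by (rule bitsize_mat_le)
    moreover have "bitsize (Num (fst r)) \<le> 1 + N i" using bitsize_num_le[of "fst r"] r(1) by simp
    ultimately show "bitsize (?\<psi> i (fold (?F i) us (x i, G i))) \<le> ?B i" unfolding r_def[symmetric] by simp
  qed (use x G polytime_Node[OF x(1) G] in auto)
  from polytime_right[OF this] show ?thesis by (simp add: implication_network.augment_def)
qed

lemma polytime_step:
  assumes net: "net_polytime I e N E a b" and \<Delta>: "polytime I e (\<lambda>i. Num (\<Delta> i))"
    and G: "polytime I e (\<lambda>i. enc_mat (N i) (G i))"
  shows "polytime I e (\<lambda>i. enc_mat (N i) (implication_network.step (N i) (E i) (a i) (b i) (\<Delta> i) (G i)))"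
proof -
  note N = net_polytimeD(1)[OF net]
  note lift = polytime_loop_lift[where N = N]
  define l where "l i = implication_network.labels (N i) (E i) (a i) (b i) (\<Delta> i) (G i)" for i
  have l: "polytime I e (\<lambda>i. enc_vec (N i) (l i))" unfolding l_def by (rule polytime_labels[OF assms])
  define x where "x i = implication_network.start (N i) (a i) (b i) (\<Delta> i) (G i) (l i)" for i
  have x: "polytime I e (\<lambda>i. Num (x i))"
    unfolding x_def implication_network.start_def
  proof (rule polytime_pick[OF N], rule polytime_conj)
    show "polytime_pred (loop_dom I N) (loop_env e) (\<lambda>j. implication_network.deficient (N (fst j))
        (a (fst j)) (b (fst j)) (\<Delta> (fst j)) (G (fst j)) (snd j))"
      by (rule polytime_deficient_excessive(1)[OF net_polytime_loop_lift[OF net] lift[OF \<Delta>] lift[OF G]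
            polytime_top]) auto
    show "polytime_pred (loop_dom I N) (loop_env e) (\<lambda>j. 0 < l (fst j) (snd j))"
      by (rule polytime_less[OF polytime_const polytime_vec_nth[OF lift[OF l] polytime_top]]) auto
  qed
  have P: "polytime_pred I e (\<lambda>i. x i < N i)"
    by (intro polytime_less x polytime_size[OF N])
  let ?K = "{i\<in>I. x i < N i}"
  have sub: "polytime ?K e f" if "polytime I e f" for f by (rule polytime_subset[OF that]) auto
  have "polytime ?K e (\<lambda>i. enc_mat (N i) (implication_network.augment (N i) (E i) (\<Delta> i) (l i) (x i) (G i)))"
    by (rule polytime_augment[OF net_polytime_subset[OF net] sub[OF \<Delta>] sub[OF G] sub[OF l] sub[OF x]]) auto
  moreover have "polytime {i\<in>I. \<not> x i < N i} e (\<lambda>i. enc_mat (N i) (G i))"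
    by (rule polytime_subset[OF G]) auto
  ultimately show ?thesis
    by (rule polytime_cong[OF polytime_If[OF P]]) (simp add: implication_network.step_def x_def l_def)
qed

lemma polytime_phases:
  assumes N: "polytime I e (\<lambda>i. enc_map Num [0..<N i])" and M: "polytime I e (\<lambda>i. Num (M i))"
  shows "polytime I e (\<lambda>i. enc_map Num (implication_network.phases (N i) (floorlog 2 (M i))))"
  unfolding implication_network.phases_def
proof (rule polytime_concat)
  let ?P = "\<lambda>i. map (\<lambda>j. 2 ^ j :: nat) (rev [0..<Suc (floorlog 2 (M i))])"
  show "polytime I e (\<lambda>i. enc_map Num (?P i))"
    using polytime_powers[OF M] by (simp add: o_def)
  let ?J = "{(i, x). i \<in> I \<and> x \<in> set (?P i)}"
  have J: "j \<in> ?J \<Longrightarrow> fst j \<in> I" for j by auto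
  let ?J2 = "{(j, y). j \<in> ?J \<and> y \<in> set [0..<N (fst j)]}"
  have J2: "j \<in> ?J2 \<Longrightarrow> fst j \<in> ?J" for j by auto
  have \<Delta>: "polytime ?J2 (loop_env (ext e (\<lambda>j. Num (snd j)))) (\<lambda>j. Num (snd (fst j)))"
    by (rule polytime_lift[OF polytime_top J2])
  have "polytime ?J2 (loop_env (ext e (\<lambda>j. Num (snd j))))
      (\<lambda>j. Node (Num (snd (fst j))) (Node (Num (snd (fst j))) (Num 0)))"
    by (rule polytime_Node[OF \<Delta> polytime_Node[OF \<Delta> polytime_const]])
  then have pair: "polytime ?J2 (loop_env (ext e (\<lambda>j. Num (snd j))))
      (\<lambda>j. enc_map Num [snd (fst j), snd (fst j)])"
    by (simp only: list.map enc_list_simps)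
  have "polytime ?J (ext e (\<lambda>j. Num (snd j)))
      (\<lambda>j. enc_map Num (concat (map ((\<lambda>j _. [snd j, snd j]) j) [0..<N (fst j)])))"
    by (rule polytime_concat[OF polytime_lift[OF N J]], assumption, rule pair)
  then show "polytime ?J (ext e (\<lambda>j. Num (snd j))) (\<lambda>j. enc_map Num (replicate (2 * N (fst j)) (snd j)))"
    by (simp only: concat_pairs)
qed

text \<open>The length of the schedule is proportional to \<open>N i\<close> times the bit length of
  \<open>M i\<close>. Flow entries stay at most \<open>N i\<close> times the sum of the increments
  used, and the bit size of that sum is at most the size of the encoded schedule.\<close>

lemma polytime_final_labels:
  assumes net: "net_polytime I e N E a b" and M: "polytime I e (\<lambda>i. Num (M i))"
  shows "polytime I e (\<lambda>i. enc_vec (N i)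
    (implication_network.final_labels (N i) (E i) (a i) (b i) (floorlog 2 (M i))))"
proof -
  note N = net_polytimeD(1)[OF net]
  let ?xs = "\<lambda>i. implication_network.phases (N i) (floorlog 2 (M i))"
  let ?F = "\<lambda>i. implication_network.step (N i) (E i) (a i) (b i)"
  have xs: "polytime I e (\<lambda>i. enc_map Num (?xs i))" by (rule polytime_phases[OF N M])
  let ?g = "\<lambda>i. bitsize (Num (N i)) + bitsize (enc_map Num (?xs i))"
  let ?B = "\<lambda>i. 1 + N i * (1 + (1 + N i * (1 + ?g i)))"
  have "polytime I e (\<lambda>i. enc_mat (N i) (fold (?F i) (?xs i) (\<lambda>_ _. 0)))"
  proof (rule polytime_fold[where A = "\<lambda>_ _. True" and B = ?B and \<psi> = "\<lambda>i. enc_mat (N i)" and F = ?F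
        and ?a0.0 = "\<lambda>i _ _. 0", OF xs])
    show "polytime I e (\<lambda>i. enc_mat (N i) (\<lambda>_ _. 0))"
      by (rule polytime_mat[OF N polytime_const])
    let ?J = "{((i, x), a :: nat \<Rightarrow> nat \<Rightarrow> nat). i \<in> I \<and> x \<in> set (?xs i) \<and> True}"
    let ?e = "ext (ext e (\<lambda>j. Num (snd j))) (\<lambda>j. enc_mat (N (fst (fst j))) (snd j))"
    have J: "j \<in> ?J \<Longrightarrow> fst j \<in> {(i, x). i \<in> I}" for j by auto
    show "polytime ?J ?e (\<lambda>j. enc_mat (N (fst (fst j))) (?F (fst (fst j)) (snd (fst j)) (snd j)))"
      by (rule polytime_step[OF net_polytime_lift[OF net_polytime_lift[OF net] J]
            polytime_lift[OF polytime_top J] polytime_top]) auto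
    show "polybound I e ?B"
      by (intro polybound_intros polytime_bitsize[OF xs] polytime_bitsize[OF polytime_size(1)[OF N]]
          polytime_size[OF N])
    fix i us vs assume us: "?xs i = us @ vs"
    have "bitsize (Num (fold (?F i) us (\<lambda>_ _. 0) p q)) \<le> ?g i" for p q
    proof -
      have "bitsize (Num (fold (?F i) us (\<lambda>_ _. 0) p q)) \<le> bitsize (Num (N i * sum_list us))"
        using implication_network.fold_step_le[of "N i" "E i" "a i" "b i" us "\<lambda>_ _. 0" p q]
        by (intro bitsize_mono) simp
      also have "\<dots> \<le> bitsize (Num (N i)) + bitsize (Num (sum_list us))" by (rule bitsize_mult)
      also have "\<dots> \<le> bitsize (Num (N i)) + bitsize (Num (sum_list (?xs i)))"
        by (intro add_left_mono bitsize_mono) (simp add: us)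
      also have "\<dots> \<le> ?g i" by (intro add_left_mono bitsize_sum_list)
      finally show ?thesis .
    qed
    then show "bitsize (enc_mat (N i) (fold (?F i) us (\<lambda>_ _. 0))) \<le> ?B i" by (rule bitsize_mat_le)
  qed auto
  from polytime_labels[OF net polytime_const[of _ _ "Num 1"] this]
  show ?thesis by (simp add: implication_network.final_labels_def)
qed

section \<open>Homomorphisms as closed sets\<close>

text \<open>A map \<open>g\<close> from \<open>{..<n}\<close> to \<open>{..<k}\<close> corresponds to the set of all \<open>u * k + i\<close> with \<open>i \<le> g u\<close>.
  Arcs of the input digraph \<open>A\<close> then become implications, and costs \<open>C\<close> become weights by
  telescoping.\<close>

definition implies :: "nat \<Rightarrow> (nat \<Rightarrow> nat \<Rightarrow> bool) \<Rightarrow> nat \<Rightarrow> nat \<Rightarrow> bool" where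
  "implies k R i j \<longleftrightarrow> (\<forall>p<k. \<forall>q<k. R p q \<longrightarrow> i \<le> p \<longrightarrow> j \<le> q)"

text \<open>The first disjunct makes every block downward closed. The others use an arc in both
  directions: a lower bound on the image of its tail forces one on the image of its head, and
  conversely.\<close>

definition hom_edge :: "nat \<Rightarrow> (nat \<Rightarrow> nat \<Rightarrow> bool) \<Rightarrow> (nat \<Rightarrow> nat \<Rightarrow> bool) \<Rightarrow> nat \<Rightarrow> nat \<Rightarrow> bool" where
  "hom_edge k R A x y \<longleftrightarrow> x div k = y div k \<and> y mod k \<le> x mod k
     \<or> A (x div k) (y div k) \<and> implies k R (x mod k) (y mod k)
     \<or> A (y div k) (x div k) \<and> implies k (\<lambda>p q. R q p) (x mod k) (y mod k)"

text \<open>Gain and loss are the two parts of the cost increment from position \<open>i - 1\<close>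
  to \<open>i\<close>. Position 0 has weight 0, since every map reaches it.\<close>

definition cost_gain :: "nat \<Rightarrow> (nat \<Rightarrow> nat) \<Rightarrow> nat \<Rightarrow> nat" where
  "cost_gain k C x = (if x mod k = 0 then 0 else C x)"

definition cost_loss :: "nat \<Rightarrow> (nat \<Rightarrow> nat) \<Rightarrow> nat \<Rightarrow> nat" where
  "cost_loss k C x = (if x mod k = 0 then 0 else C (x - 1))"

text \<open>Membership in the closed set means label 0, and counting members finds the largest one
  because blocks are downward closed. Position 0 is not counted, so the value is a valid position
  even if the whole block is missing.\<close>

definition decode :: "nat \<Rightarrow> (nat \<Rightarrow> nat) \<Rightarrow> nat \<Rightarrow> nat" where
  "decode k l u = (\<Sum>i<k - 1. of_bool (l (u * k + Suc i) = 0))"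

section \<open>Blocks of nodes and telescoping weights\<close>

lemma sum_lessThan_add: "(\<Sum>x<m + k. f x) = (\<Sum>x<m. f x) + (\<Sum>i<k. f (m + i))"
  for f :: "nat \<Rightarrow> 'b :: comm_monoid_add"
  by (induction k) (auto simp: add.assoc)

lemma sum_lessThan_mult: "(\<Sum>x<n * k. f x) = (\<Sum>u<n. \<Sum>i<k. f (u * k + i))"
  for f :: "nat \<Rightarrow> 'b :: comm_monoid_add"
  by (induction n) (auto simp: sum_lessThan_add add.commute[of k])

lemma downward_closed_eq:
  fixes S :: "nat set"
  assumes fin: "finite S" and down: "\<And>i j. i \<in> S \<Longrightarrow> j \<le> i \<Longrightarrow> j \<in> S"
  shows "S = {..<card S}"
proof (cases "S = {}")
  case False
  have "S = {..Max S}"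
  proof
    show "S \<subseteq> {..Max S}" using fin by auto
    show "{..Max S} \<subseteq> S" using down[OF Max_in[OF fin False]] by auto
  qed
  moreover from this have "card S = Suc (Max S)" by (metis card_atMost)
  ultimately show ?thesis by (metis lessThan_Suc_atMost)
qed simp

lemma code_less: "u < n \<Longrightarrow> i < k \<Longrightarrow> u * k + i < n * k" for u n i k :: nat
proof -
  assume "u < n" "i < k"
  then have "u * k + i < Suc u * k" "Suc u * k \<le> n * k"
    using mult_le_mono1[of "Suc u" n k] by simp_all
  then show ?thesis by linarith
qed

lemma hom_edge_code:
  assumes "i < k" "j < k"
  shows "hom_edge k R A (u * k + i) (v * k + j) \<longleftrightarrow> u = v \<and> j \<le> i
     \<or> A u v \<and> implies k R i j \<or> A v u \<and> implies k (\<lambda>p q. R q p) i j"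
  using assms by (simp add: hom_edge_def)

text \<open>The sum telescopes. The remaining term \<open>C (u * k)\<close> is independent of the
  map, so minimum weight amounts to minimum cost.\<close>

lemma weight_code:
  assumes g: "g < k"
  shows "(\<Sum>i<k. if i \<le> g then implication_network.weight (cost_gain k C) (cost_loss k C) (u * k + i) else 0) =
    int (C (u * k + g)) - int (C (u * k))"
proof -
  let ?w = "\<lambda>i. implication_network.weight (cost_gain k C) (cost_loss k C) (u * k + i)"
  have "(\<Sum>i<k. if i \<le> g then ?w i else 0) = (\<Sum>i\<le>g. ?w i)"
    using g by (simp add: sum.If_cases) (rule sum.cong; auto)
  also have "\<dots> = int (C (u * k + g)) - int (C (u * k))"
    using g
  proof (induction g)
    case 0
    then show ?case by (simp add: implication_network.weight_def cost_gain_def cost_loss_def)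
  next
    case (Suc g)
    have "(u * k + Suc g) mod k = Suc g" using Suc.prems by (simp add: mod_less)
    then have "?w (Suc g) = int (C (u * k + Suc g)) - int (C (u * k + g))"
      by (simp add: implication_network.weight_def cost_gain_def cost_loss_def)
    with Suc show ?case by simp
  qed
  finally show ?thesis .
qed

text \<open>The order enters in the proof that \<open>g\<close> is a homomorphism. If an arc were
  sent to a missing pair, \<open>fwd\<close> and \<open>bwd\<close> would exclude every arc of
  \<open>R\<close> enclosing that pair in the same direction, so the network would contain an
  implication from the larger decoded value to one more than the smaller, contradicting the latter.
  Optimality holds because every homomorphism yields a closed set.\<close>

theorem decode_optimal:
  fixes R A :: "nat \<Rightarrow> nat \<Rightarrow> bool" and C :: "nat \<Rightarrow> nat"
  assumes k: "0 < k" and refl: "\<And>i. i < k \<Longrightarrow> R i i"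
    and fwd: "\<And>i j i' j'. i' \<le> i \<Longrightarrow> i \<le> j \<Longrightarrow> j \<le> j' \<Longrightarrow> j' < k \<Longrightarrow> R i' j' \<Longrightarrow> R i j"
    and bwd: "\<And>i j i' j'. i' \<le> i \<Longrightarrow> i \<le> j \<Longrightarrow> j \<le> j' \<Longrightarrow> j' < k \<Longrightarrow> R j' i' \<Longrightarrow> R j i"
    and L: "\<And>x. x < n * k \<Longrightarrow> cost_loss k C x \<le> 2 ^ L"
  defines "g \<equiv> decode k (implication_network.final_labels (n * k) (hom_edge k R A)
    (cost_gain k C) (cost_loss k C) L)"
  shows "\<And>u. g u < k"
    and "\<And>u v. u < n \<Longrightarrow> v < n \<Longrightarrow> A u v \<Longrightarrow> R (g u) (g v)"
    and "\<And>g'. (\<And>u. u < n \<Longrightarrow> g' u < k) \<Longrightarrow> (\<And>u v. u < n \<Longrightarrow> v < n \<Longrightarrow> A u v \<Longrightarrow> R (g' u) (g' v)) \<Longrightarrow>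
      (\<Sum>u<n. C (u * k + g u)) \<le> (\<Sum>u<n. C (u * k + g' u))"
proof -
  define l where "l = implication_network.final_labels (n * k) (hom_edge k R A)
    (cost_gain k C) (cost_loss k C) L"
  interpret implication_network "n * k" "hom_edge k R A" "cost_gain k C" "cost_loss k C" .
  define X where "X = {x. x < n * k \<and> l x = 0}"
  have X: "closed_set X" unfolding X_def l_def by (rule min_weight_closed(1)) (rule L)
  have opt: "(\<Sum>x\<in>X. weight x) \<le> (\<Sum>x\<in>Y. weight x)" if "closed_set Y" for Y
    unfolding X_def l_def by (rule min_weight_closed(2)[OF _ that]) (rule L)
  have edge: "v * k + j \<in> X" if "u * k + i \<in> X" "hom_edge k R A (u * k + i) (v * k + j)" "v < n" "j < k"
    for u v i j
    using X that code_less[OF that(3,4)] by (auto simp: closed_set_def)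
  have g_card: "g u = card {i. i < k - 1 \<and> l (u * k + Suc i) = 0}" for u
    by (simp add: g_def decode_def sum.If_cases of_bool_def l_def Int_def)
  show g_less: "g u < k" for u
  proof -
    have "g u \<le> card {..<k - 1}" unfolding g_card by (rule card_mono) auto
    with k show ?thesis by simp
  qed
  have X_iff: "u * k + i \<in> X \<longleftrightarrow> i \<le> g u" if "u < n" "0 < i" "i < k" for u i
  proof -
    define S where "S = {i. i < k - 1 \<and> l (u * k + Suc i) = 0}"
    have mem: "j \<in> S \<longleftrightarrow> j < k - 1 \<and> u * k + Suc j \<in> X" for j
    proof (cases "j < k - 1")
      case True
      then have "u * k + Suc j < n * k" using that(1) by (intro code_less) auto
      with True show ?thesis unfolding S_def X_def by blast
    qed (simp add: S_def)
    have "S = {..<card S}"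
    proof (rule downward_closed_eq)
      show "finite S" by (simp add: S_def)
      fix i j assume i: "i \<in> S" and j: "j \<le> i"
      then have "i < k - 1" "u * k + Suc i \<in> X" using mem by blast+
      moreover from this j have "hom_edge k R A (u * k + Suc i) (u * k + Suc j)"
        by (subst hom_edge_code) auto
      moreover have "Suc j < k" using j \<open>i < k - 1\<close> by linarith
      ultimately have "u * k + Suc j \<in> X" using edge[of u "Suc i" u "Suc j"] that(1) by blast
      with \<open>i < k - 1\<close> j show "j \<in> S" unfolding mem by simp
    qed
    moreover have "card S = g u" by (simp only: S_def g_card)
    ultimately have "i - 1 \<in> S \<longleftrightarrow> i - 1 < g u" by (metis lessThan_iff)
    moreover have "i - 1 \<in> S \<longleftrightarrow> u * k + i \<in> X" using that mem[of "i - 1"] by auto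
    ultimately show ?thesis using that(2) by auto
  qed
  show "R (g u) (g v)" if uv: "u < n" "v < n" "A u v" for u v
  proof (rule ccontr)
    assume n: "\<not> R (g u) (g v)"
    with refl g_less have "g u \<noteq> g v" by metis
    then consider "g u < g v" | "g v < g u" by linarith
    then show False
    proof cases
      case 1
      have "implies k (\<lambda>p q. R q p) (g v) (Suc (g u))"
        unfolding implies_def
      proof (intro allI impI, rule ccontr)
        fix p q assume "p < k" "R q p" "g v \<le> p" "\<not> Suc (g u) \<le> q"
        with fwd[of q "g u" "g v" p] 1 n show False by simp
      qed
      moreover have lt: "Suc (g u) < k" using 1 g_less[of v] by linarith
      ultimately have "hom_edge k R A (v * k + g v) (u * k + Suc (g u))"
        using hom_edge_code[OF g_less[of v] lt] uv(3) by blast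
      \<comment> \<open>In this case \<open>0 < g v\<close>, as \<open>X_iff\<close> demands: at
        position 0 membership in \<open>X\<close> is not determined by \<open>g\<close>.\<close>
      moreover have "v * k + g v \<in> X" using X_iff[of v "g v"] uv(2) 1 g_less[of v] by linarith
      ultimately have "u * k + Suc (g u) \<in> X" using edge uv(1) lt by blast
      with X_iff[of u "Suc (g u)"] uv(1) lt show False by linarith
    next
      case 2
      have "implies k R (g u) (Suc (g v))"
        unfolding implies_def
      proof (intro allI impI, rule ccontr)
        fix p q assume "p < k" "R p q" "g u \<le> p" "\<not> Suc (g v) \<le> q"
        with bwd[of q "g v" "g u" p] 2 n show False by simp
      qed
      moreover have lt: "Suc (g v) < k" using 2 g_less[of u] by linarith
      ultimately have "hom_edge k R A (u * k + g u) (v * k + Suc (g v))"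
        using hom_edge_code[OF g_less[of u] lt] uv(3) by blast
      moreover have "u * k + g u \<in> X" using X_iff[of u "g u"] uv(1) 2 g_less[of u] by linarith
      ultimately have "v * k + Suc (g v) \<in> X" using edge uv(2) lt by blast
      with X_iff[of v "Suc (g v)"] uv(2) lt show False by linarith
    qed
  qed
  define Y where "Y h = {x. x < n * k \<and> x mod k \<le> h (x div k)}" for h
  have weight_Y: "(\<Sum>x\<in>Y h. weight x) = (\<Sum>u<n. int (C (u * k + h u)) - int (C (u * k)))"
    if "\<And>u. u < n \<Longrightarrow> h u < k" for h
  proof -
    have "(\<Sum>x\<in>Y h. weight x) = (\<Sum>x<n * k. if x mod k \<le> h (x div k) then weight x else 0)"
      by (simp add: sum.If_cases Y_def Int_def)
    also have "\<dots> = (\<Sum>u<n. \<Sum>i<k. if i \<le> h u then weight (u * k + i) else 0)"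
      unfolding sum_lessThan_mult by (intro sum.cong refl) simp_all
    also have "\<dots> = (\<Sum>u<n. int (C (u * k + h u)) - int (C (u * k)))"
      by (intro sum.cong refl weight_code that) simp_all
    finally show ?thesis .
  qed
  \<comment> \<open>The two sets may differ only at positions 0 of the blocks, where the weight
    vanishes.\<close>
  have "(\<Sum>x\<in>X. weight x) = (\<Sum>x\<in>Y g. weight x)"
  proof (rule sum.mono_neutral_cong)
    have *: "x \<in> X \<longleftrightarrow> x \<in> Y g" if "x < n * k" "x mod k \<noteq> 0" for x
    proof -
      have "x div k < n" using that(1) by (simp add: less_mult_imp_div_less)
      with X_iff[of "x div k" "x mod k"] that k show ?thesis by (simp add: Y_def)
    qed
    have zero: "weight x = 0" if "x mod k = 0" for x
      using that by (simp add: weight_def cost_gain_def cost_loss_def)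
    show "weight x = 0" if "x \<in> Y g - X" for x
      using *[of x] zero[of x] that by (cases "x mod k = 0") (auto simp: Y_def)
    show "weight x = 0" if "x \<in> X - Y g" for x
      using *[of x] zero[of x] that by (cases "x mod k = 0") (auto simp: X_def)
  qed (auto simp: X_def Y_def)
  then have weight_X: "(\<Sum>x\<in>X. weight x) = (\<Sum>u<n. int (C (u * k + g u)) - int (C (u * k)))"
    using weight_Y[of g] g_less by simp
  fix g' assume g': "\<And>u. u < n \<Longrightarrow> g' u < k"
    and hom: "\<And>u v. u < n \<Longrightarrow> v < n \<Longrightarrow> A u v \<Longrightarrow> R (g' u) (g' v)"
  have "closed_set (Y g')"
    unfolding closed_set_def
  proof (intro conjI ballI allI impI)
    fix x y assume x: "x \<in> Y g'" and y: "y < n * k" and E: "hom_edge k R A x y"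
    have lt: "x div k < n" "y div k < n" using x y by (simp_all add: Y_def less_mult_imp_div_less)
    have xk: "x mod k \<le> g' (x div k)" using x by (simp add: Y_def)
    note g'_lt = g'[OF lt(1)] g'[OF lt(2)]
    from E consider "x div k = y div k" "y mod k \<le> x mod k"
      | "A (x div k) (y div k)" "implies k R (x mod k) (y mod k)"
      | "A (y div k) (x div k)" "implies k (\<lambda>p q. R q p) (x mod k) (y mod k)"
      unfolding hom_edge_def by blast
    then have "y mod k \<le> g' (y div k)"
    proof cases
      case 1
      with xk show ?thesis by simp
    next
      case 2
      with hom[OF lt] g'_lt xk show ?thesis unfolding implies_def by blast
    next
      case 3
      with hom[OF lt(2,1)] g'_lt xk show ?thesis unfolding implies_def by blast
    qed
    with y show "y \<in> Y g'" by (simp add: Y_def)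
  qed (auto simp: Y_def)
  moreover have weight_Y': "(\<Sum>x\<in>Y g'. weight x) = (\<Sum>u<n. int (C (u * k + g' u)) - int (C (u * k)))"
    by (rule weight_Y) (rule g')
  ultimately have "(\<Sum>u<n. int (C (u * k + g u)) - int (C (u * k))) \<le>
      (\<Sum>u<n. int (C (u * k + g' u)) - int (C (u * k)))"
    using opt[of "Y g'"] unfolding weight_X weight_Y' by simp
  then have "int (\<Sum>u<n. C (u * k + g u)) \<le> int (\<Sum>u<n. C (u * k + g' u))"
    by (simp add: sum_subtractf)
  then show "(\<Sum>u<n. C (u * k + g u)) \<le> (\<Sum>u<n. C (u * k + g' u))" by linarith
qed

section \<open>A vertex order for the target\<close>

definition asym_arc :: "'a pair_pre_digraph \<Rightarrow> 'a \<Rightarrow> 'a \<Rightarrow> bool" where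
  "asym_arc H u v \<longleftrightarrow> (u, v) \<in> parcs H \<and> (v, u) \<notin> parcs H"

section \<open>Transitivity from the forbidden subdigraphs\<close>

text \<open>Containment up to isomorphism is reduced to an embedding that preserves and reflects
  arcs; the isomorphism is the inverse of \<open>f\<close> on its image.\<close>

lemma contains_inducedI:
  assumes "wf_digraph (with_proj H)" and X: "finite (pverts X)" "\<And>x y. (x, y) \<in> parcs X \<Longrightarrow> x \<in> pverts X \<and> y \<in> pverts X"
    and f: "inj_on f (pverts X)" "f ` pverts X \<subseteq> pverts H"
    and arcs: "\<And>x y. x \<in> pverts X \<Longrightarrow> y \<in> pverts X \<Longrightarrow> (f x, f y) \<in> parcs H \<longleftrightarrow> (x, y) \<in> parcs X"
  shows "contains_induced H X"
proof -
  define K where "K = with_proj H \<restriction> (f ` pverts X)"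
  have K: "verts K = f ` pverts X" "arcs K = {(f x, f y) | x y. (x, y) \<in> parcs X}"
    "tail K = fst" "head K = snd"
    using f X(2) arcs by (auto simp: K_def induce_subgraph_def) blast+
  have wfK: "wf_digraph K"
    using assms(1) by (simp add: K_def wf_digraph.wellformed_induce_subgraph)
  have "induced_subgraph K (with_proj H)"
    unfolding K_def using assms(1) f(2) by (intro wf_digraph.induced_induce) auto
  moreover have "digraph_iso K (with_proj X)"
  proof -
    define g where "g = the_inv_into (pverts X) f"
    have g: "g (f x) = x" if "x \<in> pverts X" for x
      using that f(1) by (simp add: g_def the_inv_into_f_f)
    let ?h = "\<lparr>iso_verts = g, iso_arcs = (\<lambda>(u, v). (g u, g v)), iso_head = snd, iso_tail = fst\<rparr>"
    have "pre_digraph.digraph_isomorphism K ?h"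
      unfolding pre_digraph.digraph_isomorphism_def using wfK K g X(2)
      by (auto simp: inj_on_def)
    moreover have "app_iso ?h K = with_proj X"
    proof -
      have "g ` f ` pverts X = pverts X" using g by force
      moreover have "(\<lambda>(u, v). (g u, g v)) ` {(f x, f y) | x y. (x, y) \<in> parcs X} = parcs X"
      proof -
        have "{(f x, f y) | x y. (x, y) \<in> parcs X} = (\<lambda>(x, y). (f x, f y)) ` parcs X" by auto
        moreover have "(\<lambda>(x, y). (g (f x), g (f y))) ` parcs X = (\<lambda>p. p) ` parcs X"
          by (rule image_cong) (use X(2) g in auto)
        ultimately show ?thesis by (simp add: image_image case_prod_beta)
      qed
      ultimately show ?thesis by (simp add: app_iso_def K)
    qed
    ultimately show ?thesis unfolding digraph_iso_def by metis
  qed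
  ultimately show ?thesis unfolding contains_induced_def by blast
qed

text \<open>If \<open>uw\<close> is no asymmetric arc, semicompleteness gives the arc
  \<open>wu\<close>. Then \<open>u\<close>, \<open>v\<close>, \<open>w\<close> induce
  \<open>R\<close> when \<open>uw\<close> is an arc as well, and the reflexive 3-cycle when it is
  not.\<close>

lemma asym_arc_trans:
  assumes H: "pair_fin_digraph H" "reflexive_semicomplete H"
    and noR: "\<not> contains_induced H digraph_R" and noC: "\<not> contains_induced H reflexive_C3"
    and uv: "asym_arc H u v" and vw: "asym_arc H v w"
  shows "asym_arc H u w"
proof (rule ccontr)
  assume n: "\<not> asym_arc H u w"
  interpret pair_fin_digraph H by (rule H(1))
  have V: "u \<in> pverts H" "v \<in> pverts H" "w \<in> pverts H"
    using uv vw in_arcsD1 in_arcsD2 by (auto simp: asym_arc_def)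
  have loops: "(u, u) \<in> parcs H" "(v, v) \<in> parcs H" "(w, w) \<in> parcs H"
    using V H(2) by (auto simp: reflexive_semicomplete_def)
  have ne: "u \<noteq> v" "v \<noteq> w" "u \<noteq> w" using uv vw by (auto simp: asym_arc_def)
  have wu: "(w, u) \<in> parcs H"
    using n V ne H(2) by (auto simp: asym_arc_def reflexive_semicomplete_def)
  define f :: "nat \<Rightarrow> 'a" where "f x = (if x = 1 then u else if x = 2 then v else w)" for x
  have wf: "wf_digraph (with_proj H)" by unfold_locales
  show False
  proof (cases "(u, w) \<in> parcs H")
    case True
    have "contains_induced H digraph_R"
      by (rule contains_inducedI[OF wf, of _ f])
        (use True wu uv vw ne V loops in \<open>auto simp: digraph_R_def f_def asym_arc_def inj_on_def\<close>)
    with noR show False by simp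
  next
    case False
    have "contains_induced H reflexive_C3"
      by (rule contains_inducedI[OF wf, of _ f])
        (use False wu uv vw ne V loops in \<open>auto simp: reflexive_C3_def f_def asym_arc_def inj_on_def\<close>)
    with noC show False by simp
  qed
qed

lemma mk_symmetric_sym_part:
  "pverts (mk_symmetric (with_proj (sym_part H))) = pverts H"
  "(u, v) \<in> parcs (mk_symmetric (with_proj (sym_part H))) \<longleftrightarrow> (u, v) \<in> parcs H \<and> (v, u) \<in> parcs H"
  by (auto simp: parcs_mk_symmetric sym_part_def)

section \<open>Inclusion-free intervals ordered by their closures\<close>

text \<open>Closures under smaller and larger reals replace endpoints, which an open or unbounded
  interval need not possess. They are totally ordered by inclusion.\<close>

definition below :: "real set \<Rightarrow> real set" where
  "below A = {x. \<exists>y\<in>A. x \<le> y}"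

definition above :: "real set \<Rightarrow> real set" where
  "above A = {x. \<exists>y\<in>A. y \<le> x}"

lemma interval_eq_below_above:
  assumes "is_interval A" shows "A = below A \<inter> above A"
proof
  show "A \<subseteq> below A \<inter> above A" by (auto simp: below_def above_def)
  show "below A \<inter> above A \<subseteq> A"
    using assms by (auto simp: below_def above_def is_interval_1)
qed

lemma below_total: "below A \<subseteq> below B \<or> below B \<subseteq> below A"
proof (rule disjCI)
  assume "\<not> below B \<subseteq> below A"
  then obtain x where x: "x \<in> below B" "x \<notin> below A" by blast
  then have A: "\<forall>a\<in>A. a < x" unfolding below_def by (auto simp: not_le[symmetric])
  obtain b where b: "b \<in> B" "x \<le> b" using x unfolding below_def by blast
  show "below A \<subseteq> below B"
  proof
    fix z assume "z \<in> below A"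
    then obtain a where "a \<in> A" "z \<le> a" unfolding below_def by blast
    with A b(2) have "z \<le> b" by fastforce
    with b(1) show "z \<in> below B" unfolding below_def by blast
  qed
qed

lemma above_eq_below: "above A = uminus ` below (uminus ` A)"
proof
  show "above A \<subseteq> uminus ` below (uminus ` A)"
  proof
    fix x assume "x \<in> above A"
    then have "- x \<in> below (uminus ` A)" by (auto simp: above_def below_def)
    then show "x \<in> uminus ` below (uminus ` A)" by force
  qed
qed (auto simp: above_def below_def dest: le_imp_neg_le)

lemma above_total: "above A \<subseteq> above B \<or> above B \<subseteq> above A"
  unfolding above_eq_below using below_total[of "uminus ` A" "uminus ` B"] by blast

text \<open>Inclusion-free intervals are linearly preordered by their lower closures, and the upper
  closures are then ordered in the same way.\<close>

lemma above_antimono: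
  assumes "is_interval A" "is_interval B" "\<not> A \<subset> B" "below A \<subseteq> below B"
  shows "above B \<subseteq> above A"
proof (rule ccontr)
  assume n: "\<not> above B \<subseteq> above A"
  then have "above A \<subseteq> above B" using above_total by blast
  then have "A \<subseteq> B"
    using interval_eq_below_above[OF assms(1)] interval_eq_below_above[OF assms(2)] assms(4) by blast
  with assms(3) have "A = B" by blast
  with n show False by simp
qed

text \<open>A common point of \<open>A\<close> and \<open>C\<close> lies in the lower closure of
  \<open>A\<close> and in the upper closure of \<open>C\<close>, hence in both closures of
  \<open>B\<close> and so in \<open>B\<close>.\<close>

lemma intervals_umbrella:
  assumes "is_interval A" "is_interval B" "is_interval C" "\<not> B \<subset> C"
    and "below A \<subseteq> below B" "below B \<subseteq> below C" "A \<inter> C \<noteq> {}"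
  shows "A \<inter> B \<noteq> {} \<and> B \<inter> C \<noteq> {}"
proof -
  from assms(7) obtain x where x: "x \<in> A" "x \<in> C" by blast
  then have "x \<in> below A" "x \<in> above C" unfolding below_def above_def by blast+
  then have "x \<in> B"
    using assms(5) above_antimono[OF assms(2,3,4,6)] interval_eq_below_above[OF assms(2)] by blast
  with x show ?thesis by blast
qed

text \<open>The asymmetric arcs form a strict partial order whose incomparability graph is the proper
  interval graph \<open>U(H\<^sup>s\<^sup>y\<^sup>m)\<close>.  As the latter contains neither a claw nor an induced 4-cycle, the
  partial order is a semiorder, and its vertices are linearly preordered by their sets of
  predecessors and successors.\<close>

lemma reflexive_semicomplete_order:
  fixes H :: "'a pair_pre_digraph"
  assumes H: "pair_fin_digraph H" "reflexive_semicomplete H"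
    and noR: "\<not> contains_induced H digraph_R" and noC: "\<not> contains_induced H reflexive_C3"
    and pig: "proper_interval_graph (mk_symmetric (with_proj (sym_part H)))"
  obtains hs where "distinct hs" "set hs = pverts H"
    "\<And>i j i' j'. i' \<le> i \<Longrightarrow> i \<le> j \<Longrightarrow> j \<le> j' \<Longrightarrow> j' < length hs \<Longrightarrow>
       (hs ! i', hs ! j') \<in> parcs H \<Longrightarrow> (hs ! i, hs ! j) \<in> parcs H"
    "\<And>i j i' j'. i' \<le> i \<Longrightarrow> i \<le> j \<Longrightarrow> j \<le> j' \<Longrightarrow> j' < length hs \<Longrightarrow>
       (hs ! j', hs ! i') \<in> parcs H \<Longrightarrow> (hs ! j, hs ! i) \<in> parcs H"
proof -
  interpret pair_fin_digraph H by (rule H(1))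
  let ?V = "pverts H"
  let ?lt = "asym_arc H"
  define adj where "adj u v \<longleftrightarrow> (u, v) \<in> parcs H \<and> (v, u) \<in> parcs H" for u v
  have trans: "?lt u w" if "?lt u v" "?lt v w" for u v w
    by (rule asym_arc_trans[OF H noR noC that])
  have ltV: "u \<in> ?V \<and> v \<in> ?V" if "?lt u v" for u v
    using that in_arcsD1 in_arcsD2 by (auto simp: asym_arc_def)
  have tri: "adj u v \<longleftrightarrow> \<not> ?lt u v \<and> \<not> ?lt v u" if "u \<in> ?V" "v \<in> ?V" for u v
    using that H(2) by (cases "u = v") (auto simp: adj_def asym_arc_def reflexive_semicomplete_def)
  have adj_sym: "adj u v \<longleftrightarrow> adj v u" for u v by (auto simp: adj_def)
  note verts = mk_symmetric_sym_part(1)[of H] and arcs = mk_symmetric_sym_part(2)[of _ _ H, folded adj_def]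
  from pig obtain I :: "'a \<Rightarrow> real set" where
    "(\<forall>v\<in>?V. is_interval (I v) \<and> I v \<noteq> {}) \<and> (\<forall>u\<in>?V. \<forall>v\<in>?V. \<not> I u \<subset> I v) \<and>
      (\<forall>u\<in>?V. \<forall>v\<in>?V. adj u v \<longleftrightarrow> I u \<inter> I v \<noteq> {})"
    unfolding proper_interval_graph_def verts arcs by (elim exE)
  then have I: "is_interval (I v)" "u \<in> ?V \<Longrightarrow> \<not> I u \<subset> I v"
    and adjI: "u \<in> ?V \<Longrightarrow> adj u v \<longleftrightarrow> I u \<inter> I v \<noteq> {}" if "v \<in> ?V" for u v
    using that by simp_all
  define le where "le u v \<longleftrightarrow> below (I u) \<subseteq> below (I v)" for u v
  have le_total: "le u v \<or> le v u" for u v unfolding le_def by (rule below_total)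
  have le_trans: "le u w" if "le u v" "le v w" for u v w using that unfolding le_def by blast
  have umb: "adj u v \<and> adj v w"
    if "u \<in> ?V" "v \<in> ?V" "w \<in> ?V" "le u v" "le v w" "adj u w" for u v w
    using intervals_umbrella[of "I u" "I v" "I w"] that I adjI unfolding le_def by simp
  \<comment> \<open>Two of the three leaves lie on the same side of \<open>y\<close>, and the
    umbrella property makes them adjacent.\<close>
  have noclaw: False if V: "y \<in> ?V" "a \<in> ?V" "b \<in> ?V" "c \<in> ?V"
    and y: "adj y a" "adj y b" "adj y c" and n: "\<not> adj a b" "\<not> adj b c" "\<not> adj a c" for y a b c
  proof -
    have *: False if "p \<in> ?V" "q \<in> ?V" "adj y p" "adj y q" "\<not> adj p q" "\<not> adj q p"
      "le y p \<and> le y q \<or> le p y \<and> le q y" for p q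
      using that le_total[of p q] umb[of y p q] umb[of y q p] umb[of p q y] umb[of q p y] V(1)
        adj_sym[of y p] adj_sym[of y q] by blast
    show False
    proof -
      have "\<not> (le y p \<and> le y q \<or> le p y \<and> le q y)"
        if "(p, q) = (a, b) \<or> (p, q) = (b, c) \<or> (p, q) = (a, c)" for p q
        using *[of p q] that V y n adj_sym by blast
      from this[of a b] this[of b c] this[of a c] show ?thesis
        using le_total[of y a] le_total[of y b] le_total[of y c] by blast
    qed
  qed
  \<comment> \<open>The two neighbours of a vertex are not adjacent, so they lie on opposite sides
    of it. Following this around the cycle makes the order monotone all the way, and transitivity
    then puts both neighbours of a vertex on the same side.\<close>
  have noC4: False if V: "a \<in> ?V" "b \<in> ?V" "x \<in> ?V" "y \<in> ?V"
    and C: "adj a b" "adj b x" "adj x y" "adj y a" and n: "\<not> adj a x" "\<not> adj b y" for a b x y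
  proof -
    have *: False if "p \<in> ?V" "q \<in> ?V" "r \<in> ?V" "adj p q" "adj p r" "\<not> adj q r" "\<not> adj r q"
      "le p q" "le p r" for p q r
      using that le_total[of q r] umb[of p q r] umb[of p r q] by blast
    show False
    proof -
      have "\<not> (le a b \<and> le a y)" using *[of a b y] V C n adj_sym by blast
      moreover have "\<not> (le b a \<and> le b x)" using *[of b a x] V C n adj_sym by blast
      moreover have "\<not> (le x b \<and> le x y)" using *[of x b y] V C n adj_sym by blast
      moreover have "\<not> (le y a \<and> le y x)" using *[of y a x] V C n adj_sym by blast
      moreover note le_trans[of a b x] le_trans[of a x y] le_trans[of b a y] le_trans[of b y x]
        le_total[of a b] le_total[of b x] le_total[of x y] le_total[of y a]
      ultimately show ?thesis by blast
    qed
  qed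
  define pre where "pre x y \<longleftrightarrow> (\<forall>z. ?lt z x \<longrightarrow> ?lt z y) \<and> (\<forall>z. ?lt y z \<longrightarrow> ?lt x z)" for x y
  have total: "pre x y \<or> pre y x" if xy: "x \<in> ?V" "y \<in> ?V" for x y
  proof (rule ccontr)
    assume "\<not> ?thesis"
    \<comment> \<open>The cases are the ways of violating both directions of \<open>pre\<close>. The
      first and the last give two disjoint comparable pairs, a 2+2, hence a 4-cycle of
      incomparabilities; the middle ones give a chain of three beside a single element, a 3+1, hence
      a claw.\<close>
    then consider a b where "?lt a x" "\<not> ?lt a y" "?lt b y" "\<not> ?lt b x"
      | a c where "?lt a x" "\<not> ?lt a y" "?lt x c" "\<not> ?lt y c"
      | a c where "?lt a y" "\<not> ?lt a x" "?lt y c" "\<not> ?lt x c"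
      | a b where "?lt x a" "\<not> ?lt y a" "?lt y b" "\<not> ?lt x b"
      unfolding pre_def by blast
    then show False
    proof cases
      case 1
      then have V: "a \<in> ?V" "b \<in> ?V" using ltV by blast+
      show False by (rule noC4[of a b x y]) (use 1 V xy tri trans in metis)+
    next
      case 2
      then have V: "a \<in> ?V" "c \<in> ?V" using ltV by blast+
      show False by (rule noclaw[of y a x c]) (use 2 V xy tri trans in metis)+
    next
      case 3
      then have V: "a \<in> ?V" "c \<in> ?V" using ltV by blast+
      show False by (rule noclaw[of x a y c]) (use 3 V xy tri trans in metis)+
    next
      case 4
      then have V: "a \<in> ?V" "b \<in> ?V" using ltV by blast+
      show False by (rule noC4[of a b x y]) (use 4 V xy tri trans in metis)+
    qed
  qed
  \<comment> \<open>Both the predecessor sets and the complements of the successor sets grow along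
    \<open>pre\<close>, so this difference turns the preorder into a sort key.\<close>
  define key :: "'a \<Rightarrow> int" where
    "key x = int (card {z. ?lt z x}) - int (card {z. ?lt x z})" for x
  have fin: "finite {z. ?lt z x}" "finite {z. ?lt x z}" for x
    using ltV finite_verts by (auto intro: finite_subset[of _ ?V])
  have pre_key: "key x \<le> key y" if "pre x y" for x y
  proof -
    have "card {z. ?lt z x} \<le> card {z. ?lt z y}" "card {z. ?lt y z} \<le> card {z. ?lt x z}"
      using that by (auto simp: pre_def intro!: card_mono fin)
    then show ?thesis by (simp add: key_def)
  qed
  \<comment> \<open>If only \<open>pre y x\<close> held, the inequality of keys would force equal
    cardinalities of the nested finite sets, hence equal sets.\<close>
  have key_pre: "pre x y" if "x \<in> ?V" "y \<in> ?V" "key x \<le> key y" for x y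
  proof (rule ccontr)
    assume n: "\<not> pre x y"
    with total that have yx: "pre y x" by blast
    then have s: "{z. ?lt z y} \<subseteq> {z. ?lt z x}" "{z. ?lt x z} \<subseteq> {z. ?lt y z}" by (auto simp: pre_def)
    have c: "card {z. ?lt z y} \<le> card {z. ?lt z x}" "card {z. ?lt x z} \<le> card {z. ?lt y z}"
      using s fin by (auto intro!: card_mono)
    with that(3) have "card {z. ?lt z y} = card {z. ?lt z x}" "card {z. ?lt x z} = card {z. ?lt y z}"
      by (auto simp: key_def)
    with s fin have "{z. ?lt z y} = {z. ?lt z x}" "{z. ?lt x z} = {z. ?lt y z}"
      by (metis card_subset_eq)+
    with n show False by (auto simp: pre_def)
  qed
  obtain hs0 where hs0: "set hs0 = ?V" "distinct hs0" using finite_distinct_list finite_verts by blast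
  define hs where "hs = sort_key key hs0"
  have hs: "set hs = ?V" "distinct hs" using hs0 by (auto simp: hs_def)
  have mono: "pre (hs ! i) (hs ! j)" if "i \<le> j" "j < length hs" for i j
  proof (rule key_pre)
    have "sorted (map key hs)" by (simp add: hs_def)
    then show "key (hs ! i) \<le> key (hs ! j)" using that by (auto dest: sorted_nth_mono)
  qed (use that hs(1) nth_mem[of i hs] nth_mem[of j hs] in simp_all)
  have irr: "\<not> ?lt x x" for x by (simp add: asym_arc_def)
  have nback: "\<not> ?lt (hs ! j) (hs ! i)" if "i \<le> j" "j < length hs" for i j
    using mono[OF that] irr unfolding pre_def by blast
  have arc: "(u, v) \<in> parcs H \<longleftrightarrow> \<not> ?lt v u" if "u \<in> ?V" "v \<in> ?V" for u v
    using that H(2) by (cases "u = v") (auto simp: asym_arc_def reflexive_semicomplete_def)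
  have nth: "hs ! i \<in> ?V" if "i < length hs" for i using nth_mem[OF that] hs(1) by simp
  show ?thesis
  proof (rule that[OF hs(2,1)])
    fix i j i' j' assume a: "i' \<le> i" "i \<le> j" "j \<le> j'" "j' < length hs"
    \<comment> \<open>Asymmetric arcs never point backwards along \<open>hs\<close>, so
      semicompleteness and the loops provide every arc from a position to the same or a later
      one.\<close>
    show "(hs ! i, hs ! j) \<in> parcs H"
      using a nback[of i j] arc nth by simp
    assume b: "(hs ! j', hs ! i') \<in> parcs H"
    show "(hs ! j, hs ! i) \<in> parcs H"
    proof (rule ccontr)
      assume "(hs ! j, hs ! i) \<notin> parcs H"
      then have "?lt (hs ! i) (hs ! j)" using arc nth a by simp
      \<comment> \<open>Successors are kept when moving from \<open>i\<close> down to
        \<open>i'\<close>, predecessors when moving from \<open>j\<close> up to \<open>j'\<close>,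
        so an asymmetric arc extends to the outer pair.\<close>
      then have "?lt (hs ! i') (hs ! j')"
        using mono[of i' i] mono[of j j'] a unfolding pre_def by auto
      with b show False by (simp add: asym_arc_def)
    qed
  qed
qed

section \<open>The program for MinHOM\<close>

lemma polytime_solvableI:
  assumes "polytime I e f" "\<And>i. i \<in> I \<Longrightarrow> sol i (f i)"
  shows "polytime_solvable I e sol"
proof -
  from assms(1)[unfolded polytime_def, rule_format, of 0] obtain p T where T: "polybound I e T"
    and p: "\<And>i s. i \<in> I \<Longrightarrow> s 0 = e i \<Longrightarrow> \<exists>t s'. exec p s t s' \<and> t \<le> T i \<and> s' 0 = f i" by blast
  from T obtain q where q: "\<And>i. i \<in> I \<Longrightarrow> T i \<le> poly q (bitsize (e i))"
    unfolding polybound_def by blast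
  show ?thesis
    unfolding polytime_solvable_def
  proof (intro exI[of _ p] exI[of _ q] ballI)
    fix i assume i: "i \<in> I"
    obtain t s' where "exec p ((\<lambda>x. Num 0)(0 := e i)) t s'" "t \<le> T i" "s' 0 = f i"
      using p[OF i, of "(\<lambda>x. Num 0)(0 := e i)"] by auto
    with q[OF i] assms(2)[OF i] show "\<exists>t s'. exec p ((\<lambda>x. Num 0)(0 := e i)) t s' \<and>
        t \<le> poly q (bitsize (e i)) \<and> sol i (s' 0)"
      by (metis order_trans)
  qed
qed

section \<open>Rational costs and the format of the input\<close>

definition rat_num :: "rat \<Rightarrow> nat" where "rat_num r = nat (fst (quotient_of r))"

definition rat_den :: "rat \<Rightarrow> nat" where "rat_den r = nat (snd (quotient_of r))"

lemma enc_rat_eq: "enc_rat r = Node (Num (rat_num r)) (Num (rat_den r))"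
  by (simp add: enc_rat_def rat_num_def rat_den_def case_prod_beta)

lemma rat_den_pos: "0 < rat_den r"
  using quotient_of_denom_pos[of r] by (cases "quotient_of r") (auto simp: rat_den_def)

lemma rat_num_den:
  assumes "0 \<le> r"
  shows "of_nat (rat_num r) = r * of_nat (rat_den r)"
proof -
  obtain p q where pq: "quotient_of r = (p, q)" by fastforce
  have q: "0 < q" using quotient_of_denom_pos[OF pq] .
  have r: "of_int p = r * of_int q" using quotient_of_div[OF pq] q by simp
  with assms q have "0 \<le> (of_int p :: rat)" by simp
  then have "0 \<le> p" by simp
  with q r pq show ?thesis by (simp add: rat_num_def rat_den_def)
qed

lemma concat_upt_mult:
  "concat (map (\<lambda>u. map (f u) [0..<k]) [0..<n]) = map (\<lambda>x. f (x div k) (x mod k)) [0..<n * k]"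
proof (induction n)
  case (Suc n)
  have "[0..<Suc n * k] = [0..<n * k] @ map (\<lambda>i. n * k + i) [0..<k]"
    using upt_add_eq_append[of 0 "n * k" k] map_add_upt[of "n * k" k] by (simp add: add.commute)
  then show ?case using Suc by simp
qed simp

definition size_of :: "nat pair_pre_digraph \<times> (nat \<Rightarrow> 'a \<Rightarrow> rat) \<Rightarrow> nat" where
  "size_of i = card (pverts (fst i))"

definition adj :: "nat pair_pre_digraph \<times> (nat \<Rightarrow> 'a \<Rightarrow> rat) \<Rightarrow> nat \<Rightarrow> nat \<Rightarrow> bool" where
  "adj i u v \<longleftrightarrow> (u, v) \<in> parcs (fst i)"

text \<open>The instance as the nested list that its encoding literally is, so that the rules for
  loops apply to it.\<close>

definition rows :: "'a list \<Rightarrow> nat pair_pre_digraph \<times> (nat \<Rightarrow> 'a \<Rightarrow> rat) \<Rightarrow> (bool list \<times> rat list) list" where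
  "rows vs i = map (\<lambda>u. (map (adj i u) [0..<size_of i], map (snd i u) vs)) [0..<size_of i]"

definition enc_row :: "bool list \<times> rat list \<Rightarrow> data" where
  "enc_row x = Node (enc_map (\<lambda>b. Num (of_bool b)) (fst x)) (enc_map enc_rat (snd x))"

lemma enc_minhom_rows: "enc_minhom vs i = enc_map enc_row (rows vs i)"
  by (cases i) (simp add: rows_def enc_row_def size_of_def adj_def Let_def o_def)

text \<open>Multiplying with the product of all denominators makes the costs integral.  The entry for
  \<open>u * k + i\<close> is the cost of mapping \<open>u\<close> to the \<open>i\<close>-th vertex in the order given by \<open>os\<close>.\<close>

definition flat :: "'a list \<Rightarrow> nat list \<Rightarrow> (rat \<Rightarrow> nat) \<Rightarrow> nat pair_pre_digraph \<times> (nat \<Rightarrow> 'a \<Rightarrow> rat) \<Rightarrow> nat \<Rightarrow> nat" where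
  "flat vs os h i x = h (snd i (x div length vs) (vs ! (os ! (x mod length vs))))"

text \<open>Leaving the entry's own denominator out of the product takes the place of a
  division.\<close>

definition int_cost :: "'a list \<Rightarrow> nat list \<Rightarrow> nat pair_pre_digraph \<times> (nat \<Rightarrow> 'a \<Rightarrow> rat) \<Rightarrow> nat \<Rightarrow> nat" where
  "int_cost vs os i x = flat vs os rat_num i x *
     (\<Prod>y<size_of i * length vs. if y = x then 1 else flat vs os rat_den i y)"

text \<open>An upper bound on every single loss; its bit length determines the increment of the
  first scaling phase.\<close>

definition total_loss :: "'a list \<Rightarrow> nat list \<Rightarrow> nat pair_pre_digraph \<times> (nat \<Rightarrow> 'a \<Rightarrow> rat) \<Rightarrow> nat" where
  "total_loss vs os i = (\<Sum>x<size_of i * length vs. cost_loss (length vs) (int_cost vs os i) x)"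

definition min_labels ::
    "'a list \<Rightarrow> nat list \<Rightarrow> (nat \<Rightarrow> nat \<Rightarrow> bool) \<Rightarrow> nat pair_pre_digraph \<times> (nat \<Rightarrow> 'a \<Rightarrow> rat) \<Rightarrow> nat \<Rightarrow> nat" where
  "min_labels vs os R i = implication_network.final_labels (size_of i * length vs)
     (hom_edge (length vs) R (adj i)) (cost_gain (length vs) (int_cost vs os i))
     (cost_loss (length vs) (int_cost vs os i)) (floorlog 2 (total_loss vs os i))"

section \<open>Building, solving and decoding the network in polynomial time\<close>

context
  fixes I :: "(nat pair_pre_digraph \<times> (nat \<Rightarrow> 'a \<Rightarrow> rat)) set" and vs :: "'a list" and os :: "nat list"
  assumes vs: "vs \<noteq> []" and os: "length os = length vs" "\<And>q. q < length vs \<Longrightarrow> os ! q < length vs"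
begin

private abbreviation (input) "k \<equiv> length vs"
private abbreviation (input) "nodes i \<equiv> size_of i * k"
private abbreviation (input) "e \<equiv> enc_minhom vs :: nat pair_pre_digraph \<times> (nat \<Rightarrow> 'a \<Rightarrow> rat) \<Rightarrow> data"

lemma polytime_rows: "polytime I e (\<lambda>i. enc_map enc_row (rows vs i))"
  by (rule polytime_cong[OF polytime_self]) (rule enc_minhom_rows)

lemma polytime_upt_size: "polytime I e (\<lambda>i. enc_map Num [0..<size_of i])"
  using polytime_upt(2)[OF polytime_rows] by (simp add: rows_def)

lemma polytime_adj: "polytime I e (\<lambda>i. enc_mat (size_of i) (\<lambda>u v. of_bool (adj i u v)))"
proof -
  have "polytime I e (\<lambda>i. enc_map ((\<lambda>_ x. left (enc_row x)) i) (rows vs i))"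
    by (rule polytime_map[OF polytime_rows polytime_left[OF polytime_top]])
  then show ?thesis by (simp add: rows_def enc_row_def o_def)
qed

lemma polytime_flat:
  assumes h: "\<And>(J :: (((nat pair_pre_digraph \<times> (nat \<Rightarrow> 'a \<Rightarrow> rat)) \<times> bool list \<times> rat list) \<times> nat) set) e' r.
      polytime J e' (\<lambda>j. enc_rat (r j)) \<Longrightarrow> polytime J e' (\<lambda>j. Num (h (r j)))"
  shows "polytime I e (\<lambda>i. enc_vec (nodes i) (flat vs os h i))"
proof -
  let ?F = "\<lambda>x q. h (snd x ! (os ! q))"
  let ?J = "{(i, x). i \<in> I \<and> x \<in> set (rows vs i)}"
  let ?J2 = "{(j, q). j \<in> ?J \<and> q \<in> set [0..<k]}"
  have J2: "j \<in> ?J2 \<Longrightarrow> fst j \<in> ?J" for j by auto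
  have "polytime I e (\<lambda>i. enc_map Num (concat (map ((\<lambda>_ x. map (?F x) [0..<k]) i) (rows vs i))))"
  proof (rule polytime_concat[OF polytime_rows])
    have "polytime ?J (ext e (\<lambda>j. enc_row (snd j))) (\<lambda>j. enc_map ((\<lambda>j q. Num (?F (snd j) q)) j) [0..<k])"
    proof (rule polytime_map[OF polytime_const])
      have cs: "polytime ?J2 (loop_env (ext e (\<lambda>j. enc_row (snd j)))) (\<lambda>j. enc_map enc_rat (snd (snd (fst j))))"
      proof -
        have "polytime ?J2 (loop_env (ext e (\<lambda>j. enc_row (snd j)))) (\<lambda>j. enc_row (snd (fst j)))"
          by (rule polytime_lift[OF polytime_top J2])
        from polytime_right[OF this] show ?thesis by (rule polytime_cong) (simp add: enc_row_def)
      qed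
      have q: "polytime ?J2 (loop_env (ext e (\<lambda>j. enc_row (snd j)))) (\<lambda>j. Num (os ! snd j))"
        by (rule polytime_nth[OF polytime_const polytime_top]) (use os in auto)
      show "polytime ?J2 (loop_env (ext e (\<lambda>j. enc_row (snd j)))) (\<lambda>j. Num (?F (snd (fst j)) (snd j)))"
        by (rule h, rule polytime_nth[OF cs q]) (use os in \<open>auto simp: rows_def\<close>)
    qed
    then show "polytime ?J (ext e (\<lambda>j. enc_row (snd j))) (\<lambda>j. enc_map Num (map (?F (snd j)) [0..<k]))"
      by (simp add: o_def)
  qed
  moreover have "concat (map (\<lambda>x. map (?F x) [0..<k]) (rows vs i)) = map (flat vs os h i) [0..<nodes i]" for i
  proof -
    have "concat (map (\<lambda>x. map (?F x) [0..<k]) (rows vs i)) =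
        concat (map (\<lambda>u. map (\<lambda>q. h (snd i u (vs ! (os ! q)))) [0..<k]) [0..<size_of i])"
      by (auto simp: rows_def o_def os intro!: arg_cong[of _ _ concat])
    then show ?thesis unfolding concat_upt_mult flat_def .
  qed
  ultimately show ?thesis by (simp add: o_def)
qed

text \<open>The programming language has no division. Nested loops over vertices and positions visit
  the nodes in numerical order and write down both tables.\<close>

lemma polytime_div_mod:
  "polytime I e (\<lambda>i. enc_vec (nodes i) (\<lambda>x. x div k))" "polytime I e (\<lambda>i. enc_vec (nodes i) (\<lambda>x. x mod k))"
proof -
  have "polytime I e (\<lambda>i. enc_map Num (concat (map ((\<lambda>_ u. map (\<lambda>_. u) [0..<k]) i) [0..<size_of i])))"
  proof (rule polytime_concat[OF polytime_upt_size])
    have "polytime (loop_dom I size_of) (loop_env e) (\<lambda>j. enc_map ((\<lambda>j _. Num (snd j)) j) [0..<k])"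
      by (rule polytime_map[OF polytime_const polytime_lift[OF polytime_top]]) auto
    then show "polytime (loop_dom I size_of) (loop_env e) (\<lambda>j. enc_map Num (map (\<lambda>_. snd j) [0..<k]))"
      by (simp add: o_def)
  qed
  then show "polytime I e (\<lambda>i. enc_vec (nodes i) (\<lambda>x. x div k))"
    unfolding concat_upt_mult by (simp add: o_def)
  have "polytime I e (\<lambda>i. enc_map Num (concat (map ((\<lambda>_ u. map (\<lambda>q. q) [0..<k]) i) [0..<size_of i])))"
    by (rule polytime_concat[OF polytime_upt_size polytime_const])
  then show "polytime I e (\<lambda>i. enc_vec (nodes i) (\<lambda>x. x mod k))"
    unfolding concat_upt_mult by (simp add: o_def)
qed

lemma polytime_upt_nodes: "polytime I e (\<lambda>i. enc_map Num [0..<nodes i])"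
  using polytime_upt(2)[OF polytime_div_mod(1)] by simp

lemma polytime_int_cost: "polytime I e (\<lambda>i. enc_vec (nodes i) (int_cost vs os i))"
proof (rule polytime_map[OF polytime_upt_nodes])
  have num: "polytime I e (\<lambda>i. enc_vec (nodes i) (flat vs os rat_num i))"
    by (rule polytime_flat) (use polytime_left in \<open>force simp: enc_rat_eq\<close>)
  have den: "polytime I e (\<lambda>i. enc_vec (nodes i) (flat vs os rat_den i))"
    by (rule polytime_flat) (use polytime_right in \<open>force simp: enc_rat_eq\<close>)
  let ?J = "loop_dom I nodes"
  let ?J2 = "loop_dom ?J (\<lambda>j. nodes (fst j))"
  note lift = polytime_loop_lift[where N = nodes]
  note lift2 = polytime_loop_lift[where N = "\<lambda>j. nodes (fst j)"]
  have "polytime ?J2 (loop_env (loop_env e)) (\<lambda>j. Num (if snd j = snd (fst j) then 1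
      else flat vs os rat_den (fst (fst j)) (snd j)))"
    by (intro polytime_num_If_total polytime_eq polytime_const polytime_top lift2[OF polytime_top]
        polytime_vec_nth[OF lift2[OF lift[OF den]] polytime_top]) auto
  from polytime_prod[OF lift[OF polytime_upt_nodes] this]
  have "polytime ?J (loop_env e) (\<lambda>j. Num (\<Prod>y<nodes (fst j). if y = snd j then 1
      else flat vs os rat_den (fst j) y))" by simp
  moreover have "polytime ?J (loop_env e) (\<lambda>j. Num (flat vs os rat_num (fst j) (snd j)))"
    by (rule polytime_vec_nth[OF lift[OF num] polytime_top]) auto
  ultimately show "polytime ?J (loop_env e) (\<lambda>j. Num (int_cost vs os (fst j) (snd j)))"
    unfolding int_cost_def by (intro polytime_mult)
qed

lemma polytime_network:
  "net_polytime I e nodes (\<lambda>i. hom_edge k R (adj i)) (\<lambda>i. cost_gain k (int_cost vs os i))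
    (\<lambda>i. cost_loss k (int_cost vs os i))"
  unfolding net_polytime_def
proof (intro conjI polytime_upt_nodes)
  let ?J = "loop_dom I nodes"
  let ?J2 = "loop_dom ?J (\<lambda>j. nodes (fst j))"
  let ?e2 = "loop_env (loop_env e)"
  note lift = polytime_loop_lift[where N = nodes]
  note lift2 = polytime_loop_lift[where N = "\<lambda>j. nodes (fst j)"]
  have k: "0 < k" using vs by simp
  have div_less: "x div k < m" if "x < m * k" for x m
    using that by (simp add: less_mult_imp_div_less)
  have x: "polytime ?J2 ?e2 (\<lambda>j. Num (snd (fst j)))" by (rule lift2[OF polytime_top])
  have y: "polytime ?J2 ?e2 (\<lambda>j. Num (snd j))" by (rule polytime_top)
  have dx: "polytime ?J2 ?e2 (\<lambda>j. Num (snd (fst j) div k))"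
    and mx: "polytime ?J2 ?e2 (\<lambda>j. Num (snd (fst j) mod k))"
    and dy: "polytime ?J2 ?e2 (\<lambda>j. Num (snd j div k))"
    and my: "polytime ?J2 ?e2 (\<lambda>j. Num (snd j mod k))"
    by (rule polytime_vec_nth[OF lift2[OF lift[OF polytime_div_mod(1)]] x]
        polytime_vec_nth[OF lift2[OF lift[OF polytime_div_mod(2)]] x]
        polytime_vec_nth[OF lift2[OF lift[OF polytime_div_mod(1)]] y]
        polytime_vec_nth[OF lift2[OF lift[OF polytime_div_mod(2)]] y]; force)+
  \<comment> \<open>The implications between positions depend only on the target, so their table is
    a constant of the program.\<close>
  have imp: "polytime_pred ?J2 ?e2 (\<lambda>j. implies k Q (snd (fst j) mod k) (snd j mod k))" for Q
    by (rule polytime_mat_nth[OF polytime_const[of _ _ "enc_mat k (\<lambda>i j. of_bool (implies k Q i j))"] mx my])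
      (use k in auto)
  have arc: "polytime_pred ?J2 ?e2 (\<lambda>j. adj (fst (fst j)) (snd (fst j) div k) (snd j div k))"
    by (rule polytime_mat_nth[OF lift2[OF lift[OF polytime_adj]] dx dy]) (auto intro: div_less)
  have arc': "polytime_pred ?J2 ?e2 (\<lambda>j. adj (fst (fst j)) (snd j div k) (snd (fst j) div k))"
    by (rule polytime_mat_nth[OF lift2[OF lift[OF polytime_adj]] dy dx]) (auto intro: div_less)
  show "polytime I e (\<lambda>i. enc_mat (nodes i) (\<lambda>x y. of_bool (hom_edge k R (adj i) x y)))"
  proof (rule polytime_mat[OF polytime_upt_nodes])
    show "polytime_pred ?J2 ?e2 (\<lambda>j. hom_edge k R (adj (fst (fst j))) (snd (fst j)) (snd j))"
      unfolding hom_edge_def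
      by (intro polytime_disj polytime_conj polytime_eq polytime_le dx dy mx my arc arc' imp)
  qed
  have m: "polytime ?J (loop_env e) (\<lambda>j. Num (snd j mod k))"
    by (rule polytime_vec_nth[OF lift[OF polytime_div_mod(2)] polytime_top]) auto
  have m0: "polytime_pred ?J (loop_env e) (\<lambda>j. snd j mod k = 0)"
    by (intro polytime_eq m polytime_const)
  show "polytime I e (\<lambda>i. enc_vec (nodes i) (cost_gain k (int_cost vs os i)))"
  proof (rule polytime_map[OF polytime_upt_nodes])
    have "polytime ?J (loop_env e) (\<lambda>j. Num (int_cost vs os (fst j) (snd j)))"
      by (rule polytime_vec_nth[OF lift[OF polytime_int_cost] polytime_top]) auto
    then show "polytime ?J (loop_env e) (\<lambda>j. Num (cost_gain k (int_cost vs os (fst j)) (snd j)))"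
      unfolding cost_gain_def by (intro polytime_num_If_total m0 polytime_const)
  qed
  show "polytime I e (\<lambda>i. enc_vec (nodes i) (cost_loss k (int_cost vs os i)))"
  proof (rule polytime_map[OF polytime_upt_nodes])
    \<comment> \<open>Truncated subtraction keeps the index in range at node 0 too, so the lookup is
      defined in all rounds and is discarded at positions 0.\<close>
    have "polytime ?J (loop_env e) (\<lambda>j. Num (snd j - 1))"
      by (intro polytime_diff polytime_top polytime_const)
    from polytime_vec_nth[OF lift[OF polytime_int_cost] this]
    have "polytime ?J (loop_env e) (\<lambda>j. Num (int_cost vs os (fst j) (snd j - 1)))" by fastforce
    then show "polytime ?J (loop_env e) (\<lambda>j. Num (cost_loss k (int_cost vs os (fst j)) (snd j)))"
      unfolding cost_loss_def by (intro polytime_num_If_total m0 polytime_const)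
  qed
qed

text \<open>The output always announces a homomorphism: with a loop at every vertex of a nonempty
  target, constant maps are homomorphisms. The list \<open>os\<close> turns positions in the vertex
  order into positions in \<open>vs\<close>, as the output format demands.\<close>

lemma polytime_decode:
  "polytime I e (\<lambda>i. Node (Num 1) (enc_list (map Num
     (map (\<lambda>u. os ! decode k (min_labels vs os R i) u) [0..<size_of i]))))"
proof -
  let ?J = "loop_dom I size_of"
  let ?J2 = "loop_dom ?J (\<lambda>_. k - 1)"
  note lift = polytime_loop_lift[where N = size_of]
  note lift2 = polytime_loop_lift[where N = "\<lambda>_. k - 1"]
  have loss: "polytime I e (\<lambda>i. Num (total_loss vs os i))"
    unfolding total_loss_def
    by (rule polytime_sum[OF polytime_upt_nodes],
        rule polytime_vec_nth[OF polytime_loop_lift[OF net_polytimeD(4)[OF polytime_network]] polytime_top]) auto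
  have l: "polytime I e (\<lambda>i. enc_vec (nodes i) (min_labels vs os R i))"
    unfolding min_labels_def by (rule polytime_final_labels[OF polytime_network loss])
  have "polytime ?J2 (loop_env (loop_env e)) (\<lambda>j. Num (snd (fst j) * k + (snd j + 1)))"
    by (intro polytime_add polytime_mult polytime_top lift2[OF polytime_top] polytime_const)
  then have "polytime ?J2 (loop_env (loop_env e)) (\<lambda>j. Num (snd (fst j) * k + Suc (snd j)))" by simp
  from polytime_vec_nth[OF lift2[OF lift[OF l]] this]
  have "polytime ?J2 (loop_env (loop_env e))
      (\<lambda>j. Num (min_labels vs os R (fst (fst j)) (snd (fst j) * k + Suc (snd j))))"
    by (fastforce intro: code_less)
  from polytime_eq[OF this polytime_const[of _ _ "Num 0"]]
  have dec: "polytime ?J (loop_env e) (\<lambda>j. Num (decode k (min_labels vs os R (fst j)) (snd j)))"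
    unfolding decode_def by (rule polytime_sum[OF polytime_const])
  have "decode k l u < k" for l u
  proof -
    have "decode k l u \<le> (\<Sum>i<k - 1. 1)" unfolding decode_def by (rule sum_mono) simp
    then have "decode k l u \<le> k - 1" by simp
    moreover have "0 < k" using vs by simp
    ultimately show ?thesis by linarith
  qed
  then have "polytime ?J (loop_env e) (\<lambda>j. Num (os ! decode k (min_labels vs os R (fst j)) (snd j)))"
    by (intro polytime_nth[OF polytime_const dec]) (simp add: os)
  then have "polytime I e (\<lambda>i. enc_map ((\<lambda>i u. Num (os ! decode k (min_labels vs os R i) u)) i) [0..<size_of i])"
    by (intro polytime_map[OF polytime_upt_size])
  from polytime_Node[OF polytime_const[of _ _ "Num 1"] this] show ?thesis by (simp add: o_def)
qed

end

section \<open>Correctness of the output\<close>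

text \<open>All entries are scaled by one common factor, so total integer costs compare like total
  rational costs.\<close>

lemma rat_scaled_cost:
  assumes k: "0 < length vs" and r: "\<And>u j. u < size_of i \<Longrightarrow> j < length vs \<Longrightarrow> 0 \<le> snd i u (vs ! (os ! j))"
    and u: "u < size_of i" and j: "j < length vs"
  shows "rat_of_nat (int_cost vs os i (u * length vs + j)) =
    snd i u (vs ! (os ! j)) * of_nat (\<Prod>y<size_of i * length vs. flat vs os rat_den i y)"
proof -
  let ?x = "u * length vs + j" and ?N = "size_of i * length vs"
  have x: "?x < ?N" by (rule code_less[OF u j])
  have "(\<Prod>y<?N. flat vs os rat_den i y) = flat vs os rat_den i ?x * (\<Prod>y\<in>{..<?N} - {?x}. flat vs os rat_den i y)"
    using x by (intro prod.remove) auto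
  moreover have "(\<Prod>y<?N. if y = ?x then 1 else flat vs os rat_den i y) =
      (\<Prod>y\<in>{..<?N} - {?x}. flat vs os rat_den i y)"
  proof -
    have "(\<Prod>y<?N. if y = ?x then 1 else flat vs os rat_den i y) =
        (\<Prod>y\<in>{..<?N} - {?x}. if y = ?x then 1 else flat vs os rat_den i y)"
      by (rule prod.mono_neutral_right) auto
    also have "\<dots> = (\<Prod>y\<in>{..<?N} - {?x}. flat vs os rat_den i y)" by (rule prod.cong) auto
    finally show ?thesis .
  qed
  moreover have "?x div length vs = u" "?x mod length vs = j" using j k by simp_all
  ultimately show ?thesis
    using rat_num_den[OF r[OF u j]] by (simp add: int_cost_def flat_def[of _ _ _ _ ?x])
qed

text \<open>The network requires blocks of positive length, so the target without vertices is
  separate: only the empty digraph maps to it, and the program merely tests whether the input is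
  empty.\<close>

lemma MinHOM_polytime_empty:
  assumes "pverts H = {}"
  shows "MinHOM_polytime H"
  unfolding MinHOM_polytime_def
proof (intro allI impI, elim conjE)
  fix vs assume "distinct vs" "set vs = pverts H"
  then have vs: "vs = []" using assms by simp
  let ?I = "minhom_instances H" and ?e = "enc_minhom vs"
  show "polytime_solvable ?I ?e (minhom_solution H vs)"
  proof (rule polytime_solvableI)
    have "polytime ?I ?e (\<lambda>i. enc_map enc_row (rows vs i))"
      by (rule polytime_cong[OF polytime_self]) (rule enc_minhom_rows)
    from polytime_upt(1)[OF this] have "polytime ?I ?e (\<lambda>i. Num (size_of i))" by (simp add: rows_def)
    from polytime_If[OF polytime_eq[OF this polytime_const[of _ _ "Num 0"]] polytime_const polytime_const]
    show "polytime ?I ?e (\<lambda>i. if size_of i = 0 then Node (Num 1) (Num 0) else Num 0)" .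
    fix i assume i: "i \<in> ?I"
    obtain D c where Dc: "i = (D, c)" by fastforce
    then have D: "pair_fin_digraph D" "pverts D = {..<card (pverts D)}"
      using i by (auto simp: minhom_instances_def)
    interpret pair_fin_digraph D by (rule D(1))
    show "minhom_solution H vs i (if size_of i = 0 then Node (Num 1) (Num 0) else Num 0)"
    proof (cases "card (pverts D) = 0")
      case True
      then have "pverts D = {}" using D(2) by simp
      then have hom: "digraph_hom D H f" for f
        using in_arcsD1 by (auto simp: digraph_hom_def)
      then show ?thesis
        using True \<open>pverts D = {}\<close>
        by (auto simp: Dc size_of_def min_cost_hom_def hom_cost_def intro!: exI[of _ "[]"])
    next
      case False
      then have "\<not> digraph_hom D H f" for f using assms by (auto simp: digraph_hom_def)
      with False show ?thesis by (simp add: Dc size_of_def)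
    qed
  qed
qed

theorem MinHOM_polytime_ordered:
  fixes H :: "'a pair_pre_digraph"
  assumes refl: "\<And>u. u \<in> pverts H \<Longrightarrow> (u, u) \<in> parcs H" and ne: "pverts H \<noteq> {}"
    and hs: "distinct hs" "set hs = pverts H"
    and fwd: "\<And>i j i' j'. i' \<le> i \<Longrightarrow> i \<le> j \<Longrightarrow> j \<le> j' \<Longrightarrow> j' < length hs \<Longrightarrow>
       (hs ! i', hs ! j') \<in> parcs H \<Longrightarrow> (hs ! i, hs ! j) \<in> parcs H"
    and bwd: "\<And>i j i' j'. i' \<le> i \<Longrightarrow> i \<le> j \<Longrightarrow> j \<le> j' \<Longrightarrow> j' < length hs \<Longrightarrow>
       (hs ! j', hs ! i') \<in> parcs H \<Longrightarrow> (hs ! j, hs ! i) \<in> parcs H"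
  shows "MinHOM_polytime H"
  unfolding MinHOM_polytime_def
proof (intro allI impI, elim conjE)
  fix vs assume vs: "distinct vs" "set vs = pverts H"
  define k where "k = length vs"
  have len: "length hs = k" using hs vs by (metis distinct_card k_def)
  have vs_ne: "vs \<noteq> []" using vs ne by auto
  then have k: "0 < k" by (simp add: k_def)
  have "\<exists>m<k. vs ! m = hs ! q" if "q < k" for q
    using that hs(2) vs(2) len by (metis in_set_conv_nth k_def nth_mem)
  then obtain ordr where ordr: "\<And>q. q < k \<Longrightarrow> ordr q < k \<and> vs ! ordr q = hs ! q" by metis
  \<comment> \<open>Costs and outputs refer to the arbitrary enumeration \<open>vs\<close>, the
    algorithm to the order \<open>hs\<close>; \<open>os\<close> translates positions of the latter
    into positions of the former.\<close>
  define os where "os = map ordr [0..<k]"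
  have os: "length os = length vs" "\<And>q. q < length vs \<Longrightarrow> os ! q < length vs"
    and vs_os: "\<And>q. q < k \<Longrightarrow> vs ! (os ! q) = hs ! q"
    using ordr by (simp_all add: os_def k_def)
  define R where "R p q \<longleftrightarrow> (hs ! p, hs ! q) \<in> parcs H" for p q
  have hs_mem: "hs ! q \<in> pverts H" if "q < k" for q using nth_mem[of q hs] that hs(2) len by simp
  let ?I = "minhom_instances H"
  let ?g = "\<lambda>i. decode (length vs) (min_labels vs os R i)"
  show "polytime_solvable ?I (enc_minhom vs) (minhom_solution H vs)"
  proof (rule polytime_solvableI[OF polytime_decode[OF vs_ne os]])
    fix i assume i: "i \<in> ?I"
    obtain D c where Dc: "i = (D, c)" by fastforce
    define n where "n = card (pverts D)"
    have D: "pair_fin_digraph D" "pverts D = {..<n}"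
      and c: "\<And>u q. u < n \<Longrightarrow> q \<in> pverts H \<Longrightarrow> 0 \<le> c u q"
      using i by (auto simp: minhom_instances_def Dc n_def)
    interpret D: pair_fin_digraph D by (rule D(1))
    have arcs: "u < n \<and> v < n" if "(u, v) \<in> parcs D" for u v
      using that D.in_arcsD1 D.in_arcsD2 D(2) by auto
    have size: "size_of i = n" by (simp add: size_of_def Dc n_def)
    have adj: "adj i u v \<longleftrightarrow> (u, v) \<in> parcs D" for u v by (simp add: adj_def Dc)
    define C where "C = int_cost vs os i"
    define g where "g = decode k (min_labels vs os R i)"
    \<comment> \<open>A loss is at most the total, and a number is less than 2 to the power of its
      bit length; this is the bound that the first scaling phase requires.\<close>
    have loss: "cost_loss k C x \<le> 2 ^ floorlog 2 (total_loss vs os i)" if "x < n * k" for x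
    proof -
      have "cost_loss k C x \<le> total_loss vs os i"
        unfolding total_loss_def size C_def k_def[symmetric] by (rule member_le_sum) (use that in auto)
      also have "\<dots> < 2 ^ floorlog 2 (total_loss vs os i)"
        using floorlog_le_iff[of 2 "total_loss vs os i" "floorlog 2 (total_loss vs os i)"] by simp
      finally show ?thesis by simp
    qed
    have R: "R q q" if "q < k" for q using refl[OF hs_mem[OF that]] by (simp add: R_def)
    have Rf: "R p q" if "p' \<le> p" "p \<le> q" "q \<le> q'" "q' < k" "R p' q'" for p q p' q'
      using fwd[of p' p q q'] that by (simp add: R_def len)
    have Rb: "R q p" if "p' \<le> p" "p \<le> q" "q \<le> q'" "q' < k" "R q' p'" for p q p' q'
      using bwd[of p' p q q'] that by (simp add: R_def len)
    have g_eq: "g = decode k (implication_network.final_labels (n * k) (hom_edge k R (adj i))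
        (cost_gain k C) (cost_loss k C) (floorlog 2 (total_loss vs os i)))"
      by (simp add: g_def min_labels_def size C_def k_def)
    have g_less: "g u < k" for u
      unfolding g_eq by (rule decode_optimal(1)) (fact k R Rf Rb loss)+
    have "R (g u) (g v)" if "u < n" "v < n" "adj i u v" for u v
      using that unfolding g_eq by (rule decode_optimal(2)[rotated -3]) (fact k R Rf Rb loss)+
    then have g_hom: "R (g u) (g v)" if "(u, v) \<in> parcs D" for u v
      using arcs[OF that] that by (simp add: adj)
    have g_opt: "(\<Sum>u<n. C (u * k + g u)) \<le> (\<Sum>u<n. C (u * k + g' u))"
      if g': "\<And>u. u < n \<Longrightarrow> g' u < k" "\<And>u v. (u, v) \<in> parcs D \<Longrightarrow> R (g' u) (g' v)" for g'
    proof -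
      have g'_adj: "R (g' u) (g' v)" if "u < n" "v < n" "adj i u v" for u v
        using g'(2) that by (simp add: adj)
      show ?thesis
        unfolding g_eq by (rule decode_optimal(3)) (fact k R Rf Rb loss g'(1) g'_adj)+
    qed
    define Q where "Q = (\<Prod>y<n * k. flat vs os rat_den i y)"
    have Q: "0 < Q" unfolding Q_def flat_def by (simp add: prod_pos rat_den_pos)
    have cost: "hom_cost D c f * of_nat Q = of_nat (\<Sum>u<n. C (u * k + g' u))"
      if "\<And>u. u < n \<Longrightarrow> g' u < k" "\<And>u. u < n \<Longrightarrow> f u = hs ! g' u" for f g'
    proof -
      have "of_nat (C (u * k + g' u)) = c u (f u) * of_nat Q" if "u < n" for u
      proof -
        have "of_nat (int_cost vs os i (u * length vs + g' u)) =
            snd i u (vs ! (os ! g' u)) * of_nat (\<Prod>y<size_of i * length vs. flat vs os rat_den i y)"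
          by (rule rat_scaled_cost)
            (use \<open>u < n\<close> \<open>\<And>u. u < n \<Longrightarrow> g' u < k\<close> k c hs_mem vs_os in \<open>auto simp: size[unfolded Dc] k_def Dc\<close>)
        then show ?thesis
          using \<open>u < n\<close> \<open>\<And>u. u < n \<Longrightarrow> g' u < k\<close> \<open>\<And>u. u < n \<Longrightarrow> f u = hs ! g' u\<close> vs_os
          by (simp add: C_def Q_def size[unfolded Dc] k_def Dc)
      qed
      then show ?thesis by (simp add: hom_cost_def D(2) sum_distrib_right)
    qed
    let ?f = "\<lambda>u. hs ! g u"
    have f_hom: "digraph_hom D H ?f"
      using hs_mem g_less g_hom by (auto simp: digraph_hom_def R_def)
    have f_opt: "hom_cost D c ?f \<le> hom_cost D c f" if f: "digraph_hom D H f" for f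
    proof -
      have "\<exists>q<k. hs ! q = f u" if "u < n" for u
        using f that hs(2) len D(2) by (metis digraph_hom_def image_subset_iff in_set_conv_nth lessThan_iff)
      then obtain g' where g': "\<And>u. u < n \<Longrightarrow> g' u < k \<and> hs ! g' u = f u" by metis
      have "(\<Sum>u<n. C (u * k + g u)) \<le> (\<Sum>u<n. C (u * k + g' u))"
        by (rule g_opt) (use g' f arcs in \<open>auto simp: R_def digraph_hom_def\<close>)
      then have "(of_nat (\<Sum>u<n. C (u * k + g u)) :: rat) \<le> of_nat (\<Sum>u<n. C (u * k + g' u))"
        by (rule of_nat_mono)
      then have "hom_cost D c ?f * of_nat Q \<le> hom_cost D c f * of_nat Q"
        using cost[of g ?f] cost[of g' f] g' g_less by simp
      with Q show ?thesis by simp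
    qed
    define ks where "ks = map (\<lambda>u. os ! g u) [0..<n]"
    have agree: "vs ! (ks ! u) = hs ! g u" if "u < n" for u
      using that vs_os[OF g_less] by (simp add: ks_def)
    \<comment> \<open>The list determines the map only on \<open>{..<n}\<close>, but arcs and costs
      involve no other vertices.\<close>
    have "digraph_hom D H (\<lambda>u. vs ! (ks ! u))"
      using f_hom agree arcs by (auto simp: digraph_hom_def D(2))
    moreover have "hom_cost D c (\<lambda>u. vs ! (ks ! u)) = hom_cost D c ?f"
      unfolding hom_cost_def D(2) by (rule sum.cong) (auto simp: agree)
    ultimately have "min_cost_hom D H c (\<lambda>u. vs ! (ks ! u))"
      using f_opt by (simp add: min_cost_hom_def)
    moreover have "\<forall>q\<in>set ks. q < length vs" using os(2) g_less by (auto simp: ks_def k_def)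
    moreover have "length ks = card (pverts D)" by (simp add: ks_def n_def)
    ultimately have "minhom_solution H vs (D, c) (Node (Num 1) (enc_list (map Num ks)))"
      unfolding minhom_solution.simps using f_hom by (subst if_P) blast+
    moreover have "map (\<lambda>u. os ! ?g i u) [0..<size_of i] = ks"
      by (simp add: ks_def g_def k_def size)
    ultimately show "minhom_solution H vs i
        (Node (Num 1) (enc_list (map Num (map (\<lambda>u. os ! ?g i u) [0..<size_of i]))))"
      using Dc by simp
  qed
qed

theorem theorem2p15:
  fixes H :: "'a pair_pre_digraph"
  assumes "pair_fin_digraph H"
    and "reflexive_semicomplete H"
    and "\<not> contains_induced H digraph_R"
    and "\<not> contains_induced H reflexive_C3"
    and "proper_interval_graph (mk_symmetric (with_proj (sym_part H)))"
  shows "MinHOM_polytime H"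
proof (cases "pverts H = {}")
  case True
  then show ?thesis by (rule MinHOM_polytime_empty)
next
  case False
  show ?thesis
  proof (rule reflexive_semicomplete_order[OF assms])
    fix hs assume hs: "distinct hs" "set hs = pverts H"
      "\<And>i j i' j'. i' \<le> i \<Longrightarrow> i \<le> j \<Longrightarrow> j \<le> j' \<Longrightarrow> j' < length hs \<Longrightarrow>
         (hs ! i', hs ! j') \<in> parcs H \<Longrightarrow> (hs ! i, hs ! j) \<in> parcs H"
      "\<And>i j i' j'. i' \<le> i \<Longrightarrow> i \<le> j \<Longrightarrow> j \<le> j' \<Longrightarrow> j' < length hs \<Longrightarrow>
         (hs ! j', hs ! i') \<in> parcs H \<Longrightarrow> (hs ! j, hs ! i) \<in> parcs H"
    show ?thesis
      by (rule MinHOM_polytime_ordered[OF _ False hs])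
        (use assms(2) in \<open>auto simp: reflexive_semicomplete_def\<close>)
  qed
qed

end
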